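(* Let $\mathbb Z$ act on $\mathbb Z$ by the homomorphism $\varphi\colon\mathbb Z\to\mathrm{Aut}(\mathbb Z)=\{\pm1\}$ for which $\varphi(1)$ is multiplication by $-1$, so that $\mathbb Z\rtimes_\varphi\mathbb Z=\langle x,t\mid txt^{-1}=x^{-1}\rangle$ is the Klein bottle group. Then $\mathrm{tc}(d)=2$ for every derivation $d\colon\mathbb Z\to\mathbb Z$ relative to this action.
   Context: All groups are discrete. When $G$ (written multiplicatively) acts by automorphisms on $K$ (written additively), $(g,k)\mapsto g\cdot k$, the semi-direct product $K\rtimes G$ is the set $K\times G$ with $(k,g)(k',g')=(k+g\cdot k',gg')$, with projection $p(k,g)=g$. A derivation is a function $d\colon G\to K$ with $d(gh)=d(g)+g\cdot d(h)$; it determines the splitting $s_d(g)=(d(g),g)$ of $p$. A functorial classifying space construction gives a fibration $Bp\colon B(K\rtimes G)\to BG$ with fibre $BK$ and section $B(s_d)$. For a fibration $q\colon E\to Y$, $\mathrm{secat}(q)$ is the minimal $n$ such that $Y$ has an open cover $U_0,\dots,U_n$ with each $U_i$ admitting a section $U_i\to E$ of $q$. For a fibration $q\colon X\to B$ with section $s$, let $P_BX=\{\alpha\colon I\to X \text{ continuous}\mid q\circ\alpha \text{ constant},\ \alpha(0)=s(q(\alpha(0)))\}$ and $\mathrm{ev}_1\colon P_BX\to X$, $\alpha\mapsto\alpha(1)$. The complexity of $d$ is the $BG$-parametrized LS-category of $B(K\rtimes G)$ with respect to the section $B(s_d)$ of $Bp$, that is, $$\mathrm{tc}(d):=\mathrm{cat}_{BG}(B(K\rtimes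 G))=\mathrm{secat}\big(\mathrm{ev}_1\colon P_{BG}B(K\rtimes G)\to B(K\rtimes G)\big).$$ *)

theory Defs
  imports
    "HOL-Algebra.Bij"
    "HOL-Algebra.Elementary_Groups"
    "HOL-Analysis.Analysis"
    "HOL-Homology.Simplices"
    "HOL-Library.Extended_Nat"
begin

section \<open>Semi-direct products and derivations\<close>

text \<open>The group \<open>K\<close> is written additively in informal notation; here its operation is
  the multiplication of the record \<open>K\<close>. An action of \<open>G\<close> on \<open>K\<close> by automorphisms is a
  homomorphism \<open>\<phi> \<in> hom G (AutoGroup K)\<close>, with \<open>\<phi> g k\<close> for \<open>g \<cdot> k\<close>.\<close>

definition semidirect ::
  "('k, 'm) monoid_scheme \<Rightarrow> ('g, 'n) monoid_scheme \<Rightarrow> ('g \<Rightarrow> 'k \<Rightarrow> 'k) \<Rightarrow> ('k \<times> 'g) monoid" where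
  "semidirect K G \<phi> =
    \<lparr>carrier = carrier K \<times> carrier G,
     monoid.mult = (\<lambda>(k, g) (k', g'). (k \<otimes>\<^bsub>K\<^esub> \<phi> g k', g \<otimes>\<^bsub>G\<^esub> g')),
     one = (\<one>\<^bsub>K\<^esub>, \<one>\<^bsub>G\<^esub>)\<rparr>"

definition derivation ::
  "('k, 'm) monoid_scheme \<Rightarrow> ('g, 'n) monoid_scheme \<Rightarrow> ('g \<Rightarrow> 'k \<Rightarrow> 'k) \<Rightarrow> ('g \<Rightarrow> 'k) \<Rightarrow> bool" where
  "derivation K G \<phi> d \<longleftrightarrow>
    d \<in> carrier G \<rightarrow> carrier K \<and>
    (\<forall>g \<in> carrier G. \<forall>h \<in> carrier G. d (g \<otimes>\<^bsub>G\<^esub> h) = d g \<otimes>\<^bsub>K\<^esub> \<phi> g (d h))"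

lemma group_semidirect:
  assumes "group K" "group G" and \<phi>: "\<phi> \<in> hom G (AutoGroup K)"
  shows "group (semidirect K G \<phi>)"
proof -
  interpret K: group K by fact
  interpret G: group G by fact
  have aut: "\<phi> g \<in> auto K" if "g \<in> carrier G" for g
    using \<phi> that by (auto simp: hom_def AutoGroup_def)
  have cl: "\<phi> g k \<in> carrier K" if "g \<in> carrier G" "k \<in> carrier K" for g k
    using aut[OF that(1)] that(2) by (auto simp: auto_def hom_def)
  have add: "\<phi> g (k \<otimes>\<^bsub>K\<^esub> k') = \<phi> g k \<otimes>\<^bsub>K\<^esub> \<phi> g k'"
    if "g \<in> carrier G" "k \<in> carrier K" "k' \<in> carrier K" for g k k'
    using aut[OF that(1)] that(2,3) by (auto simp: auto_def hom_def)
  have comp: "\<phi> (g \<otimes>\<^bsub>G\<^esub> h) k = \<phi> g (\<phi> h k)"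
    if "g \<in> carrier G" "h \<in> carrier G" "k \<in> carrier K" for g h k
  proof -
    have "\<phi> (g \<otimes>\<^bsub>G\<^esub> h) = \<phi> g \<otimes>\<^bsub>AutoGroup K\<^esub> \<phi> h"
      using \<phi> that by (auto simp: hom_def)
    then show ?thesis
      using aut[OF that(1)] aut[OF that(2)] that(3)
      by (simp add: AutoGroup_def BijGroup_def auto_def compose_def)
  qed
  have one: "\<phi> \<one>\<^bsub>G\<^esub> k = k" if "k \<in> carrier K" for k
  proof -
    have "\<phi> \<one>\<^bsub>G\<^esub> (\<phi> \<one>\<^bsub>G\<^esub> k) = \<phi> \<one>\<^bsub>G\<^esub> k"
      using comp[of "\<one>\<^bsub>G\<^esub>" "\<one>\<^bsub>G\<^esub>" k] that by simp
    moreover have "inj_on (\<phi> \<one>\<^bsub>G\<^esub>) (carrier K)"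
      using aut[of "\<one>\<^bsub>G\<^esub>"] by (auto simp: auto_def Bij_def bij_betw_def)
    ultimately show ?thesis
      using that cl[of "\<one>\<^bsub>G\<^esub>" k] by (auto dest: inj_onD)
  qed
  show ?thesis
  proof (rule groupI)
    fix x assume "x \<in> carrier (semidirect K G \<phi>)"
    then obtain k g where x: "x = (k, g)" "k \<in> carrier K" "g \<in> carrier G"
      by (auto simp: semidirect_def)
    have "\<phi> (inv\<^bsub>G\<^esub> g) (inv\<^bsub>K\<^esub> k) \<otimes>\<^bsub>K\<^esub> \<phi> (inv\<^bsub>G\<^esub> g) k = \<phi> (inv\<^bsub>G\<^esub> g) \<one>\<^bsub>K\<^esub>"
      using x add[of "inv\<^bsub>G\<^esub> g" "inv\<^bsub>K\<^esub> k" k] by simp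
    moreover have "\<phi> (inv\<^bsub>G\<^esub> g) \<one>\<^bsub>K\<^esub> = \<one>\<^bsub>K\<^esub>"
      using x add[of "inv\<^bsub>G\<^esub> g" "\<one>\<^bsub>K\<^esub>" "\<one>\<^bsub>K\<^esub>"] cl[of "inv\<^bsub>G\<^esub> g" "\<one>\<^bsub>K\<^esub>"]
      by simp
    ultimately show "\<exists>y\<in>carrier (semidirect K G \<phi>).
        y \<otimes>\<^bsub>semidirect K G \<phi>\<^esub> x = \<one>\<^bsub>semidirect K G \<phi>\<^esub>"
      using x cl
      by (intro bexI[of _ "(\<phi> (inv\<^bsub>G\<^esub> g) (inv\<^bsub>K\<^esub> k), inv\<^bsub>G\<^esub> g)"])
        (auto simp: semidirect_def)
  qed (auto simp: semidirect_def cl add comp one K.m_assoc G.m_assoc)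
qed

lemma hom_snd_semidirect: "snd \<in> hom (semidirect K G \<phi>) G"
  by (auto simp: hom_def semidirect_def)

lemma hom_derivation_section:
  assumes "derivation K G \<phi> d"
  shows "(\<lambda>g. (d g, g)) \<in> hom G (semidirect K G \<phi>)"
  using assms by (auto simp: hom_def semidirect_def derivation_def)


section \<open>Classifying spaces\<close>

text \<open>\<open>BG\<close> is the geometric realization, with the weak topology, of the nerve of \<open>G\<close>
  regarded as a category with one object.

  An \<open>n\<close>-simplex of the nerve is a functor from the ordered set \<open>{0, \<dots>, n}\<close> to \<open>G\<close>, i.e. a
  family \<open>\<sigma> i j\<close> for \<open>i \<le> j \<le> n\<close> with \<open>\<sigma> i i = 1\<close> and \<open>\<sigma> i j \<cdot> \<sigma> j k = \<sigma> i k\<close>. In bar notation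
  this is \<open>[\<sigma> 0 1 | \<sigma> 1 2 | \<dots> | \<sigma> (n-1) n]\<close>. Outside the triangle \<open>i \<le> j \<le> n\<close> the value of
  \<open>\<sigma>\<close> is fixed to be \<open>undefined\<close>, so that simplices are equal iff they agree on the triangle.\<close>

definition nerve :: "('g, 'n) monoid_scheme \<Rightarrow> nat \<Rightarrow> (nat \<Rightarrow> nat \<Rightarrow> 'g) set" where
  "nerve G n =
    {\<sigma>. (\<forall>i j. i \<le> j \<and> j \<le> n \<longrightarrow> \<sigma> i j \<in> carrier G) \<and>
         (\<forall>i \<le> n. \<sigma> i i = \<one>\<^bsub>G\<^esub>) \<and>
         (\<forall>i j k. i \<le> j \<and> j \<le> k \<and> k \<le> n \<longrightarrow> \<sigma> i j \<otimes>\<^bsub>G\<^esub> \<sigma> j k = \<sigma> i k) \<and>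
         (\<forall>i j. \<not> (i \<le> j \<and> j \<le> n) \<longrightarrow> \<sigma> i j = undefined)}"

definition order_map :: "nat \<Rightarrow> nat \<Rightarrow> (nat \<Rightarrow> nat) \<Rightarrow> bool" where
  "order_map m n \<theta> \<longleftrightarrow> mono_on {..m} \<theta> \<and> \<theta> \<in> {..m} \<rightarrow> {..n}"

definition nerve_pullback ::
  "nat \<Rightarrow> (nat \<Rightarrow> nat) \<Rightarrow> (nat \<Rightarrow> nat \<Rightarrow> 'g) \<Rightarrow> nat \<Rightarrow> nat \<Rightarrow> 'g" where
  "nerve_pullback m \<theta> \<sigma> = (\<lambda>i j. if i \<le> j \<and> j \<le> m then \<sigma> (\<theta> i) (\<theta> j) else undefined)"

definition simplex_push ::
  "nat \<Rightarrow> (nat \<Rightarrow> nat) \<Rightarrow> (nat \<Rightarrow> real) \<Rightarrow> nat \<Rightarrow> real" where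
  "simplex_push m \<theta> t = (\<lambda>j. \<Sum>i | i \<le> m \<and> \<theta> i = j. t i)"

type_synonym 'g nerve_point = "(nat \<times> (nat \<Rightarrow> nat \<Rightarrow> 'g)) \<times> (nat \<Rightarrow> real)"

definition nerve_sum :: "('g, 'n) monoid_scheme \<Rightarrow> 'g nerve_point topology" where
  "nerve_sum G =
    sum_topology (\<lambda>(n, \<sigma>). subtopology (powertop_real UNIV) (standard_simplex n))
      (SIGMA n:UNIV. nerve G n)"

definition nerve_glue :: "('g, 'n) monoid_scheme \<Rightarrow> 'g nerve_point rel" where
  "nerve_glue G =
    {(((m, nerve_pullback m \<theta> \<sigma>), t), ((n, \<sigma>), simplex_push m \<theta> t)) | m n \<theta> \<sigma> t.
      order_map m n \<theta> \<and> \<sigma> \<in> nerve G n \<and> t \<in> standard_simplex m}"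

definition nerve_equiv :: "('g, 'n) monoid_scheme \<Rightarrow> 'g nerve_point rel" where
  "nerve_equiv G =
    (nerve_glue G \<union> (nerve_glue G)\<inverse>)\<^sup>* \<inter> topspace (nerve_sum G) \<times> topspace (nerve_sum G)"

definition quotient_space :: "'a topology \<Rightarrow> 'a rel \<Rightarrow> 'a set topology" where
  "quotient_space X R =
    topology (\<lambda>U. U \<subseteq> topspace X // R \<and> openin X {x \<in> topspace X. R `` {x} \<in> U})"

definition classifying_space :: "('g, 'n) monoid_scheme \<Rightarrow> 'g nerve_point set topology" where
  "classifying_space G = quotient_space (nerve_sum G) (nerve_equiv G)"

definition nerve_map :: "('g \<Rightarrow> 'h) \<Rightarrow> 'g nerve_point \<Rightarrow> 'h nerve_point" where
  "nerve_map f = (\<lambda>((n, \<sigma>), t).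
    ((n, \<lambda>i j. if i \<le> j \<and> j \<le> n then f (\<sigma> i j) else undefined), t))"

text \<open>\<open>Bf\<close> for a homomorphism \<open>f\<close> into \<open>H\<close>: the class of \<open>x\<close> goes to the class of
  \<open>nerve_map f x\<close> (see \<open>classifying_map_class\<close> below).\<close>

definition classifying_map ::
  "('h, 'n) monoid_scheme \<Rightarrow> ('g \<Rightarrow> 'h) \<Rightarrow> 'g nerve_point set \<Rightarrow> 'h nerve_point set" where
  "classifying_map H f c = nerve_equiv H `` (nerve_map f ` c)"

lemma openin_quotient_space:
  "openin (quotient_space X R) U \<longleftrightarrow>
    U \<subseteq> topspace X // R \<and> openin X {x \<in> topspace X. R `` {x} \<in> U}"
proof -
  let ?L = "\<lambda>U. U \<subseteq> topspace X // R \<and> openin X {x \<in> topspace X. R `` {x} \<in> U}"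
  have "istopology ?L"
    unfolding istopology_def
  proof (intro conjI allI impI)
    fix S T assume "?L S" "?L T"
    moreover have "{x \<in> topspace X. R `` {x} \<in> S \<inter> T} =
        {x \<in> topspace X. R `` {x} \<in> S} \<inter> {x \<in> topspace X. R `` {x} \<in> T}"
      by auto
    ultimately show "S \<inter> T \<subseteq> topspace X // R"
      "openin X {x \<in> topspace X. R `` {x} \<in> S \<inter> T}"
      by auto
  next
    fix \<K> assume K: "\<forall>S\<in>\<K>. ?L S"
    show "\<Union>\<K> \<subseteq> topspace X // R" using K by auto
    have "{x \<in> topspace X. R `` {x} \<in> \<Union>\<K>} = (\<Union>S\<in>\<K>. {x \<in> topspace X. R `` {x} \<in> S})"
      by auto
    then show "openin X {x \<in> topspace X. R `` {x} \<in> \<Union>\<K>}"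
      using K by auto
  qed
  then show ?thesis
    by (simp add: quotient_space_def)
qed

lemma topspace_quotient_space: "topspace (quotient_space X R) = topspace X // R"
proof -
  have "{x \<in> topspace X. R `` {x} \<in> topspace X // R} = topspace X"
    by (auto simp: quotient_def)
  then have "openin (quotient_space X R) (topspace X // R)"
    by (simp add: openin_quotient_space)
  then show ?thesis
    by (metis openin_quotient_space openin_subset openin_topspace subset_antisym)
qed

lemma quotient_map_quotient_space:
  "quotient_map X (quotient_space X R) (\<lambda>x. R `` {x})"
  unfolding quotient_map_def topspace_quotient_space
  by (auto simp: openin_quotient_space quotient_def)

lemma topspace_nerve_sum:
  "topspace (nerve_sum G) = {((n, \<sigma>), t). \<sigma> \<in> nerve G n \<and> t \<in> standard_simplex n}"
  by (auto simp: nerve_sum_def)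

lemma equiv_nerve_equiv: "equiv (topspace (nerve_sum G)) (nerve_equiv G)"
proof -
  let ?R = "nerve_glue G \<union> (nerve_glue G)\<inverse>"
  have "sym (?R\<^sup>*)"
    by (intro sym_rtrancl sym_Un_converse)
  then show ?thesis
    by (auto simp: equiv_def refl_on_def nerve_equiv_def sym_def
        intro!: transI dest: rtrancl_trans)
qed

lemma nerve_map_in:
  assumes "group G" "group H" "f \<in> hom G H" "x \<in> topspace (nerve_sum G)"
  shows "nerve_map f x \<in> topspace (nerve_sum H)"
proof -
  interpret group_hom G H f
    using assms by (simp add: group_hom_def group_hom_axioms_def)
  show ?thesis
    using assms(4)
    by (auto simp: topspace_nerve_sum nerve_map_def nerve_def simp flip: hom_mult)
qed

lemma nerve_map_glue:
  assumes "group G" "group H" "f \<in> hom G H" "(x, y) \<in> nerve_glue G"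
  shows "(nerve_map f x, nerve_map f y) \<in> nerve_glue H"
proof -
  obtain m n \<theta> \<sigma> t where *: "x = ((m, nerve_pullback m \<theta> \<sigma>), t)" "y = ((n, \<sigma>), simplex_push m \<theta> t)"
    "order_map m n \<theta>" "\<sigma> \<in> nerve G n" "t \<in> standard_simplex m"
    using assms(4) by (auto simp: nerve_glue_def)
  define \<tau> where "\<tau> = (\<lambda>i j. if i \<le> j \<and> j \<le> n then f (\<sigma> i j) else undefined)"
  have "((n, \<sigma>), \<lambda>j. if j = 0 then 1 else 0) \<in> topspace (nerve_sum G)"
    using * by (simp add: topspace_nerve_sum)
  then have "\<tau> \<in> nerve H n"
    using nerve_map_in[OF assms(1-3)]
    by (fastforce simp: topspace_nerve_sum nerve_map_def \<tau>_def)
  moreover have "nerve_map f x = ((m, nerve_pullback m \<theta> \<tau>), t)"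
    using *(3) by (auto simp: *(1) nerve_map_def nerve_pullback_def \<tau>_def order_map_def
        mono_on_def Pi_def fun_eq_iff)
  moreover have "nerve_map f y = ((n, \<tau>), simplex_push m \<theta> t)"
    by (simp add: * nerve_map_def \<tau>_def)
  ultimately show ?thesis
    using * unfolding nerve_glue_def by blast
qed

lemma classifying_map_class:
  assumes "group G" "group H" "f \<in> hom G H" "x \<in> topspace (nerve_sum G)"
  shows "classifying_map H f (nerve_equiv G `` {x}) = nerve_equiv H `` {nerve_map f x}"
proof -
  let ?R = "nerve_glue G \<union> (nerve_glue G)\<inverse>" and ?S = "nerve_glue H \<union> (nerve_glue H)\<inverse>"
  have "(nerve_map f x, nerve_map f y) \<in> ?S\<^sup>*" if "(x, y) \<in> ?R\<^sup>*" for y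
    using that
  proof induction
    case (step y z)
    then have "(nerve_map f y, nerve_map f z) \<in> ?S"
      using nerve_map_glue[OF assms(1-3), of y z] nerve_map_glue[OF assms(1-3), of z y] by blast
    with step.IH show ?case by (rule rtrancl_into_rtrancl)
  qed simp
  then have "(nerve_map f x, nerve_map f y) \<in> nerve_equiv H" if "(x, y) \<in> nerve_equiv G" for y
    using that nerve_map_in[OF assms(1-3)] by (auto simp: nerve_equiv_def)
  then have *: "nerve_equiv H `` {nerve_map f y} = nerve_equiv H `` {nerve_map f x}"
    if "(x, y) \<in> nerve_equiv G" for y
    using that equiv_class_eq[OF equiv_nerve_equiv] by blast
  have "(x, x) \<in> nerve_equiv G"
    using assms(4) by (simp add: nerve_equiv_def)
  moreover have "classifying_map H f (nerve_equiv G `` {x}) =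
      (\<Union>y \<in> nerve_equiv G `` {x}. nerve_equiv H `` {nerve_map f y})"
    unfolding classifying_map_def by blast
  moreover have "\<dots> = (\<Union>y \<in> nerve_equiv G `` {x}. nerve_equiv H `` {nerve_map f x})"
    using * by simp
  ultimately show ?thesis
    by blast
qed


section \<open>Sectional category and parametrized LS-category\<close>

text \<open>The infimum is over a set of naturals embedded in \<open>enat\<close>: it is the minimum if
  such an \<open>n\<close> exists, and \<open>\<infinity>\<close> otherwise.\<close>

definition secat :: "'e topology \<Rightarrow> 'y topology \<Rightarrow> ('e \<Rightarrow> 'y) \<Rightarrow> enat" where
  "secat E Y q =
    Inf {enat n | n. \<exists>U. (\<forall>i\<le>n. openin Y (U i)) \<and> (\<Union>i\<le>n. U i) = topspace Y \<and>
      (\<forall>i\<le>n. \<exists>s. continuous_map (subtopology Y (U i)) E s \<and> (\<forall>y \<in> U i. q (s y) = y))}"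

text \<open>Maps are made extensional on the source, so that they are determined by their
  values there.\<close>

definition compact_open :: "'a topology \<Rightarrow> 'b topology \<Rightarrow> ('a \<Rightarrow> 'b) topology" where
  "compact_open A X =
    topology_generated_by
      {{\<alpha> \<in> extensional (topspace A). continuous_map A X \<alpha> \<and> \<alpha> ` C \<subseteq> V} | C V.
        compactin A C \<and> openin X V}"

text \<open>For \<open>q: X \<rightarrow> B\<close> with section \<open>s\<close>, the space \<open>P\<^sub>B X\<close> of paths in \<open>X\<close> that lie in a fibre
  of \<open>q\<close> and start on the section.\<close>

definition fibre_path_space ::
  "'x topology \<Rightarrow> ('x \<Rightarrow> 'b) \<Rightarrow> ('b \<Rightarrow> 'x) \<Rightarrow> (real \<Rightarrow> 'x) topology" where
  "fibre_path_space X q s =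
    subtopology (compact_open (top_of_set {0..1}) X)
      {\<alpha>. (\<exists>b. \<forall>u \<in> {0..1}. q (\<alpha> u) = b) \<and> \<alpha> 0 = s (q (\<alpha> 0))}"

definition parametrized_cat :: "'x topology \<Rightarrow> ('x \<Rightarrow> 'b) \<Rightarrow> ('b \<Rightarrow> 'x) \<Rightarrow> enat" where
  "parametrized_cat X q s = secat (fibre_path_space X q s) X (\<lambda>\<alpha>. \<alpha> 1)"

definition tc ::
  "('k, 'm) monoid_scheme \<Rightarrow> ('g, 'n) monoid_scheme \<Rightarrow> ('g \<Rightarrow> 'k \<Rightarrow> 'k) \<Rightarrow> ('g \<Rightarrow> 'k) \<Rightarrow> enat" where
  "tc K G \<phi> d =
    parametrized_cat (classifying_space (semidirect K G \<phi>))
      (classifying_map G snd)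
      (classifying_map (semidirect K G \<phi>) (\<lambda>g. (d g, g)))"

end

theory Submission
  imports Defs
begin

text \<open>
  Write \<open>\<Gamma>\<close> for the Klein bottle group \<open>\<int> \<rtimes> \<int>\<close> and \<open>X\<close> for its classifying space. A section over
  \<open>U \<subseteq> X\<close> of the evaluation \<open>P X \<rightarrow> X\<close> deforms \<open>U\<close> along the fibres into the image of
  \<open>B(s\<^sub>d)\<close>. As the fibres are aspherical, such a deformation amounts to a section over \<open>U\<close> of the
  covering of \<open>X\<close> with fibre \<open>\<Gamma> / s\<^sub>d(\<int>)\<close>, so \<open>tc(d)\<close> is the sectional category of this
  covering. It is at most \<open>2\<close> because \<open>X\<close> is a surface up to homotopy. It is at least \<open>2\<close>
  because the class \<open>u \<in> H\<^sup>1(X; \<int>/2)\<close> of \<open>(k, g) \<mapsto> k - d g\<close> vanishes on the covering while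
  \<open>u\<^sup>2 \<noteq> 0\<close>. The form of this used below is that \<open>u\<close> is not the reduction of a homomorphism
  \<open>\<Gamma> \<rightarrow> \<int>\<close>, whereas two open sets that cover \<open>X\<close> and on which \<open>u\<close> vanishes would make it one.
  Both halves are made explicit, without covering spaces or cohomology.

  Throughout, a point of \<open>X\<close> with barycentric coordinates \<open>t\<^sub>0, \<dots>, t\<^sub>n\<close> in the simplex with vertices
  \<open>v\<^sub>0, \<dots>, v\<^sub>n \<in> \<Gamma>\<close> is thought of as the step function on \<open>[0, 1]\<close> whose value on the \<open>i\<close>-th
  of consecutive intervals of lengths \<open>t\<^sub>0, \<dots>, t\<^sub>n\<close> is \<open>v\<^sub>i\<close>. Faces and degeneracies do not change
  this step function, and \<open>X\<close> consists of the step functions up to left translation by \<open>\<Gamma>\<close>.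

  For the upper bound, a section over \<open>U\<close> comes from a locally constant choice, for each point of
  \<open>U\<close>, of an element \<open>c\<close> of the kernel of \<open>\<Gamma> \<rightarrow> \<int>\<close> that depends equivariantly on the chosen
  vertices (\<open>section_over_labelled_set\<close>): the path replaces the values \<open>v\<^sub>j\<close> by \<open>c s(p(v\<^sub>j))\<close> to the
  left of a cut that moves across \<open>[0, 1]\<close>. Now \<open>\<Gamma>\<close> acts on the plane by affine isometries, and
  averaging the orbit of the origin with weights \<open>t\<^sub>i\<close> maps step functions equivariantly to the
  plane (\<open>develop\<close>). So it suffices to cover the plane by three invariant open sets, each with
  an equivariant locally constant map to \<open>\<int>\<close>: vertical strips around the lines with integral
  abscissa, and two brick patterns for what is left.

  For the lower bound, the signs \<open>(-1)\<^sup>u\<close> turn a step function into one with values \<open>\<plusminus>1\<close>, defined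
  up to a global sign. Its integrals over \<open>[0, a]\<close> are defined up to a common sign, so their
  products are continuous functions on \<open>X\<close>, and choosing square roots of these products is choosing
  a sheet of the double covering of \<open>u\<close>. The roots are canonical on the image of \<open>B(s\<^sub>d)\<close>, and a
  section over \<open>U\<close> transports them to \<open>U\<close> (\<open>root_exists\<close>). Let two such sets \<open>U\<close> cover
  \<open>X\<close>, and pull everything back along the map from the unit square that wraps it around the Klein
  bottle. A partition of unity combines the two choices of signs into a nowhere zero complex function
  on the square that changes sign from the left to the right edge. Its logarithm changes by a fixed
  odd multiple of \<open>\<pi> \<i>\<close> from left to right; but the top edge is glued to the bottom edge with a flip,
  so this number is its own negative (\<open>no_odd_function_on_klein_square\<close>).
\<close>

section \<open>Points of a realization as subdivided intervals\<close>

text \<open>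
  The length of the part of the \<open>i\<close>-th interval that lies in \<open>[0, a]\<close>. Written as a difference of
  truncated partial sums, it telescopes over blocks of consecutive intervals.
\<close>

definition part_below :: "(nat \<Rightarrow> real) \<Rightarrow> real \<Rightarrow> nat \<Rightarrow> real" where
  "part_below t a i = min a (\<Sum>l<Suc i. t l) - min a (\<Sum>l<i. t l)"

lemma initial_segment:
  fixes A :: "nat set"
  assumes "A \<subseteq> {..m}" "\<And>i k. k \<in> A \<Longrightarrow> i \<le> k \<Longrightarrow> i \<in> A"
  obtains r where "A = {..<r}"
proof -
  have ex: "Suc m \<notin> A" using assms(1) by auto
  define r where "r = (LEAST i. i \<notin> A)"
  have "r \<notin> A" unfolding r_def by (rule LeastI, rule ex)
  moreover have "i \<in> A" if "i < r" for i
    using that not_less_Least unfolding r_def by blast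
  ultimately have "A = {..<r}"
    using assms(2) by (metis lessThan_iff not_le subsetI subset_antisym)
  then show thesis by (rule that)
qed

lemma sum_simplex_push_less:
  "(\<Sum>l<j. simplex_push m \<theta> t l) = (\<Sum>i | i \<le> m \<and> \<theta> i < j. t i)"
proof -
  have "(\<Sum>l<j. sum t {i \<in> {i. i \<le> m \<and> \<theta> i < j}. \<theta> i = l}) = (\<Sum>i | i \<le> m \<and> \<theta> i < j. t i)"
    by (rule sum.group) auto
  moreover have "simplex_push m \<theta> t l = sum t {i \<in> {i. i \<le> m \<and> \<theta> i < j}. \<theta> i = l}" if "l < j" for l
    using that unfolding simplex_push_def by (intro sum.cong) auto
  ultimately show ?thesis by simp
qed

text \<open>
  A monotone \<open>\<theta>\<close> merges blocks of consecutive intervals and inserts empty ones, so it does not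
  matter whether the subdivision is first pushed forward or first cut at \<open>a\<close>. This is what makes
  constructions with cut points compatible with the gluing of simplices.
\<close>

lemma simplex_push_part_below:
  assumes "order_map m n \<theta>"
  shows "simplex_push m \<theta> (part_below t a) j = part_below (simplex_push m \<theta> t) a j"
proof -
  have mono: "\<theta> i \<le> \<theta> k" if "i \<le> k" "k \<le> m" for i k
    using assms that by (auto simp: order_map_def mono_on_def)
  have seg: "\<exists>r. {i. i \<le> m \<and> \<theta> i < j} = {..<r}" for j
  proof (rule initial_segment[of "{i. i \<le> m \<and> \<theta> i < j}" m])
    show "i \<in> {i. i \<le> m \<and> \<theta> i < j}" if "k \<in> {i. i \<le> m \<and> \<theta> i < j}" "i \<le> k" for i k
      using that mono[of i k] by auto
  qed auto
  obtain r where r: "{i. i \<le> m \<and> \<theta> i < j} = {..<r}" using seg by blast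
  obtain r' where r': "{i. i \<le> m \<and> \<theta> i < Suc j} = {..<r'}" using seg by blast
  have "{..<r} \<subseteq> {..<r'}" unfolding r[symmetric] r'[symmetric] by auto
  then have rr: "r \<le> r'" by (simp add: lessThan_subset_iff)
  have "{i. i \<le> m \<and> \<theta> i = j} = {i. i \<le> m \<and> \<theta> i < Suc j} - {i. i \<le> m \<and> \<theta> i < j}"
    by auto
  then have blk: "{i. i \<le> m \<and> \<theta> i = j} = {r..<r'}"
    unfolding r r' by auto
  have "simplex_push m \<theta> (part_below t a) j = (\<Sum>i\<in>{r..<r'}. part_below t a i)"
    by (simp add: simplex_push_def blk)
  also have "\<dots> = min a (\<Sum>l<r'. t l) - min a (\<Sum>l<r. t l)"
    unfolding part_below_def
    using sum_Suc_diff'[OF rr, of "\<lambda>i. min a (\<Sum>l<i. t l)"] by simp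
  also have "\<dots> = part_below (simplex_push m \<theta> t) a j"
    unfolding part_below_def sum_simplex_push_less r r' ..
  finally show ?thesis .
qed

lemma part_below_bounds:
  assumes "0 \<le> t i"
  shows "0 \<le> part_below t a i" "part_below t a i \<le> t i"
  using assms by (auto simp: part_below_def)

lemma sum_part_below: "(\<Sum>i<r. part_below t a i) = min a (\<Sum>l<r. t l) - min a 0"
  unfolding part_below_def
  using sum_Suc_diff'[of 0 r "\<lambda>i. min a (\<Sum>l<i. t l)"] by (simp add: atLeast0LessThan)

lemma simplexD:
  assumes "t \<in> standard_simplex n"
  shows "0 \<le> t i" "t i \<le> 1" "i > n \<Longrightarrow> t i = 0" "(\<Sum>i\<le>n. t i) = 1"
    "(\<Sum>l<j. t l) \<le> 1" "0 \<le> (\<Sum>l<j. t l)"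
proof -
  show "0 \<le> t i" "t i \<le> 1" "i > n \<Longrightarrow> t i = 0" and 1: "(\<Sum>i\<le>n. t i) = 1"
    using assms by (auto simp: standard_simplex_def)
  have nn: "\<And>i. 0 \<le> t i" and z: "\<And>i. i > n \<Longrightarrow> t i = 0"
    using assms by (auto simp: standard_simplex_def)
  show "0 \<le> (\<Sum>l<j. t l)" by (simp add: nn sum_nonneg)
  have "(\<Sum>l<j. t l) \<le> (\<Sum>l\<in>{..<j} \<union> {..n}. t l)" by (rule sum_mono2) (auto simp: nn)
  also have "\<dots> = (\<Sum>l\<le>n. t l)"
    by (rule sum.mono_neutral_right) (auto simp: z)
  finally show "(\<Sum>l<j. t l) \<le> 1" using 1 by simp
qed

lemma simplexI:
  assumes "\<And>i. 0 \<le> t i" "\<And>i. i > n \<Longrightarrow> t i = 0" "(\<Sum>i\<le>n. t i) = 1"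
  shows "t \<in> standard_simplex n"
proof -
  have "t i \<le> 1" for i
  proof (cases "i \<le> n")
    case True
    then have "t i \<le> (\<Sum>i\<le>n. t i)" by (intro member_le_sum) (auto simp: assms)
    then show ?thesis using assms by simp
  qed (simp add: assms)
  then show ?thesis using assms by (auto simp: standard_simplex_def)
qed

lemma simplex_push_in:
  assumes "order_map m n \<theta>" "t \<in> standard_simplex m"
  shows "simplex_push m \<theta> t \<in> standard_simplex n"
proof (rule simplexI)
  have \<theta>: "\<theta> i \<le> n" if "i \<le> m" for i using assms(1) that by (auto simp: order_map_def)
  show "0 \<le> simplex_push m \<theta> t i" for i
    by (auto simp: simplex_push_def intro!: sum_nonneg simplexD[OF assms(2)])
  show "simplex_push m \<theta> t i = 0" if "i > n" for i
  proof -
    have "{k. k \<le> m \<and> \<theta> k = i} = {}" using \<theta> that by fastforce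
    then show ?thesis unfolding simplex_push_def by (simp only: sum.empty)
  qed
  have "(\<Sum>i\<le>n. simplex_push m \<theta> t i) = (\<Sum>i | i \<le> m \<and> \<theta> i < Suc n. t i)"
    using sum_simplex_push_less[of m \<theta> t "Suc n"] by (simp add: lessThan_Suc_atMost)
  also have "{i. i \<le> m \<and> \<theta> i < Suc n} = {..m}" using \<theta> by (auto simp: less_Suc_eq_le)
  finally show "(\<Sum>i\<le>n. simplex_push m \<theta> t i) = 1" using simplexD(4)[OF assms(2)] by simp
qed

lemma part_below_one:
  assumes "t \<in> standard_simplex n"
  shows "part_below t 1 i = t i" "part_below t 0 i = 0"
  using simplexD(5,6)[OF assms, of i] simplexD(5,6)[OF assms, of "Suc i"]
  by (simp_all add: part_below_def)

text \<open>
  In \<open>cut_point_glue\<close> this is applied to a map \<open>\<theta>\<close> of doubled indices that is not monotone.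
\<close>

lemma simplex_push_comp:
  assumes "\<iota> \<in> {..k} \<rightarrow> {..m}"
  shows "simplex_push m \<theta> (simplex_push k \<iota> t) = simplex_push k (\<theta> \<circ> \<iota>) t"
proof
  fix j
  have "(\<Sum>i | i \<le> m \<and> \<theta> i = j. sum t {l \<in> {l. l \<le> k \<and> \<theta> (\<iota> l) = j}. \<iota> l = i})
      = (\<Sum>l | l \<le> k \<and> \<theta> (\<iota> l) = j. t l)"
    using assms by (intro sum.group) auto
  moreover have "simplex_push k \<iota> t i = sum t {l \<in> {l. l \<le> k \<and> \<theta> (\<iota> l) = j}. \<iota> l = i}"
    if "\<theta> i = j" for i
    using that unfolding simplex_push_def by (intro sum.cong) auto
  ultimately show "simplex_push m \<theta> (simplex_push k \<iota> t) j = simplex_push k (\<theta> \<circ> \<iota>) t j"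
    by (simp add: simplex_push_def)
qed


lemma sum_simplex_push_mult:
  assumes "order_map m n \<theta>"
  shows "(\<Sum>j\<le>n. simplex_push m \<theta> t j * f j) = (\<Sum>i\<le>m. t i * f (\<theta> i))"
proof -
  have "(\<Sum>j\<le>n. \<Sum>i\<in>{i \<in> {..m}. \<theta> i = j}. t i * f (\<theta> i)) = (\<Sum>i\<le>m. t i * f (\<theta> i))"
    using assms by (intro sum.group) (auto simp: order_map_def)
  moreover have "(\<Sum>i\<in>{i \<in> {..m}. \<theta> i = j}. t i * f (\<theta> i)) = simplex_push m \<theta> t j * f j" for j
    by (simp add: simplex_push_def sum_distrib_right)
  ultimately show ?thesis by simp
qed

section \<open>Classes of points and continuous maps\<close>

abbreviation simplex_top :: "nat \<Rightarrow> (nat \<Rightarrow> real) topology" where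
  "simplex_top n \<equiv> subtopology (powertop_real UNIV) (standard_simplex n)"

lemma nerve_pullback_in:
  assumes "order_map m n \<theta>" "\<sigma> \<in> nerve G n"
  shows "nerve_pullback m \<theta> \<sigma> \<in> nerve G m"
proof -
  have \<theta>: "\<theta> i \<le> n" if "i \<le> m" for i using assms(1) that by (auto simp: order_map_def)
  have mono: "\<theta> i \<le> \<theta> k" if "i \<le> k" "k \<le> m" for i k
    using assms that by (auto simp: order_map_def mono_on_def)
  show ?thesis using assms(2) \<theta> mono unfolding nerve_def nerve_pullback_def by auto
qed

lemma nerve_glue_topspace:
  assumes "(x, y) \<in> nerve_glue G"
  shows "x \<in> topspace (nerve_sum G)" "y \<in> topspace (nerve_sum G)"
  using assms nerve_pullback_in simplex_push_in
  by (fastforce simp: nerve_glue_def topspace_nerve_sum)+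

lemma nerve_glueI:
  assumes "order_map m n \<theta>" "\<sigma> \<in> nerve G n" "t \<in> standard_simplex m"
    "\<tau> = nerve_pullback m \<theta> \<sigma>" "t' = simplex_push m \<theta> t"
  shows "(((m, \<tau>), t), ((n, \<sigma>), t')) \<in> nerve_glue G"
  using assms unfolding nerve_glue_def by blast

lemma nerve_glue_class:
  assumes "(x, y) \<in> nerve_glue G"
  shows "nerve_equiv G `` {x} = nerve_equiv G `` {y}"
proof -
  have "(x, y) \<in> nerve_equiv G"
    using assms nerve_glue_topspace[OF assms] by (auto simp: nerve_equiv_def)
  then show ?thesis using equiv_class_eq[OF equiv_nerve_equiv] by blast
qed

lemma nerve_equiv_invariant:
  assumes "\<And>x y. (x, y) \<in> nerve_glue G \<Longrightarrow> f x = f y" "(x, y) \<in> nerve_equiv G"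
  shows "f x = f y"
proof -
  have "(x, y) \<in> (nerve_glue G \<union> (nerve_glue G)\<inverse>)\<^sup>*"
    using assms(2) by (auto simp: nerve_equiv_def)
  then show ?thesis
    by induction (auto dest: assms(1))
qed

lemma topspace_classifying_space:
  "topspace (classifying_space G) = topspace (nerve_sum G) // nerve_equiv G"
  by (simp add: classifying_space_def topspace_quotient_space)

lemma class_in_classifying_space:
  "x \<in> topspace (nerve_sum G) \<Longrightarrow> nerve_equiv G `` {x} \<in> topspace (classifying_space G)"
  by (simp add: topspace_classifying_space quotientI)

lemma class_eq_iff:
  assumes "x \<in> topspace (nerve_sum G)" "y \<in> topspace (nerve_sum G)"
  shows "nerve_equiv G `` {x} = nerve_equiv G `` {y} \<longleftrightarrow> (x, y) \<in> nerve_equiv G"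
  using eq_equiv_class_iff[OF equiv_nerve_equiv assms] .

lemma quotient_map_classifying:
  "quotient_map (nerve_sum G) (classifying_space G) (\<lambda>x. nerve_equiv G `` {x})"
  unfolding classifying_space_def by (rule quotient_map_quotient_space)

lemma openin_nerve_sum:
  "openin (nerve_sum G) U \<longleftrightarrow> U \<subseteq> topspace (nerve_sum G) \<and>
    (\<forall>n. \<forall>\<sigma> \<in> nerve G n. openin (simplex_top n) {t. ((n, \<sigma>), t) \<in> U})"
  by (auto simp: nerve_sum_def openin_sum_topology)

text \<open>
  A map out of a disjoint sum is continuous when it is so on each summand; with
  \<open>quotient_map_classifying\<close> this reduces continuity on a classifying space to single simplices.
\<close>

lemma continuous_map_nerve_sum:
  assumes "\<And>n \<sigma>. \<sigma> \<in> nerve G n \<Longrightarrow> continuous_map (simplex_top n) Y (\<lambda>t. f ((n, \<sigma>), t))"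
  shows "continuous_map (nerve_sum G) Y f"
  unfolding continuous_map_alt
proof (intro conjI allI impI)
  show "f \<in> topspace (nerve_sum G) \<rightarrow> topspace Y"
    using assms by (fastforce simp: topspace_nerve_sum continuous_map_def Pi_iff)
  fix W assume W: "openin Y W"
  have "openin (simplex_top n) {t. ((n, \<sigma>), t) \<in> f -` W \<inter> topspace (nerve_sum G)}"
    if "\<sigma> \<in> nerve G n" for n \<sigma>
  proof -
    have "{t. ((n, \<sigma>), t) \<in> f -` W \<inter> topspace (nerve_sum G)} =
       {t \<in> topspace (simplex_top n). f ((n, \<sigma>), t) \<in> W}"
      using that by (auto simp: topspace_nerve_sum)
    then show ?thesis using assms[OF that] W openin_continuous_map_preimage by fastforce
  qed
  then show "openin (nerve_sum G) (f -` W \<inter> topspace (nerve_sum G))"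
    by (simp add: openin_nerve_sum)
qed

lemma continuous_map_simplex_class:
  assumes "\<sigma> \<in> nerve G n"
  shows "continuous_map (simplex_top n) (classifying_space G) (\<lambda>t. nerve_equiv G `` {((n, \<sigma>), t)})"
proof -
  have "continuous_map (simplex_top n) (nerve_sum G) (\<lambda>t. ((n, \<sigma>), t))"
    using continuous_map_component_injection[of "(n, \<sigma>)" "SIGMA n:UNIV. nerve G n"
        "\<lambda>(n, \<sigma>). simplex_top n"] assms
    by (simp add: nerve_sum_def)
  from continuous_map_compose[OF this quotient_imp_continuous_map[OF quotient_map_classifying]]
  show ?thesis by (simp add: o_def)
qed

section \<open>Simplices with prescribed vertices\<close>

text \<open>
  A simplex of the nerve is determined by the group elements at its vertices, up to a common left
  factor. In this description pulling back along \<open>\<theta>\<close> is composition with \<open>\<theta>\<close>.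
\<close>

definition vertex_simplex :: "('g, 'n) monoid_scheme \<Rightarrow> nat \<Rightarrow> (nat \<Rightarrow> 'g) \<Rightarrow> nat \<Rightarrow> nat \<Rightarrow> 'g" where
  "vertex_simplex G n v =
    (\<lambda>i j. if i \<le> j \<and> j \<le> n then inv\<^bsub>G\<^esub> (v i) \<otimes>\<^bsub>G\<^esub> v j else undefined)"

lemma vertex_simplex_cong:
  assumes "\<And>j. j \<le> n \<Longrightarrow> v j = v' j"
  shows "vertex_simplex G n v = vertex_simplex G n v'"
  using assms by (auto simp: vertex_simplex_def fun_eq_iff)

lemma vertex_simplex_in_nerve:
  assumes "group G" "\<And>j. j \<le> n \<Longrightarrow> v j \<in> carrier G"
  shows "vertex_simplex G n v \<in> nerve G n"
proof -
  interpret group G by fact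
  have "inv\<^bsub>G\<^esub> v i \<otimes>\<^bsub>G\<^esub> v j \<otimes>\<^bsub>G\<^esub> (inv\<^bsub>G\<^esub> v j \<otimes>\<^bsub>G\<^esub> v k) = inv\<^bsub>G\<^esub> v i \<otimes>\<^bsub>G\<^esub> v k"
    if "v i \<in> carrier G" "v j \<in> carrier G" "v k \<in> carrier G" for i j k
  proof -
    have "v j \<otimes>\<^bsub>G\<^esub> (inv\<^bsub>G\<^esub> v j \<otimes>\<^bsub>G\<^esub> v k) = v k"
      using that by (simp add: m_assoc[symmetric])
    then show ?thesis using that by (simp add: m_assoc)
  qed
  then show ?thesis
    using assms(2) by (auto simp: nerve_def vertex_simplex_def)
qed

text \<open>
  Every simplex arises in this way: its first vertex may be put at the neutral element.
\<close>

lemma vertex_simplex_nerve: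
  assumes "group G" "\<sigma> \<in> nerve G n"
  shows "vertex_simplex G n (\<sigma> 0) = \<sigma>"
proof (intro ext)
  fix i j
  interpret group G by fact
  show "vertex_simplex G n (\<sigma> 0) i j = \<sigma> i j"
  proof (cases "i \<le> j \<and> j \<le> n")
    case True
    have *: "\<sigma> 0 i \<otimes>\<^bsub>G\<^esub> \<sigma> i j = \<sigma> 0 j" "\<sigma> 0 i \<in> carrier G" "\<sigma> 0 j \<in> carrier G" "\<sigma> i j \<in> carrier G"
      using assms(2) True unfolding nerve_def by auto
    have "inv\<^bsub>G\<^esub> \<sigma> 0 i \<otimes>\<^bsub>G\<^esub> \<sigma> 0 j = \<sigma> i j"
      using * by (metis inv_closed l_inv l_one m_assoc)
    then show ?thesis using True by (simp add: vertex_simplex_def)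
  next
    case False
    then show ?thesis using assms(2) by (auto simp: vertex_simplex_def nerve_def)
  qed
qed

lemma nerve_in_carrier:
  "\<sigma> \<in> nerve G n \<Longrightarrow> i \<le> j \<Longrightarrow> j \<le> n \<Longrightarrow> \<sigma> i j \<in> carrier G"
  by (auto simp: nerve_def)

lemma nerve_pullback_vertex_simplex:
  assumes "order_map m n \<theta>"
  shows "nerve_pullback m \<theta> (vertex_simplex G n v) = vertex_simplex G m (v \<circ> \<theta>)"
  using assms
  by (auto simp: nerve_pullback_def vertex_simplex_def order_map_def mono_on_def fun_eq_iff Pi_iff)

lemma vertex_simplex_translate:
  assumes "group G" "\<gamma> \<in> carrier G" "\<And>j. j \<le> n \<Longrightarrow> v j \<in> carrier G"
  shows "vertex_simplex G n (\<lambda>j. \<gamma> \<otimes>\<^bsub>G\<^esub> v j) = vertex_simplex G n v"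
proof -
  interpret group G by fact
  have "inv\<^bsub>G\<^esub> (\<gamma> \<otimes>\<^bsub>G\<^esub> a) \<otimes>\<^bsub>G\<^esub> (\<gamma> \<otimes>\<^bsub>G\<^esub> b) = inv\<^bsub>G\<^esub> a \<otimes>\<^bsub>G\<^esub> b"
    if "a \<in> carrier G" "b \<in> carrier G" for a b
  proof -
    have "inv\<^bsub>G\<^esub> \<gamma> \<otimes>\<^bsub>G\<^esub> (\<gamma> \<otimes>\<^bsub>G\<^esub> b) = b"
      using that assms(2) by (simp add: m_assoc[symmetric])
    then show ?thesis using that assms(2) by (simp add: inv_mult_group m_assoc)
  qed
  then show ?thesis using assms(3) by (auto simp: vertex_simplex_def fun_eq_iff)
qed

lemma nerve_map_vertex_simplex:
  assumes "group G" "group H" "f \<in> hom G H" "\<And>j. j \<le> n \<Longrightarrow> v j \<in> carrier G"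
  shows "nerve_map f ((n, vertex_simplex G n v), t) = ((n, vertex_simplex H n (f \<circ> v)), t)"
proof -
  interpret group_hom G H f
    using assms by (simp add: group_hom_def group_hom_axioms_def)
  show ?thesis using assms(4) by (auto simp: nerve_map_def vertex_simplex_def fun_eq_iff)
qed

lemma vertex_simplex_class_eq:
  assumes "group G" "order_map m n \<theta>" "\<And>j. j \<le> n \<Longrightarrow> v j \<in> carrier G" "t \<in> standard_simplex m"
    "\<And>j. j \<le> m \<Longrightarrow> v' j = v (\<theta> j)" "t' = simplex_push m \<theta> t"
  shows "nerve_equiv G `` {((m, vertex_simplex G m v'), t)}
    = nerve_equiv G `` {((n, vertex_simplex G n v), t')}"
proof (rule nerve_glue_class, rule nerve_glueI)
  show "vertex_simplex G m v' = nerve_pullback m \<theta> (vertex_simplex G n v)"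
    unfolding nerve_pullback_vertex_simplex[OF assms(2)]
    by (intro vertex_simplex_cong) (simp add: assms(5))
  show "vertex_simplex G n v \<in> nerve G n"
    using assms(1,3) by (rule vertex_simplex_in_nerve)
qed (use assms in auto)

section \<open>Sliding a point along a prism\<close>

text \<open>
  The vertices of a prism \<open>\<Delta>\<^sup>n \<times> [0, 1]\<close> in the order bottom, top, bottom, top, and so on.
\<close>

definition interleave :: "(nat \<Rightarrow> 'a) \<Rightarrow> (nat \<Rightarrow> 'a) \<Rightarrow> nat \<Rightarrow> 'a" where
  "interleave h g l = (if even l then h (l div 2) else g (l div 2))"

abbreviation cut_weights :: "(nat \<Rightarrow> real) \<Rightarrow> real \<Rightarrow> nat \<Rightarrow> real" where
  "cut_weights t a \<equiv> interleave (part_below t a) (\<lambda>i. t i - part_below t a i)"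

text \<open>
  The step function with values \<open>h\<^sub>j\<close> to the left of \<open>a\<close> and \<open>g\<^sub>j\<close> to the right of \<open>a\<close>. It lies in one
  of the \<open>n + 1\<close> simplices \<open>h\<^sub>0, \<dots>, h\<^sub>i, g\<^sub>i, \<dots>, g\<^sub>n\<close> of the prism, where \<open>i\<close> is the interval that
  contains \<open>a\<close>. These simplices are all faces of the single simplex \<open>h\<^sub>0, g\<^sub>0, h\<^sub>1, g\<^sub>1, \<dots>\<close>; using
  it for all \<open>a\<close> makes continuity in \<open>a\<close> immediate, with no pieces to be matched.
\<close>

definition cut_point ::
  "('g, 'n) monoid_scheme \<Rightarrow> nat \<Rightarrow> (nat \<Rightarrow> 'g) \<Rightarrow> (nat \<Rightarrow> 'g) \<Rightarrow> (nat \<Rightarrow> real) \<Rightarrow> real \<Rightarrow> 'g nerve_point"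
  where "cut_point G n h g t a =
    ((2 * n + 1, vertex_simplex G (2 * n + 1) (interleave h g)), cut_weights t a)"

lemma interleave_simps [simp]:
  "interleave h g (2 * i) = h i" "interleave h g (Suc (2 * i)) = g i"
  by (simp_all add: interleave_def)

lemma interleave_ext:
  assumes "\<And>i. f (2 * i) = h i" "\<And>i. f (Suc (2 * i)) = g i"
  shows "f = interleave h g"
proof
  fix l show "f l = interleave h g l"
    using assms by (cases l rule: parity_cases) (auto elim!: evenE oddE)
qed

lemma interleave_carrier:
  assumes "\<And>j. j \<le> n \<Longrightarrow> h j \<in> A" "\<And>j. j \<le> n \<Longrightarrow> g j \<in> A" "l \<le> 2 * n + 1"
  shows "interleave h g l \<in> A"
proof -
  have "l div 2 \<le> n" using assms(3) by simp
  then show ?thesis using assms(1,2) by (simp add: interleave_def)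
qed

text \<open>
  Only one of the intervals is really cut, so the weights are carried by the face of the prism
  simplex with vertices \<open>h\<^sub>0, \<dots>, h\<^bsub>i0\<^esub>, g\<^bsub>i0\<^esub>, \<dots>, g\<^sub>m\<close>.
\<close>

lemma cut_weights_push:
  assumes t: "t \<in> standard_simplex m" and a: "0 \<le> a" "a \<le> 1"
  obtains i0 e where "i0 \<le> m" "e \<in> standard_simplex (Suc m)"
    "simplex_push (Suc m) (\<lambda>l. if l \<le> i0 then 2 * l else 2 * l - 1) e = cut_weights t a"
proof -
  define S where "S i = (\<Sum>l<i. t l)" for i
  have S1: "S (Suc m) = 1" using simplexD(4)[OF t] by (simp add: S_def lessThan_Suc_atMost)
  have Smono: "S i \<le> S j" if "i \<le> j" for i j
    unfolding S_def using that by (intro sum_mono2) (auto simp: simplexD[OF t])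
  \<comment> \<open>The number of the interval that contains \<open>a\<close>.\<close>
  define i0 where "i0 = (LEAST i. a \<le> S (Suc i))"
  have up: "a \<le> S (Suc i0)" unfolding i0_def by (rule LeastI[of _ m]) (simp add: S1 a)
  have i0m: "i0 \<le> m" unfolding i0_def by (rule Least_le) (simp add: S1 a)
  have lo: "S i0 \<le> a"
  proof (cases i0)
    case 0 then show ?thesis using a by (simp add: S_def)
  next
    case (Suc k)
    then have "\<not> a \<le> S (Suc k)" unfolding i0_def using not_less_Least[of k] by force
    then show ?thesis using Suc by simp
  qed
  have pb_hi: "part_below t a i = 0" if "i > i0" for i
  proof -
    have "a \<le> S i" "a \<le> S (Suc i)" using up Smono[of "Suc i0" i] Smono[of "Suc i0" "Suc i"] that by auto
    then show ?thesis by (simp add: part_below_def S_def)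
  qed
  have pb_lo: "part_below t a i = t i" if "i < i0" for i
  proof -
    have "S i \<le> a" "S (Suc i) \<le> a" using lo Smono[of i i0] Smono[of "Suc i" i0] that by auto
    then show ?thesis by (simp add: part_below_def S_def)
  qed
  define e where "e l = (if l \<le> i0 then part_below t a l else t (l - 1) - part_below t a (l - 1))" for l
  define \<iota> where "\<iota> l = (if l \<le> i0 then 2 * l else 2 * l - 1)" for l :: nat
  have e: "e \<in> standard_simplex (Suc m)"
  proof (rule simplexI)
    show "0 \<le> e i" for i using part_below_bounds simplexD(1)[OF t] by (simp add: e_def)
    show "e i = 0" if "i > Suc m" for i
    proof -
      have "t (i - 1) = 0" using that simplexD(3)[OF t, of "i - 1"] by simp
      moreover have "part_below t a (i - 1) = 0" using pb_hi[of "i - 1"] that i0m by simp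
      ultimately show ?thesis using that i0m by (simp add: e_def)
    qed
    have "{..Suc m} = {..<Suc i0} \<union> {Suc i0..<Suc (Suc m)}" using i0m by auto
    then have "(\<Sum>i\<le>Suc m. e i) = (\<Sum>i<Suc i0. e i) + (\<Sum>i = Suc i0..<Suc (Suc m). e i)"
      by (simp only:) (rule sum.union_disjoint, auto)
    also have "(\<Sum>i<Suc i0. e i) = (\<Sum>i<Suc i0. part_below t a i)"
      by (rule sum.cong) (auto simp: e_def)
    also have "\<dots> = a"
      using up a unfolding sum_part_below S_def by simp
    also have "(\<Sum>i = Suc i0..<Suc (Suc m). e i) = (\<Sum>i = i0..<Suc m. t i - part_below t a i)"
      unfolding sum.shift_bounds_Suc_ivl by (rule sum.cong) (auto simp: e_def)
    also have "\<dots> = (S (Suc m) - S i0) - (min a (S (Suc m)) - min a (S i0))"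
    proof -
      have "(\<Sum>i = i0..<Suc m. t i) = S (Suc m) - S i0"
        using sum_Suc_diff'[of i0 "Suc m" S] i0m by (simp add: S_def)
      moreover have "(\<Sum>i = i0..<Suc m. part_below t a i) = min a (S (Suc m)) - min a (S i0)"
        using sum_Suc_diff'[of i0 "Suc m" "\<lambda>i. min a (S i)"] i0m
        unfolding part_below_def S_def by simp
      ultimately show ?thesis by (simp only: sum_subtractf)
    qed
    also have "\<dots> = 1 - a" using S1 lo a by simp
    finally show "(\<Sum>i\<le>Suc m. e i) = 1" by simp
  qed
  have "simplex_push (Suc m) \<iota> e = cut_weights t a"
  proof (rule interleave_ext)
    fix i
    show "simplex_push (Suc m) \<iota> e (2 * i) = part_below t a i"
    proof (cases "i \<le> i0")
      case True
      then have "{l. l \<le> Suc m \<and> \<iota> l = 2 * i} = {i}"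
        using i0m by (auto simp: \<iota>_def; presburger)
      then show ?thesis using True by (simp add: simplex_push_def e_def)
    next
      case False
      then have "{l. l \<le> Suc m \<and> \<iota> l = 2 * i} = {}"
        by (auto simp: \<iota>_def; presburger)
      then show ?thesis using False pb_hi unfolding simplex_push_def by (simp only: sum.empty)
    qed
    show "simplex_push (Suc m) \<iota> e (Suc (2 * i)) = t i - part_below t a i"
    proof (cases "i0 \<le> i \<and> i \<le> m")
      case True
      then have "{l. l \<le> Suc m \<and> \<iota> l = Suc (2 * i)} = {Suc i}"
        by (auto simp: \<iota>_def; presburger)
      then show ?thesis using True by (simp add: simplex_push_def e_def)
    next
      case False
      then have "{l. l \<le> Suc m \<and> \<iota> l = Suc (2 * i)} = {}"
        by (auto simp: \<iota>_def; presburger)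
      moreover have "t i - part_below t a i = 0"
        using False pb_lo[of i] pb_hi[of i] simplexD(3)[OF t, of i] i0m by fastforce
      ultimately show ?thesis unfolding simplex_push_def by (simp only: sum.empty)
    qed
  qed
  with i0m e show thesis unfolding \<iota>_def by (rule that)
qed

lemma cut_order_map:
  assumes "i0 \<le> m"
  shows "order_map (Suc m) (2 * m + 1) (\<lambda>l. if l \<le> i0 then 2 * l else 2 * l - 1)"
  using assms by (auto simp: order_map_def mono_on_def)

lemma cut_weights_in:
  assumes "t \<in> standard_simplex n" "0 \<le> a" "a \<le> 1"
  shows "cut_weights t a \<in> standard_simplex (2 * n + 1)"
  using cut_weights_push[OF assms] simplex_push_in cut_order_map by metis

text \<open>
  Doubling \<open>\<theta>\<close> respects the two layers, but it is not monotone: if \<open>\<theta>\<close> merges two vertices, it sends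
  the top one of the first to the right of the bottom one of the second. So it does not define a
  gluing by itself.
\<close>

lemma double_push:
  "simplex_push (2 * m + 1) (\<lambda>l. 2 * \<theta> (l div 2) + l mod 2) (interleave x y) =
    interleave (simplex_push m \<theta> x) (simplex_push m \<theta> y)"
proof (rule interleave_ext)
  fix i
  have "{l. l \<le> 2 * m + 1 \<and> 2 * \<theta> (l div 2) + l mod 2 = 2 * i} = (\<lambda>k. 2 * k) ` {k. k \<le> m \<and> \<theta> k = i}"
  proof (intro subset_antisym subsetI)
    fix l assume l: "l \<in> {l. l \<le> 2 * m + 1 \<and> 2 * \<theta> (l div 2) + l mod 2 = 2 * i}"
    then have "l mod 2 = 0" by simp presburger
    then have "l = 2 * (l div 2)" by presburger
    with l show "l \<in> (\<lambda>k. 2 * k) ` {k. k \<le> m \<and> \<theta> k = i}" by (intro image_eqI[of _ _ "l div 2"]) auto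
  qed auto
  then show "simplex_push (2 * m + 1) (\<lambda>l. 2 * \<theta> (l div 2) + l mod 2) (interleave x y) (2 * i) =
      simplex_push m \<theta> x i"
    by (simp add: simplex_push_def sum.reindex inj_on_def)
  have "{l. l \<le> 2 * m + 1 \<and> 2 * \<theta> (l div 2) + l mod 2 = Suc (2 * i)} =
      (\<lambda>k. Suc (2 * k)) ` {k. k \<le> m \<and> \<theta> k = i}"
  proof (intro subset_antisym subsetI)
    fix l assume l: "l \<in> {l. l \<le> 2 * m + 1 \<and> 2 * \<theta> (l div 2) + l mod 2 = Suc (2 * i)}"
    then have "l mod 2 = 1" by simp presburger
    then have "l = Suc (2 * (l div 2))" by presburger
    with l show "l \<in> (\<lambda>k. Suc (2 * k)) ` {k. k \<le> m \<and> \<theta> k = i}"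
      by (intro image_eqI[of _ _ "l div 2"]) auto
  qed auto
  then show "simplex_push (2 * m + 1) (\<lambda>l. 2 * \<theta> (l div 2) + l mod 2) (interleave x y) (Suc (2 * i)) =
      simplex_push m \<theta> y i"
    by (simp add: simplex_push_def sum.reindex inj_on_def)
qed

lemma simplex_push_diff:
  "simplex_push m \<theta> (\<lambda>i. x i - y i) = (\<lambda>j. simplex_push m \<theta> x j - simplex_push m \<theta> y j)"
  by (simp add: simplex_push_def sum_subtractf)

text \<open>
  The doubled map becomes monotone on the face that carries the weights (\<open>cut_weights_push\<close>). Both cut
  points are therefore glued to one and the same point of that smaller simplex.
\<close>

lemma cut_point_glue:
  assumes G: "group G" and \<theta>: "order_map m n \<theta>"
    and h: "\<And>j. j \<le> n \<Longrightarrow> h j \<in> carrier G" and g: "\<And>j. j \<le> n \<Longrightarrow> g j \<in> carrier G"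
    and t: "t \<in> standard_simplex m" and a: "0 \<le> a" "a \<le> 1"
  shows "nerve_equiv G `` {cut_point G m (h \<circ> \<theta>) (g \<circ> \<theta>) t a} =
    nerve_equiv G `` {cut_point G n h g (simplex_push m \<theta> t) a}"
proof -
  obtain i0 e where i0: "i0 \<le> m" and e: "e \<in> standard_simplex (Suc m)"
    and push: "simplex_push (Suc m) (\<lambda>l. if l \<le> i0 then 2 * l else 2 * l - 1) e = cut_weights t a"
    using cut_weights_push[OF t a] by blast
  define \<iota> where "\<iota> = (\<lambda>l. if l \<le> i0 then 2 * l else 2 * l - 1)"
  define \<Theta> where "\<Theta> l = 2 * \<theta> (l div 2) + l mod 2" for l :: nat
  have \<iota>: "order_map (Suc m) (2 * m + 1) \<iota>"
    unfolding \<iota>_def by (rule cut_order_map[OF i0])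
  have \<theta>n: "\<theta> i \<le> n" if "i \<le> m" for i using \<theta> that by (auto simp: order_map_def)
  have mono: "\<theta> i \<le> \<theta> k" if "i \<le> k" "k \<le> m" for i k
    using \<theta> that by (auto simp: order_map_def mono_on_def)
  have \<Theta>\<iota>_eq: "\<Theta> (\<iota> l) = (if l \<le> i0 then 2 * \<theta> l else 2 * \<theta> (l - 1) + 1)" for l
  proof (cases "l \<le> i0")
    case False
    then obtain k where "l = Suc k" by (cases l) auto
    then show ?thesis using False by (simp add: \<Theta>_def \<iota>_def)
  qed (simp add: \<Theta>_def \<iota>_def)
  have \<Theta>\<iota>: "order_map (Suc m) (2 * n + 1) (\<Theta> \<circ> \<iota>)"
    unfolding order_map_def
  proof (intro conjI mono_onI)
    show "(\<Theta> \<circ> \<iota>) k \<le> (\<Theta> \<circ> \<iota>) l" if "k \<in> {..Suc m}" "l \<in> {..Suc m}" "k \<le> l" for k l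
    proof -
      consider "l \<le> i0" | "k \<le> i0" "\<not> l \<le> i0" | "\<not> k \<le> i0" by linarith
      then show ?thesis
      proof cases
        case 1 then show ?thesis using that mono[of k l] i0 by (simp add: \<Theta>\<iota>_eq)
      next
        case 2
        then have "\<theta> k \<le> \<theta> (l - 1)" using that by (intro mono) auto
        then show ?thesis using 2 by (simp add: \<Theta>\<iota>_eq)
      next
        case 3
        then have "\<theta> (k - 1) \<le> \<theta> (l - 1)" using that by (intro mono) auto
        then show ?thesis using 3 that by (simp add: \<Theta>\<iota>_eq)
      qed
    qed
    have "(\<Theta> \<circ> \<iota>) l \<le> 2 * n + 1" if "l \<le> Suc m" for l
    proof (cases "l \<le> i0")
      case True then show ?thesis using i0 \<theta>n[of l] by (simp add: \<Theta>\<iota>_eq)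
    next
      case False then show ?thesis using that \<theta>n[of "l - 1"] by (simp add: \<Theta>\<iota>_eq)
    qed
    then show "\<Theta> \<circ> \<iota> \<in> {..Suc m} \<rightarrow> {..2 * n + 1}" by auto
  qed
  have hm: "h (\<theta> j) \<in> carrier G" "g (\<theta> j) \<in> carrier G" if "j \<le> m" for j
    using that h g \<theta>n by auto
  have v: "interleave h g (\<Theta> l) = interleave (h \<circ> \<theta>) (g \<circ> \<theta>) l" for l
    unfolding \<Theta>_def by (cases "even l") (auto simp: interleave_def mod2_eq_if)
  \<comment> \<open>The push-forward along \<open>\<Theta>\<close> makes sense for weights, although \<open>\<Theta>\<close> alone is no map of simplices.\<close>
  have push': "cut_weights (simplex_push m \<theta> t) a = simplex_push (Suc m) (\<Theta> \<circ> \<iota>) e"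
  proof -
    have "simplex_push (Suc m) (\<Theta> \<circ> \<iota>) e = simplex_push (2 * m + 1) \<Theta> (simplex_push (Suc m) \<iota> e)"
      by (rule simplex_push_comp[symmetric]) (use \<iota> in \<open>auto simp: order_map_def\<close>)
    also have "\<dots> = simplex_push (2 * m + 1) \<Theta> (cut_weights t a)"
      using push unfolding \<iota>_def by simp
    also have "\<dots> = cut_weights (simplex_push m \<theta> t) a"
      unfolding \<Theta>_def double_push simplex_push_diff simplex_push_part_below[OF \<theta>, abs_def] ..
    finally show ?thesis ..
  qed
  have "nerve_equiv G `` {cut_point G m (h \<circ> \<theta>) (g \<circ> \<theta>) t a} =
     nerve_equiv G `` {((Suc m, vertex_simplex G (Suc m) (interleave (h \<circ> \<theta>) (g \<circ> \<theta>) \<circ> \<iota>)), e)}"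
    unfolding cut_point_def
    by (rule vertex_simplex_class_eq[symmetric, OF G \<iota>])
      (use push[folded \<iota>_def] hm interleave_carrier[of m "h \<circ> \<theta>" "carrier G" "g \<circ> \<theta>"] e in auto)
  also have "\<dots> = nerve_equiv G `` {cut_point G n h g (simplex_push m \<theta> t) a}"
    unfolding cut_point_def
    by (rule vertex_simplex_class_eq[OF G \<Theta>\<iota>])
      (use push' h g interleave_carrier[of n h "carrier G" g] e in \<open>auto simp: v\<close>)
  finally show ?thesis .
qed

lemma cut_point_in:
  assumes "group G" "\<And>j. j \<le> n \<Longrightarrow> h j \<in> carrier G" "\<And>j. j \<le> n \<Longrightarrow> g j \<in> carrier G"
    "t \<in> standard_simplex n" "0 \<le> a" "a \<le> 1"
  shows "cut_point G n h g t a \<in> topspace (nerve_sum G)"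
  using vertex_simplex_in_nerve[OF assms(1)] interleave_carrier[OF assms(2,3)] cut_weights_in[OF assms(4-6)]
  by (simp add: cut_point_def topspace_nerve_sum)

lemma cut_point_ends:
  assumes G: "group G"
    and h: "\<And>j. j \<le> n \<Longrightarrow> h j \<in> carrier G" and g: "\<And>j. j \<le> n \<Longrightarrow> g j \<in> carrier G"
    and t: "t \<in> standard_simplex n"
  shows "nerve_equiv G `` {cut_point G n h g t 1} = nerve_equiv G `` {((n, vertex_simplex G n h), t)}"
    and "nerve_equiv G `` {cut_point G n h g t 0} = nerve_equiv G `` {((n, vertex_simplex G n g), t)}"
proof -
  have sing: "{l. l \<le> n \<and> l = i} = (if i \<le> n then {i} else {})"
    "{l. l \<le> n \<and> 2 * l = Suc (2 * i)} = {}" "{l. l \<le> n \<and> Suc (2 * l) = 2 * i} = {}" for i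
    by (auto; presburger)+
  have w: "cut_weights t 1 = simplex_push n (\<lambda>l. 2 * l) t"
    by (rule interleave_ext[symmetric])
      (simp_all add: simplex_push_def part_below_one[OF t] sing simplexD(3)[OF t])
  have w': "cut_weights t 0 = simplex_push n (\<lambda>l. Suc (2 * l)) t"
    by (rule interleave_ext[symmetric])
      (simp_all add: simplex_push_def part_below_one[OF t] sing simplexD(3)[OF t])
  show "nerve_equiv G `` {cut_point G n h g t 1} = nerve_equiv G `` {((n, vertex_simplex G n h), t)}"
    unfolding cut_point_def
    by (rule vertex_simplex_class_eq[symmetric, OF G, where \<theta> = "\<lambda>l. 2 * l"])
      (use h g t w interleave_carrier[of n h "carrier G" g] in \<open>auto simp: order_map_def mono_on_def\<close>)
  show "nerve_equiv G `` {cut_point G n h g t 0} = nerve_equiv G `` {((n, vertex_simplex G n g), t)}"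
    unfolding cut_point_def
    by (rule vertex_simplex_class_eq[symmetric, OF G, where \<theta> = "\<lambda>l. Suc (2 * l)"])
      (use h g t w' interleave_carrier[of n h "carrier G" g] in \<open>auto simp: order_map_def mono_on_def\<close>)
qed

text \<open>
  If the two layers have the same image, then the cut is invisible in the image. Hence a moving cut
  traces a path in a fibre.
\<close>

lemma cut_point_project:
  assumes G: "group G" and H: "group H" and f: "f \<in> hom G H"
    and h: "\<And>j. j \<le> n \<Longrightarrow> h j \<in> carrier G" and g: "\<And>j. j \<le> n \<Longrightarrow> g j \<in> carrier G"
    and fhg: "\<And>j. j \<le> n \<Longrightarrow> f (h j) = f (g j)"
    and t: "t \<in> standard_simplex n" and a: "0 \<le> a" "a \<le> 1"
  shows "classifying_map H f (nerve_equiv G `` {cut_point G n h g t a}) =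
    nerve_equiv H `` {((n, vertex_simplex H n (f \<circ> g)), t)}"
proof -
  have fg: "f (g j) \<in> carrier H" if "j \<le> n" for j
    using f g[OF that] by (auto simp: hom_def)
  have fib: "{l. l \<le> 2 * n + 1 \<and> l div 2 = i} = (if i \<le> n then {2 * i, Suc (2 * i)} else {})" for i
    by (auto; presburger)
  have "t i = simplex_push (2 * n + 1) (\<lambda>l. l div 2) (cut_weights t a) i" for i
    unfolding simplex_push_def fib by (simp add: simplexD(3)[OF t])
  then have w: "t = simplex_push (2 * n + 1) (\<lambda>l. l div 2) (cut_weights t a)" by blast
  have "classifying_map H f (nerve_equiv G `` {cut_point G n h g t a}) =
    nerve_equiv H `` {nerve_map f (cut_point G n h g t a)}"
    by (rule classifying_map_class[OF G H f cut_point_in[OF G h g t a]])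
  also have "nerve_map f (cut_point G n h g t a) =
      ((2 * n + 1, vertex_simplex H (2 * n + 1) (f \<circ> interleave h g)), cut_weights t a)"
    unfolding cut_point_def
    by (rule nerve_map_vertex_simplex[OF G H f])
      (use interleave_carrier[of n h "carrier G" g] h g in auto)
  also have "nerve_equiv H `` {\<dots>} = nerve_equiv H `` {((n, vertex_simplex H n (f \<circ> g)), t)}"
  proof (rule vertex_simplex_class_eq[OF H, where \<theta> = "\<lambda>l. l div 2"])
    show "(f \<circ> interleave h g) l = (f \<circ> g) (l div 2)" if "l \<le> 2 * n + 1" for l
      using that fhg[of "l div 2"] by (auto simp: interleave_def)
    show "order_map (2 * n + 1) n (\<lambda>l. l div 2)"
      by (auto simp: order_map_def mono_on_def div_le_mono)
  qed (use fg w cut_weights_in[OF t a] in auto)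
  finally show ?thesis .
qed

lemma continuous_on_part_below [continuous_intros]:
  assumes "continuous_on A f" "continuous_on A \<alpha>"
  shows "continuous_on A (\<lambda>x. part_below (f x) (\<alpha> x) i)"
proof -
  have "continuous_on A (\<lambda>x. f x l)" for l
    using assms(1) by (rule continuous_on_product_then_coordinatewise)
  then show ?thesis using assms(2) unfolding part_below_def by (intro continuous_intros)
qed

lemma simplex_top_eq: "simplex_top n = top_of_set (standard_simplex n)"
  by (simp add: euclidean_product_topology)

lemma continuous_map_cut_point:
  assumes G: "group G"
    and h: "\<And>j. j \<le> n \<Longrightarrow> h j \<in> carrier G" and g: "\<And>j. j \<le> n \<Longrightarrow> g j \<in> carrier G"
  shows "continuous_map (top_of_set (standard_simplex n \<times> {0..1})) (classifying_space G)
    (\<lambda>(t, a). nerve_equiv G `` {cut_point G n h g t a})"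
proof -
  have "continuous_on (standard_simplex n \<times> {0..1}) (\<lambda>x. cut_weights (fst x) (snd x) l)" for l
  proof -
    have "continuous_on (standard_simplex n \<times> {0..1::real}) (\<lambda>x. fst x (l div 2))"
      by (intro continuous_on_product_then_coordinatewise[of _ fst] continuous_intros)
    moreover have "continuous_on (standard_simplex n \<times> {0..1}) (\<lambda>x. part_below (fst x) (snd x) (l div 2))"
      by (intro continuous_on_part_below continuous_on_fst continuous_on_snd continuous_on_id)
    ultimately show ?thesis
      unfolding interleave_def by (cases "even l") (simp_all add: continuous_on_diff)
  qed
  then have "continuous_on (standard_simplex n \<times> {0..1}) (\<lambda>x. cut_weights (fst x) (snd x))"
    by (intro continuous_on_coordinatewise_then_product)
  then have "continuous_map (top_of_set (standard_simplex n \<times> {0..1})) (simplex_top (2 * n + 1))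
      (\<lambda>x. cut_weights (fst x) (snd x))"
    unfolding simplex_top_eq using cut_weights_in by (auto simp: continuous_map_in_subtopology)
  moreover have "vertex_simplex G (2 * n + 1) (interleave h g) \<in> nerve G (2 * n + 1)"
    using interleave_carrier[of n h "carrier G" g] h g by (intro vertex_simplex_in_nerve[OF G]) auto
  ultimately have "continuous_map (top_of_set (standard_simplex n \<times> {0..1})) (classifying_space G)
     ((\<lambda>t. nerve_equiv G `` {((2 * n + 1, vertex_simplex G (2 * n + 1) (interleave h g)), t)}) \<circ>
      (\<lambda>x. cut_weights (fst x) (snd x)))"
    using continuous_map_compose continuous_map_simplex_class by blast
  then show ?thesis by (simp add: o_def cut_point_def case_prod_unfold)
qed

section \<open>Sections of the path fibration from labellings\<close>

text \<open>
  The tube lemma, in the form that gives continuity of the adjoint map into a path space with the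
  compact-open topology.
\<close>

lemma openin_uniformly_into:
  fixes S :: "'a::topological_space set" and T :: "'b::topological_space set"
  assumes f: "continuous_map (top_of_set (S \<times> T)) X f" and C: "compact C" "C \<subseteq> T" and W: "openin X W"
  shows "openin (top_of_set S) {x \<in> S. \<forall>u\<in>C. f (x, u) \<in> W}"
proof -
  have "openin (top_of_set (S \<times> T)) {z \<in> S \<times> T. f z \<in> W}"
    using openin_continuous_map_preimage[OF f W] by simp
  then obtain O' where O': "open O'" "{z \<in> S \<times> T. f z \<in> W} = S \<times> T \<inter> O'"
    unfolding openin_open by blast
  have "\<exists>N. openin (top_of_set S) N \<and> x \<in> N \<and> N \<subseteq> {x \<in> S. \<forall>u\<in>C. f (x, u) \<in> W}"
    if x: "x \<in> S" "\<forall>u\<in>C. f (x, u) \<in> W" for x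
  proof -
    have "{x} \<times> C \<subseteq> O'" using O'(2) C(2) x by blast
    then obtain X0 where X0: "x \<in> X0" "open X0" "X0 \<times> C \<subseteq> O'"
      using Elementary_Topology.tube_lemma[OF C(1) O'(1)] by blast
    have "S \<inter> X0 \<subseteq> {x \<in> S. \<forall>u\<in>C. f (x, u) \<in> W}"
      using O'(2) C(2) X0(3) by blast
    then show ?thesis using X0 x by (intro exI[of _ "S \<inter> X0"]) (auto simp: openin_open)
  qed
  then show ?thesis by (subst openin_subopen) blast
qed

text \<open>
  The projection of a semidirect product together with the section of a derivation, without
  reference to the kernel as a separate group.
\<close>

locale split_extension =
  E: group E + G: group G
  for E :: "('e, 'm) monoid_scheme" (structure) and G :: "('g, 'n) monoid_scheme" (structure) +
  fixes p :: "'e \<Rightarrow> 'g" and s :: "'g \<Rightarrow> 'e"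
  assumes p: "p \<in> hom E G" and s: "s \<in> hom G E"
    and ps: "\<And>g. g \<in> carrier G \<Longrightarrow> p (s g) = g"
begin

lemma p_closed: "x \<in> carrier E \<Longrightarrow> p x \<in> carrier G"
  and s_closed: "g \<in> carrier G \<Longrightarrow> s g \<in> carrier E"
  and p_mult: "x \<in> carrier E \<Longrightarrow> y \<in> carrier E \<Longrightarrow> p (x \<otimes>\<^bsub>E\<^esub> y) = p x \<otimes>\<^bsub>G\<^esub> p y"
  and s_mult: "g \<in> carrier G \<Longrightarrow> h \<in> carrier G \<Longrightarrow> s (g \<otimes>\<^bsub>G\<^esub> h) = s g \<otimes>\<^bsub>E\<^esub> s h"
  using p s by (auto simp: hom_def)

text \<open>
  For \<open>k\<close> in the kernel of \<open>p\<close>, these vertices lie over the same elements as those of \<open>\<sigma>\<close>, and they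
  span a simplex in the image of \<open>s\<close>, since the common left factor \<open>k\<close> cancels.
\<close>

definition slid_vertices :: "(nat \<Rightarrow> nat \<Rightarrow> 'e) \<Rightarrow> 'e \<Rightarrow> nat \<Rightarrow> 'e" where
  "slid_vertices \<sigma> k j = k \<otimes>\<^bsub>E\<^esub> s (p (\<sigma> 0 j))"

text \<open>
  At time \<open>0\<close> the cut is at the right end and the whole step function is slid; at time \<open>1\<close> it is
  unchanged.
\<close>

definition slide :: "'e nerve_point \<Rightarrow> 'e \<Rightarrow> real \<Rightarrow> 'e nerve_point set" where
  "slide = (\<lambda>((n, \<sigma>), t) k u.
    nerve_equiv E `` {cut_point E n (slid_vertices \<sigma> k) (\<sigma> 0) t (1 - u)})"

lemma slid_vertices_closed:
  assumes "\<sigma> \<in> nerve E n" "k \<in> carrier E" "j \<le> n"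
  shows "slid_vertices \<sigma> k j \<in> carrier E"
  using assms nerve_in_carrier[OF assms(1), of 0 j]
  by (simp add: slid_vertices_def p_closed s_closed)

text \<open>
  Passing to the simplex of \<open>\<theta>\<close> moves the base vertex, which changes all vertices by the left factor
  \<open>\<gamma> = \<sigma> 0 (\<theta> 0)\<close>. The two labels have to be related so that the slid vertices change by the same factor:
  as cosets, \<open>k' s(G) = \<gamma> k s(G)\<close>.
\<close>

lemma slide_glue:
  assumes \<theta>: "order_map m n \<theta>" and \<sigma>: "\<sigma> \<in> nerve E n" and t: "t \<in> standard_simplex m"
    and k: "k \<in> carrier E" and k': "k' \<in> carrier E" and u: "0 \<le> u" "u \<le> 1"
    and equi: "k' \<otimes>\<^bsub>E\<^esub> s (p (\<sigma> 0 (\<theta> 0))) = \<sigma> 0 (\<theta> 0) \<otimes>\<^bsub>E\<^esub> k"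
  shows "slide ((m, nerve_pullback m \<theta> \<sigma>), t) k u = slide ((n, \<sigma>), simplex_push m \<theta> t) k' u"
proof -
  define \<gamma> where "\<gamma> = \<sigma> 0 (\<theta> 0)"
  define \<tau> where "\<tau> = nerve_pullback m \<theta> \<sigma>"
  have \<theta>n: "\<theta> i \<le> n" if "i \<le> m" for i using \<theta> that by (auto simp: order_map_def)
  have \<theta>0: "\<theta> 0 \<le> \<theta> i" if "i \<le> m" for i using \<theta> that by (auto simp: order_map_def mono_on_def)
  have \<sigma>c: "\<sigma> i j \<in> carrier E" if "i \<le> j" "j \<le> n" for i j using nerve_in_carrier[OF \<sigma> that] .
  have \<gamma>: "\<gamma> \<in> carrier E" unfolding \<gamma>_def using \<sigma>c \<theta>n by simp
  have \<tau>: "\<tau> \<in> nerve E m" unfolding \<tau>_def by (rule nerve_pullback_in[OF \<theta> \<sigma>])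
  have \<tau>c: "\<tau> 0 i \<in> carrier E" if "i \<le> m" for i using nerve_in_carrier[OF \<tau>, of 0 i] that by simp
  have vert: "\<sigma> 0 (\<theta> i) = \<gamma> \<otimes>\<^bsub>E\<^esub> \<tau> 0 i" if "i \<le> m" for i
    using \<sigma> \<theta>n[OF that] \<theta>0[OF that] that by (simp add: \<tau>_def nerve_pullback_def \<gamma>_def nerve_def)
  have slid: "slid_vertices \<sigma> k' (\<theta> i) = \<gamma> \<otimes>\<^bsub>E\<^esub> slid_vertices \<tau> k i" if "i \<le> m" for i
  proof -
    have "slid_vertices \<sigma> k' (\<theta> i) = k' \<otimes>\<^bsub>E\<^esub> (s (p \<gamma>) \<otimes>\<^bsub>E\<^esub> s (p (\<tau> 0 i)))"
      using \<gamma> \<tau>c[OF that] by (simp add: slid_vertices_def vert[OF that] p_mult s_mult p_closed)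
    also have "\<dots> = (\<gamma> \<otimes>\<^bsub>E\<^esub> k) \<otimes>\<^bsub>E\<^esub> s (p (\<tau> 0 i))"
      using \<gamma> \<tau>c[OF that] k' equi by (simp add: E.m_assoc[symmetric] p_closed s_closed \<gamma>_def)
    also have "\<dots> = \<gamma> \<otimes>\<^bsub>E\<^esub> slid_vertices \<tau> k i"
      using \<gamma> \<tau>c[OF that] k by (simp add: slid_vertices_def E.m_assoc p_closed s_closed)
    finally show ?thesis .
  qed
  have "vertex_simplex E (2 * m + 1) (interleave (slid_vertices \<sigma> k' \<circ> \<theta>) (\<sigma> 0 \<circ> \<theta>)) =
      vertex_simplex E (2 * m + 1) (\<lambda>l. \<gamma> \<otimes>\<^bsub>E\<^esub> interleave (slid_vertices \<tau> k) (\<tau> 0) l)"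
    by (rule vertex_simplex_cong) (auto simp: interleave_def vert slid)
  also have "\<dots> = vertex_simplex E (2 * m + 1) (interleave (slid_vertices \<tau> k) (\<tau> 0))"
    using interleave_carrier[of m "slid_vertices \<tau> k" "carrier E" "\<tau> 0"]
      slid_vertices_closed[OF \<tau> k] \<tau>c \<gamma>
    by (intro vertex_simplex_translate E.is_group) auto
  finally have "cut_point E m (slid_vertices \<sigma> k' \<circ> \<theta>) (\<sigma> 0 \<circ> \<theta>) t (1 - u) =
      cut_point E m (slid_vertices \<tau> k) (\<tau> 0) t (1 - u)"
    by (simp add: cut_point_def)
  moreover have "nerve_equiv E `` {cut_point E m (slid_vertices \<sigma> k' \<circ> \<theta>) (\<sigma> 0 \<circ> \<theta>) t (1 - u)} =
      nerve_equiv E `` {cut_point E n (slid_vertices \<sigma> k') (\<sigma> 0) (simplex_push m \<theta> t) (1 - u)}"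
    by (rule cut_point_glue[OF E.is_group \<theta> slid_vertices_closed[OF \<sigma> k'] \<sigma>c t]) (use u in auto)
  ultimately show ?thesis
    by (simp add: slide_def \<tau>_def)
qed

lemma slide_end:
  assumes "\<sigma> \<in> nerve E n" "t \<in> standard_simplex n" "k \<in> carrier E"
  shows "slide ((n, \<sigma>), t) k 1 = nerve_equiv E `` {((n, \<sigma>), t)}"
proof -
  have c: "\<sigma> 0 j \<in> carrier E" if "j \<le> n" for j
    using nerve_in_carrier[OF assms(1), of 0 j] that by simp
  show ?thesis
    using cut_point_ends(2)[OF E.is_group slid_vertices_closed[OF assms(1,3)] c assms(2)]
      vertex_simplex_nerve[OF E.is_group assms(1)]
    by (simp add: slide_def)
qed

lemma slide_project:
  assumes \<sigma>: "\<sigma> \<in> nerve E n" and t: "t \<in> standard_simplex n"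
    and k: "k \<in> carrier E" "p k = \<one>\<^bsub>G\<^esub>" and u: "0 \<le> u" "u \<le> 1"
  shows "classifying_map G p (slide ((n, \<sigma>), t) k u) =
    nerve_equiv G `` {((n, vertex_simplex G n (\<lambda>j. p (\<sigma> 0 j))), t)}"
proof -
  have c: "\<sigma> 0 j \<in> carrier E" if "j \<le> n" for j using nerve_in_carrier[OF \<sigma>, of 0 j] that by simp
  have "p (slid_vertices \<sigma> k j) = p (\<sigma> 0 j)" if "j \<le> n" for j
    using c[OF that] k by (simp add: slid_vertices_def p_mult p_closed s_closed ps)
  from cut_point_project[OF E.is_group G.is_group p slid_vertices_closed[OF \<sigma> k(1)] c this t]
  show ?thesis using u by (simp add: slide_def o_def)
qed

lemma slide_start:
  assumes \<sigma>: "\<sigma> \<in> nerve E n" and t: "t \<in> standard_simplex n"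
    and k: "k \<in> carrier E" "p k = \<one>\<^bsub>G\<^esub>"
  shows "slide ((n, \<sigma>), t) k 0 = classifying_map E s (classifying_map G p (slide ((n, \<sigma>), t) k 0))"
proof -
  have c: "\<sigma> 0 j \<in> carrier E" if "j \<le> n" for j using nerve_in_carrier[OF \<sigma>, of 0 j] that by simp
  have pc: "p (\<sigma> 0 j) \<in> carrier G" if "j \<le> n" for j by (rule p_closed[OF c[OF that]])
  have "slide ((n, \<sigma>), t) k 0 = nerve_equiv E `` {((n, vertex_simplex E n (slid_vertices \<sigma> k)), t)}"
    using cut_point_ends(1)[OF E.is_group slid_vertices_closed[OF \<sigma> k(1)] c t]
    by (simp add: slide_def)
  also have "vertex_simplex E n (slid_vertices \<sigma> k) = vertex_simplex E n (s \<circ> (\<lambda>j. p (\<sigma> 0 j)))"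
    unfolding slid_vertices_def o_def
    using c k by (intro vertex_simplex_translate E.is_group) (auto simp: p_closed s_closed)
  also have "nerve_equiv E `` {((n, \<dots>), t)} =
      classifying_map E s (nerve_equiv G `` {((n, vertex_simplex G n (\<lambda>j. p (\<sigma> 0 j))), t)})"
  proof -
    have "((n, vertex_simplex G n (\<lambda>j. p (\<sigma> 0 j))), t) \<in> topspace (nerve_sum G)"
      using vertex_simplex_in_nerve[OF G.is_group pc] t by (simp add: topspace_nerve_sum)
    from classifying_map_class[OF G.is_group E.is_group s this]
    show ?thesis by (simp add: nerve_map_vertex_simplex[OF G.is_group E.is_group s pc] del: o_def)
  qed
  also have "\<dots> = classifying_map E s (classifying_map G p (slide ((n, \<sigma>), t) k 0))"
    by (simp add: slide_project[OF assms])
  finally show ?thesis .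
qed

lemma continuous_map_slide:
  assumes \<sigma>: "\<sigma> \<in> nerve E n" and k: "k \<in> carrier E"
  shows "continuous_map (top_of_set (standard_simplex n \<times> {0..1})) (classifying_space E)
    (\<lambda>(t, u). slide ((n, \<sigma>), t) k u)"
proof -
  have c: "\<sigma> 0 j \<in> carrier E" if "j \<le> n" for j using nerve_in_carrier[OF \<sigma>, of 0 j] that by simp
  have "continuous_map (top_of_set (standard_simplex n \<times> {0..1})) (top_of_set (standard_simplex n \<times> {0..1}))
     (\<lambda>x. (fst x, 1 - snd x :: real))"
    by (auto simp: continuous_map_in_subtopology
        intro!: continuous_on_Pair continuous_on_diff continuous_on_const continuous_on_fst
          continuous_on_snd continuous_on_id)
  from continuous_map_compose[OF this
      continuous_map_cut_point[OF E.is_group slid_vertices_closed[OF \<sigma> k] c]]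
  show ?thesis by (simp add: o_def slide_def case_prod_unfold)
qed

text \<open>
  The label \<open>c x\<close> stands for the coset \<open>c x s(G)\<close>, that is, for a point of the covering with fibre
  \<open>E / s(G)\<close> over the class of \<open>x\<close>. A continuous choice of such points over \<open>U\<close> yields a section of the
  path fibration over \<open>U\<close>, by sliding with the given labels. Representatives in the sum of simplices
  are used throughout, since labels refer to the first vertex and do not descend to classes.
\<close>

lemma section_over_labelled_set:
  fixes c :: "'e nerve_point \<Rightarrow> 'e"
  defines "X \<equiv> classifying_space E"
  assumes V: "V \<subseteq> topspace (nerve_sum E)"
    and loc: "\<And>n \<sigma> k. \<sigma> \<in> nerve E n \<Longrightarrow>
        openin (top_of_set (standard_simplex n)) {t. ((n, \<sigma>), t) \<in> V \<and> c ((n, \<sigma>), t) = k}"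
    and ker: "\<And>x. x \<in> V \<Longrightarrow> c x \<in> carrier E \<and> p (c x) = \<one>\<^bsub>G\<^esub>"
    and sat: "\<And>x y. (x, y) \<in> nerve_glue E \<Longrightarrow> x \<in> V \<longleftrightarrow> y \<in> V"
    and equi: "\<And>m n \<theta> \<sigma> t. order_map m n \<theta> \<Longrightarrow> \<sigma> \<in> nerve E n \<Longrightarrow> t \<in> standard_simplex m \<Longrightarrow>
        ((n, \<sigma>), simplex_push m \<theta> t) \<in> V \<Longrightarrow>
        c ((n, \<sigma>), simplex_push m \<theta> t) \<otimes>\<^bsub>E\<^esub> s (p (\<sigma> 0 (\<theta> 0))) =
          \<sigma> 0 (\<theta> 0) \<otimes>\<^bsub>E\<^esub> c ((m, nerve_pullback m \<theta> \<sigma>), t)"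
  defines "U \<equiv> (\<lambda>x. nerve_equiv E `` {x}) ` V"
  shows "openin X U"
    and "\<exists>f. continuous_map (subtopology X U)
        (fibre_path_space X (classifying_map G p) (classifying_map E s)) f \<and> (\<forall>y\<in>U. f y 1 = y)"
proof -
  define P where "P x = (if x \<in> V then restrict (slide x (c x)) {0..1} else undefined)" for x
  have P_glue: "P x = P y" if xy: "(x, y) \<in> nerve_glue E" for x y
  proof (cases "x \<in> V")
    case True
    then have yV: "y \<in> V" using sat[OF xy] by simp
    obtain m n \<theta> \<sigma> t where *: "x = ((m, nerve_pullback m \<theta> \<sigma>), t)" "y = ((n, \<sigma>), simplex_push m \<theta> t)"
      "order_map m n \<theta>" "\<sigma> \<in> nerve E n" "t \<in> standard_simplex m"
      using xy by (auto simp: nerve_glue_def)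
    have "slide x (c x) u = slide y (c y) u" if "u \<in> {0..1}" for u
      unfolding *(1,2)
      by (rule slide_glue[OF *(3-5)]) (use ker[OF True] ker[OF yV] that equi[OF *(3-5)] yV * in auto)
    then have "restrict (slide x (c x)) {0..1} = restrict (slide y (c y)) {0..1}"
      by (rule restrict_ext)
    then show ?thesis using True yV by (simp add: P_def)
  qed (use sat[OF xy] in \<open>simp add: P_def\<close>)
  have P_equiv: "P x = P y" if "(x, y) \<in> nerve_equiv E" for x y
    using P_glue that by (rule nerve_equiv_invariant)
  have V_equiv: "x \<in> V \<longleftrightarrow> y \<in> V" if "(x, y) \<in> nerve_equiv E" for x y
    using sat that by (rule nerve_equiv_invariant[of E "\<lambda>x. x \<in> V"])
  have VU: "{x \<in> topspace (nerve_sum E). nerve_equiv E `` {x} \<in> U} = V"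
    using V V_equiv class_eq_iff unfolding U_def by blast
  have openV: "openin (nerve_sum E) V"
    unfolding openin_nerve_sum simplex_top_eq
  proof (intro conjI V allI ballI)
    fix n \<sigma> assume \<sigma>: "\<sigma> \<in> nerve E n"
    have "{t. ((n, \<sigma>), t) \<in> V} = (\<Union>k. {t. ((n, \<sigma>), t) \<in> V \<and> c ((n, \<sigma>), t) = k})" by auto
    then show "openin (top_of_set (standard_simplex n)) {t. ((n, \<sigma>), t) \<in> V}"
      using loc[OF \<sigma>] by auto
  qed
  have UX: "U \<subseteq> topspace X" unfolding U_def X_def using V by (intro image_subsetI class_in_classifying_space) blast
  show opU: "openin X U"
    using quotient_map_classifying[of E] UX VU openV unfolding quotient_map_def X_def by auto
  \<comment> \<open>Any representative of the class gives the same path, by \<open>P_equiv\<close>.\<close>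
  define f where "f C = P (SOME x. x \<in> C)" for C
  have f_class: "f (nerve_equiv E `` {x}) = P x" if "x \<in> V" for x
  proof -
    have "(x, x) \<in> nerve_equiv E" using V that by (auto simp: nerve_equiv_def)
    then have "(x, SOME y. y \<in> nerve_equiv E `` {x}) \<in> nerve_equiv E"
      by (metis Image_singleton_iff someI_ex)
    then show ?thesis unfolding f_def using P_equiv by metis
  qed
  have VD: "\<exists>n \<sigma> t. x = ((n, \<sigma>), t) \<and> \<sigma> \<in> nerve E n \<and> t \<in> standard_simplex n" if "x \<in> V" for x
    using V that by (auto simp: topspace_nerve_sum)
  have path: "continuous_map (top_of_set {0..1}) X (P x)" if x: "x \<in> V" for x
  proof -
    obtain n \<sigma> t where *: "x = ((n, \<sigma>), t)" "\<sigma> \<in> nerve E n" "t \<in> standard_simplex n"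
      using VD[OF x] by blast
    have "continuous_map (top_of_set {0..1}) (top_of_set (standard_simplex n \<times> {0..1})) (\<lambda>u::real. (t, u))"
      using *(3) by (auto simp: continuous_map_in_subtopology intro!: continuous_intros)
    from continuous_map_compose[OF this continuous_map_slide[OF *(2)], of "c x"] ker[OF x]
    have "continuous_map (top_of_set {0..1}) X (slide x (c x))"
      by (simp add: o_def * X_def)
    then show ?thesis by (rule continuous_map_eq) (simp add: P_def x)
  qed
  have P_in: "P x \<in> topspace (fibre_path_space X (classifying_map G p) (classifying_map E s))"
    if x: "x \<in> V" for x
  proof -
    obtain n \<sigma> t where *: "x = ((n, \<sigma>), t)" "\<sigma> \<in> nerve E n" "t \<in> standard_simplex n"
      using VD[OF x] by blast
    have "P x \<in> topspace (compact_open (top_of_set {0..1}) X)"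
      unfolding compact_open_def topology_generated_by_topspace
    proof (rule UnionI)
      show "P x \<in> {\<alpha> \<in> extensional (topspace (top_of_set {0..1})).
          continuous_map (top_of_set {0..1}) X \<alpha> \<and> \<alpha> ` {} \<subseteq> topspace X}"
        using path[OF x] x by (simp add: P_def)
      show "{\<alpha> \<in> extensional (topspace (top_of_set {0..1::real})).
          continuous_map (top_of_set {0..1}) X \<alpha> \<and> \<alpha> ` {} \<subseteq> topspace X} \<in>
        {{\<alpha> \<in> extensional (topspace (top_of_set {0..1})).
          continuous_map (top_of_set {0..1}) X \<alpha> \<and> \<alpha> ` C \<subseteq> W} |C W.
          compactin (top_of_set {0..1}) C \<and> openin X W}"
        by blast
    qed
    moreover have "classifying_map G p (P x u) =
        nerve_equiv G `` {((n, vertex_simplex G n (\<lambda>j. p (\<sigma> 0 j))), t)}" if "u \<in> {0..1}" for u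
      using slide_project[OF *(2,3), of "c x" u] ker[OF x] that x by (simp add: P_def *(1))
    moreover have "P x 0 = classifying_map E s (classifying_map G p (P x 0))"
      using slide_start[OF *(2,3), of "c x"] ker[OF x] x by (simp add: P_def *(1))
    ultimately show ?thesis
      unfolding fibre_path_space_def topspace_subtopology by blast
  qed
  have "continuous_map (subtopology (nerve_sum E) V) (compact_open (top_of_set {0..1}) X) P"
    unfolding compact_open_def continuous_on_generated_topo_iff
  proof (intro conjI allI impI)
    show "P ` topspace (subtopology (nerve_sum E) V) \<subseteq> \<Union> {{\<alpha> \<in> extensional (topspace (top_of_set {0..1})).
        continuous_map (top_of_set {0..1}) X \<alpha> \<and> \<alpha> ` C \<subseteq> W} |C W. compactin (top_of_set {0..1}) C \<and> openin X W}"
      using P_in V unfolding fibre_path_space_def compact_open_def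
      by (simp add: image_subset_iff topology_generated_by_topspace)
    fix S assume "S \<in> {{\<alpha> \<in> extensional (topspace (top_of_set {0..1::real})).
        continuous_map (top_of_set {0..1}) X \<alpha> \<and> \<alpha> ` C \<subseteq> W} |C W. compactin (top_of_set {0..1}) C \<and> openin X W}"
    then obtain C W where S: "S = {\<alpha> \<in> extensional (topspace (top_of_set {0..1})).
        continuous_map (top_of_set {0..1}) X \<alpha> \<and> \<alpha> ` C \<subseteq> W}"
      and cC: "compactin (top_of_set {0..1::real}) C" and W: "openin X W"
      by blast
    from cC have C: "compact C" "C \<subseteq> {0..1::real}" by (simp_all add: compactin_subtopology)
    have S_eq: "P -` S \<inter> topspace (subtopology (nerve_sum E) V) = {x \<in> V. \<forall>u\<in>C. slide x (c x) u \<in> W}"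
    proof -
      have "P x \<in> S \<longleftrightarrow> (\<forall>u\<in>C. slide x (c x) u \<in> W)" if x: "x \<in> V" for x
      proof -
        have "P x u = slide x (c x) u" if "u \<in> C" for u using that C(2) x by (auto simp: P_def)
        moreover have "P x \<in> extensional (topspace (top_of_set {0..1}))" using x by (simp add: P_def)
        ultimately show ?thesis using path[OF x] by (simp add: S image_subset_iff)
      qed
      then show ?thesis using V by (auto simp del: split_paired_All)
    qed
    have "openin (nerve_sum E) {x \<in> V. \<forall>u\<in>C. slide x (c x) u \<in> W}"
      unfolding openin_nerve_sum simplex_top_eq
    proof (intro conjI allI ballI)
      show "{x \<in> V. \<forall>u\<in>C. slide x (c x) u \<in> W} \<subseteq> topspace (nerve_sum E)" using V by auto
      fix n \<sigma> assume \<sigma>: "\<sigma> \<in> nerve E n"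
      \<comment> \<open>On the open part where the label is \<open>k\<close>, the slide with the constant label \<open>k\<close> can be used.\<close>
      let ?A = "\<lambda>k. {t. ((n, \<sigma>), t) \<in> V \<and> c ((n, \<sigma>), t) = k} \<inter>
          {t \<in> standard_simplex n. \<forall>u\<in>C. (case (t, u) of (t, u) \<Rightarrow> slide ((n, \<sigma>), t) k u) \<in> W}"
      have "{t. ((n, \<sigma>), t) \<in> {x \<in> V. \<forall>u\<in>C. slide x (c x) u \<in> W}} = (\<Union>k\<in>carrier E. ?A k)"
        using V ker by (auto simp: topspace_nerve_sum)
      moreover have "openin (top_of_set (standard_simplex n)) (?A k)" if "k \<in> carrier E" for k
        by (intro openin_Int loc[OF \<sigma>]
            openin_uniformly_into[OF continuous_map_slide[OF \<sigma> that] C W[unfolded X_def]])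
      ultimately show "openin (top_of_set (standard_simplex n))
          {t. ((n, \<sigma>), t) \<in> {x \<in> V. \<forall>u\<in>C. slide x (c x) u \<in> W}}"
        by (simp only:) blast
    qed
    then show "openin (subtopology (nerve_sum E) V) (P -` S \<inter> topspace (subtopology (nerve_sum E) V))"
      unfolding S_eq by (simp add: openin_open_subtopology[OF openV])
  qed
  then have contP: "continuous_map (subtopology (nerve_sum E) V)
      (fibre_path_space X (classifying_map G p) (classifying_map E s)) P"
    using P_in V unfolding fibre_path_space_def continuous_map_in_subtopology by auto
  have "continuous_map (subtopology X U) (fibre_path_space X (classifying_map G p) (classifying_map E s)) f"
  proof (rule continuous_compose_quotient_map)
    show "quotient_map (subtopology (nerve_sum E) V) (subtopology X U) (\<lambda>x. nerve_equiv E `` {x})"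
      unfolding X_def by (rule quotient_map_restriction[OF quotient_map_classifying VU])
        (use opU in \<open>simp add: X_def\<close>)
    show "continuous_map (subtopology (nerve_sum E) V)
        (fibre_path_space X (classifying_map G p) (classifying_map E s)) (f \<circ> (\<lambda>x. nerve_equiv E `` {x}))"
      using contP by (rule continuous_map_eq) (simp add: f_class)
  qed
  moreover have "f y 1 = y" if "y \<in> U" for y
  proof -
    obtain x where x: "x \<in> V" "y = nerve_equiv E `` {x}" using \<open>y \<in> U\<close> unfolding U_def by blast
    obtain n \<sigma> t where *: "x = ((n, \<sigma>), t)" "\<sigma> \<in> nerve E n" "t \<in> standard_simplex n"
      using VD[OF x(1)] by blast
    show ?thesis using slide_end[OF *(2,3), of "c x"] ker[OF x(1)] x by (simp add: f_class P_def *(1))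
  qed
  ultimately show "\<exists>f. continuous_map (subtopology X U)
        (fibre_path_space X (classifying_map G p) (classifying_map E s)) f \<and> (\<forall>y\<in>U. f y 1 = y)"
    by blast
qed

end

section \<open>The Klein bottle group\<close>

definition int_sgn :: "int \<Rightarrow> int" where
  "int_sgn g = (if even g then 1 else - 1)"

lemma klein_action:
  fixes \<phi> :: "int \<Rightarrow> int \<Rightarrow> int"
  assumes "\<phi> \<in> hom integer_group (AutoGroup integer_group)" "\<phi> 1 = (\<lambda>k. - k)"
  shows "\<phi> g k = int_sgn g * k"
proof -
  have bij: "\<phi> g \<in> Bij UNIV" for g
    using assms(1) by (auto simp: hom_def AutoGroup_def auto_def)
  have comp: "\<phi> (g + h) k = \<phi> g (\<phi> h k)" for g h k
  proof -
    have "\<phi> (g + h) = \<phi> g \<otimes>\<^bsub>AutoGroup integer_group\<^esub> \<phi> h"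
      using assms(1) by (auto simp: hom_def)
    then show ?thesis using bij by (simp add: AutoGroup_def BijGroup_def compose_def)
  qed
  have zero: "\<phi> 0 k = k" for k
  proof -
    have "inj (\<phi> 0)" using bij[of 0] by (auto simp: Bij_def bij_betw_def)
    moreover have "\<phi> 0 (\<phi> 0 k) = \<phi> 0 k" using comp[of 0 0 k] by simp
    ultimately show ?thesis by (rule injD)
  qed
  have suc: "\<phi> (g + 1) k = \<phi> g (- k)" for g k using comp[of g 1 k] assms(2) by simp
  have "\<forall>k. \<phi> g k = int_sgn g * k"
  proof (induction g rule: int_induct[where k = 0])
    case (step1 i) then show ?case by (auto simp: suc int_sgn_def)
  next
    case (step2 i)
    have "\<phi> (i - 1) k = \<phi> i (- k)" for k using suc[of "i - 1" "- k"] by simp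
    then show ?case using step2 by (simp add: int_sgn_def)
  qed (simp add: zero int_sgn_def)
  then show ?thesis by simp
qed

locale klein =
  fixes \<phi> :: "int \<Rightarrow> int \<Rightarrow> int" and d :: "int \<Rightarrow> int"
  assumes \<phi>: "\<phi> \<in> hom integer_group (AutoGroup integer_group)" and \<phi>1: "\<phi> 1 = (\<lambda>k. - k)"
    and d: "derivation integer_group integer_group \<phi> d"
begin

abbreviation (input) KB where "KB \<equiv> semidirect integer_group integer_group \<phi>"

lemma carrier_K [simp]: "carrier KB = UNIV"
  by (simp add: semidirect_def)

lemma mult_K [simp]: "(k, g) \<otimes>\<^bsub>KB\<^esub> (k', g') = (k + int_sgn g * k', g + g')"
  by (simp add: semidirect_def klein_action[OF \<phi> \<phi>1])

lemma d_add: "d (g + h) = d g + int_sgn g * d h"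
  using d by (simp add: derivation_def klein_action[OF \<phi> \<phi>1])

sublocale split_extension KB integer_group snd "\<lambda>g. (d g, g)"
proof (intro split_extension.intro split_extension_axioms.intro)
  show "group KB" by (rule group_semidirect[OF group_integer_group group_integer_group \<phi>])
qed (simp_all add: hom_snd_semidirect hom_derivation_section[OF d])

text \<open>
  The coset of \<open>(k, g)\<close> modulo the image of the section contains \<open>(k - d g, 0)\<close>, so this function
  identifies the cosets with \<open>\<int>\<close>.
\<close>

definition height :: "int \<times> int \<Rightarrow> int" where
  "height x = fst x - d (snd x)"

lemma height_mult: "height (x \<otimes>\<^bsub>KB\<^esub> y) = height x + int_sgn (snd x) * height y"
  by (cases x; cases y) (simp add: height_def d_add algebra_simps)

lemma snd_mult_K: "snd (x \<otimes>\<^bsub>KB\<^esub> y) = snd x + snd y"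
  by (cases x; cases y) simp

text \<open>
  The group acts on the plane by
  \<open>(k, g) (x, y) = (k - d g + (-1)\<^sup>g x, g + y)\<close>, and the orbit of the origin consists of the points
  \<open>(height v, snd v)\<close>. The barycentre of these points over the vertices is equivariant because the action
  is affine (\<open>develop_glue\<close>), and it is defined on representatives with first vertex at the neutral
  element.
\<close>

definition develop :: "(int \<times> int) nerve_point \<Rightarrow> real \<times> real" where
  "develop = (\<lambda>((n, \<sigma>), t).
    (\<Sum>i\<le>n. t i * real_of_int (height (\<sigma> 0 i)), \<Sum>i\<le>n. t i * real_of_int (snd (\<sigma> 0 i))))"

lemma develop_glue:
  assumes \<theta>: "order_map m n \<theta>" and \<sigma>: "\<sigma> \<in> nerve KB n" and t: "t \<in> standard_simplex m"
  defines "\<gamma> \<equiv> \<sigma> 0 (\<theta> 0)" and "z \<equiv> develop ((m, nerve_pullback m \<theta> \<sigma>), t)"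
  shows "develop ((n, \<sigma>), simplex_push m \<theta> t) =
    (real_of_int (height \<gamma>) + real_of_int (int_sgn (snd \<gamma>)) * fst z, snd z + real_of_int (snd \<gamma>))"
proof -
  define \<tau> where "\<tau> = nerve_pullback m \<theta> \<sigma>"
  have \<theta>n: "\<theta> i \<le> n" if "i \<le> m" for i using \<theta> that by (auto simp: order_map_def)
  have \<theta>0: "\<theta> 0 \<le> \<theta> i" if "i \<le> m" for i using \<theta> that by (auto simp: order_map_def mono_on_def)
  have vert: "\<sigma> 0 (\<theta> i) = \<gamma> \<otimes>\<^bsub>KB\<^esub> \<tau> 0 i" if "i \<le> m" for i
    using \<sigma> \<theta>n[OF that] \<theta>0[OF that] that by (simp add: \<tau>_def nerve_pullback_def \<gamma>_def nerve_def)
  have 1: "(\<Sum>i\<le>m. t i) = 1" by (rule simplexD(4)[OF t])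
  have "(\<Sum>j\<le>n. simplex_push m \<theta> t j * real_of_int (height (\<sigma> 0 j))) =
      (\<Sum>i\<le>m. t i * real_of_int (height \<gamma>) + int_sgn (snd \<gamma>) * (t i * real_of_int (height (\<tau> 0 i))))"
    unfolding sum_simplex_push_mult[OF \<theta>]
    by (intro sum.cong) (simp_all add: vert height_mult algebra_simps)
  also have "\<dots> = real_of_int (height \<gamma>) + int_sgn (snd \<gamma>) * fst z"
    by (simp add: sum.distrib 1 flip: sum_distrib_left sum_distrib_right)
      (simp add: z_def develop_def \<tau>_def)
  finally have A: "(\<Sum>j\<le>n. simplex_push m \<theta> t j * real_of_int (height (\<sigma> 0 j))) =
    real_of_int (height \<gamma>) + int_sgn (snd \<gamma>) * fst z" .
  have "(\<Sum>j\<le>n. simplex_push m \<theta> t j * real_of_int (snd (\<sigma> 0 j))) =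
      (\<Sum>i\<le>m. t i * real_of_int (snd \<gamma>) + t i * real_of_int (snd (\<tau> 0 i)))"
    unfolding sum_simplex_push_mult[OF \<theta>]
    by (intro sum.cong) (simp_all add: vert snd_mult_K algebra_simps)
  also have "\<dots> = snd z + real_of_int (snd \<gamma>)"
    by (simp add: sum.distrib 1 flip: sum_distrib_left sum_distrib_right)
      (simp add: z_def develop_def \<tau>_def)
  finally show ?thesis using A by (simp add: develop_def)
qed

lemma continuous_on_develop:
  "continuous_on S (\<lambda>t. develop ((n, \<sigma>), t))"
proof -
  have "continuous_on S (\<lambda>t. t i :: real)" for i :: nat
    by (rule continuous_on_product_then_coordinatewise[OF continuous_on_id])
  then show ?thesis
    unfolding develop_def prod.case
    by (intro continuous_on_Pair continuous_on_sum continuous_on_mult continuous_on_const)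
qed

definition section_exists :: "(int \<times> int) nerve_point set set \<Rightarrow> bool" where
  "section_exists U \<longleftrightarrow> (\<exists>f. continuous_map (subtopology (classifying_space KB) U)
    (fibre_path_space (classifying_space KB) (classifying_map integer_group snd)
      (classifying_map KB (\<lambda>g. (d g, g)))) f \<and> (\<forall>y\<in>U. f y 1 = y))"

text \<open>
  An equivariant label on an invariant open part of the plane pulls back along \<open>develop\<close>. In the
  hypotheses \<open>a\<close> stands for the height of the group element, which can be any integer.
\<close>

lemma section_over_region:
  fixes L :: "real \<times> real \<Rightarrow> int"
  assumes opn: "\<And>k. open {z \<in> D. L z = k}"
    and D: "\<And>a g x y. (real_of_int a + real_of_int (int_sgn g) * x, y + real_of_int g) \<in> D \<longleftrightarrow> (x, y) \<in> D"
    and L: "\<And>a g x y. (x, y) \<in> D \<Longrightarrow>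
      L (real_of_int a + real_of_int (int_sgn g) * x, y + real_of_int g) = a + int_sgn g * L (x, y)"
  defines "U \<equiv> (\<lambda>x. nerve_equiv KB `` {x}) ` {x \<in> topspace (nerve_sum KB). develop x \<in> D}"
  shows "openin (classifying_space KB) U" "section_exists U"
proof -
  define V where "V = {x \<in> topspace (nerve_sum KB). develop x \<in> D}"
  define c where "c x = (L (develop x), 0::int)" for x
  have loc: "openin (top_of_set (standard_simplex n)) {t. ((n, \<sigma>), t) \<in> V \<and> c ((n, \<sigma>), t) = k}"
    if "\<sigma> \<in> nerve KB n" for n \<sigma> k
  proof (cases "snd k = 0")
    case True
    have "{t. ((n, \<sigma>), t) \<in> V \<and> c ((n, \<sigma>), t) = k} =
        standard_simplex n \<inter> (\<lambda>t. develop ((n, \<sigma>), t)) -` {z \<in> D. L z = fst k}"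
      using that True by (auto simp: V_def c_def topspace_nerve_sum prod_eq_iff)
    then show ?thesis
      using continuous_openin_preimage_gen[OF continuous_on_develop opn] by simp
  next
    case False
    then have "{t. ((n, \<sigma>), t) \<in> V \<and> c ((n, \<sigma>), t) = k} = {}" by (auto simp: c_def)
    then show ?thesis by (simp only: openin_empty)
  qed
  have step: "develop y = (real_of_int a + real_of_int (int_sgn g) * fst (develop x), snd (develop x) + real_of_int g)
      \<Longrightarrow> develop y \<in> D \<longleftrightarrow> develop x \<in> D" for x y a g
    using D[of a g "fst (develop x)" "snd (develop x)"] by simp
  have sat: "x \<in> V \<longleftrightarrow> y \<in> V" if xy: "(x, y) \<in> nerve_glue KB" for x y
  proof -
    obtain m n \<theta> \<sigma> t where *: "x = ((m, nerve_pullback m \<theta> \<sigma>), t)" "y = ((n, \<sigma>), simplex_push m \<theta> t)"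
      "order_map m n \<theta>" "\<sigma> \<in> nerve KB n" "t \<in> standard_simplex m"
      using xy by (auto simp: nerve_glue_def)
    show ?thesis
      using step[OF develop_glue[OF *(3-5)]] nerve_glue_topspace[OF xy] by (auto simp: V_def *(1,2))
  qed
  have equi: "c ((n, \<sigma>), simplex_push m \<theta> t) \<otimes>\<^bsub>KB\<^esub> (d (snd (\<sigma> 0 (\<theta> 0))), snd (\<sigma> 0 (\<theta> 0))) =
      \<sigma> 0 (\<theta> 0) \<otimes>\<^bsub>KB\<^esub> c ((m, nerve_pullback m \<theta> \<sigma>), t)"
    if *: "order_map m n \<theta>" "\<sigma> \<in> nerve KB n" "t \<in> standard_simplex m"
      "((n, \<sigma>), simplex_push m \<theta> t) \<in> V" for m n \<theta> \<sigma> t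
  proof -
    define z where "z = develop ((m, nerve_pullback m \<theta> \<sigma>), t)"
    have "develop ((n, \<sigma>), simplex_push m \<theta> t) \<in> D" using *(4) by (simp add: V_def)
    then have "(fst z, snd z) \<in> D" using step[OF develop_glue[OF *(1-3)]] by (simp add: z_def)
    from L[OF this] develop_glue[OF *(1-3)]
    have "L (develop ((n, \<sigma>), simplex_push m \<theta> t)) =
        height (\<sigma> 0 (\<theta> 0)) + int_sgn (snd (\<sigma> 0 (\<theta> 0))) * L z"
      by (simp add: z_def)
    then show ?thesis
      by (cases "\<sigma> 0 (\<theta> 0)") (simp add: c_def height_def z_def int_sgn_def)
  qed
  have VT: "V \<subseteq> topspace (nerve_sum KB)" by (auto simp: V_def)
  have ker: "x \<in> V \<Longrightarrow> c x \<in> carrier KB \<and> snd (c x) = \<one>\<^bsub>integer_group\<^esub>" for x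
    by (simp add: c_def)
  show "openin (classifying_space KB) U"
    unfolding U_def V_def[symmetric] by (rule section_over_labelled_set(1)[OF VT loc ker sat equi])
  show "section_exists U"
    unfolding U_def V_def[symmetric] section_exists_def
    by (rule section_over_labelled_set(2)[OF VT loc ker sat equi])
qed

lemma nonint_floor:
  fixes x :: real
  assumes "x \<notin> \<int>"
  shows "real_of_int \<lfloor>x\<rfloor> < x" "x < real_of_int \<lfloor>x\<rfloor> + 1"
proof -
  have "real_of_int \<lfloor>x\<rfloor> \<noteq> x" using assms Ints_of_int[of "\<lfloor>x\<rfloor>"] by force
  then show "real_of_int \<lfloor>x\<rfloor> < x" using of_int_floor_le[of x] by linarith
  show "x < real_of_int \<lfloor>x\<rfloor> + 1" by (rule floor_correct[THEN conjunct2, simplified]) 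
qed

lemma nonintI:
  fixes x :: real
  assumes "real_of_int k < x" "x < real_of_int k + 1"
  shows "x \<notin> \<int>"
proof
  assume "x \<in> \<int>"
  then obtain j where "x = real_of_int j" by (rule Ints_cases)
  then show False using assms by simp
qed

lemma floor_twist:
  fixes x :: real
  assumes "x \<notin> \<int>"
  shows "\<lfloor>real_of_int a + real_of_int (int_sgn g) * x\<rfloor> = a + int_sgn g * \<lfloor>x\<rfloor> - (if even g then 0 else 1)"
proof (cases "even g")
  case False
  have "\<lfloor>real_of_int a - x\<rfloor> = a - \<lfloor>x\<rfloor> - 1"
    using nonint_floor[OF assms] by (intro floor_unique) (simp, linarith, simp)
  then show ?thesis using False by (simp add: int_sgn_def)
qed (simp add: int_sgn_def)

lemma Ints_twist:
  fixes x :: real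
  shows "real_of_int a + real_of_int (int_sgn g) * x \<in> \<int> \<longleftrightarrow> x \<in> \<int>"
  by (simp add: int_sgn_def)

lemma open_nonint_parity:
  fixes e :: real
  shows "open {y::real. y + e \<notin> \<int> \<and> (even \<lfloor>y + e\<rfloor> \<longleftrightarrow> b)}"
proof -
  have "{y::real. y + e \<notin> \<int> \<and> (even \<lfloor>y + e\<rfloor> \<longleftrightarrow> b)} =
      (\<Union>k\<in>{k. even k \<longleftrightarrow> b}. {of_int k - e <..< of_int k + 1 - e})"
  proof (intro subset_antisym subsetI)
    fix y assume "y \<in> {y::real. y + e \<notin> \<int> \<and> (even \<lfloor>y + e\<rfloor> \<longleftrightarrow> b)}"
    then have y: "y + e \<notin> \<int>" "even \<lfloor>y + e\<rfloor> \<longleftrightarrow> b" by auto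
    have "of_int \<lfloor>y + e\<rfloor> - e < y" "y < of_int \<lfloor>y + e\<rfloor> + 1 - e"
      using nonint_floor[OF y(1)] by linarith+
    then show "y \<in> (\<Union>k\<in>{k. even k \<longleftrightarrow> b}. {of_int k - e <..< of_int k + 1 - e})" using y(2) by auto
  next
    fix y assume "y \<in> (\<Union>k\<in>{k. even k \<longleftrightarrow> b}. {of_int k - e <..< of_int k + 1 - e})"
    then obtain k where k: "even k \<longleftrightarrow> b" "of_int k < y + e" "y + e < of_int k + 1" by auto
    then have "\<lfloor>y + e\<rfloor> = k" by linarith
    moreover have "y + e \<notin> \<int>" by (rule nonintI[OF k(2,3)])
    ultimately show "y \<in> {y::real. y + e \<notin> \<int> \<and> (even \<lfloor>y + e\<rfloor> \<longleftrightarrow> b)}" using k by simp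
  qed
  then show ?thesis by auto
qed

lemma open_nonint_floor:
  fixes e :: real
  shows "open {x::real. x + e \<notin> \<int> \<and> \<lfloor>x + e\<rfloor> = k}"
proof -
  have "{x::real. x + e \<notin> \<int> \<and> \<lfloor>x + e\<rfloor> = k} = {of_int k - e <..< of_int k + 1 - e}"
  proof (intro subset_antisym subsetI)
    fix x assume "x \<in> {x::real. x + e \<notin> \<int> \<and> \<lfloor>x + e\<rfloor> = k}"
    then have x: "x + e \<notin> \<int>" "\<lfloor>x + e\<rfloor> = k" by auto
    show "x \<in> {of_int k - e <..< of_int k + 1 - e}"
      using nonint_floor[OF x(1)] unfolding x(2) by (simp add: algebra_simps)
  next
    fix x assume k: "x \<in> {of_int k - e <..< of_int k + 1 - e}"
    then have k': "real_of_int k < x + e" "x + e < real_of_int k + 1" by auto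
    then have "\<lfloor>x + e\<rfloor> = k" by linarith
    moreover have "x + e \<notin> \<int>" by (rule nonintI[OF k'])
    ultimately show "x \<in> {x::real. x + e \<notin> \<int> \<and> \<lfloor>x + e\<rfloor> = k}" by simp
  qed
  then show ?thesis by auto
qed

definition strips :: "(real \<times> real) set" where
  "strips = {(x, y). x + 1/2 \<notin> \<int>}"

definition bricks :: "real \<Rightarrow> (real \<times> real) set" where
  "bricks e = {(x, y). x \<notin> \<int> \<and> y + e \<notin> \<int>}"

definition classes_over :: "(real \<times> real) set \<Rightarrow> (int \<times> int) nerve_point set set" where
  "classes_over D = (\<lambda>x. nerve_equiv KB `` {x}) ` {x \<in> topspace (nerve_sum KB). develop x \<in> D}"

text \<open>
  Rounding the abscissa to the nearest integer commutes with integral translations and, away from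
  the half-integers, with the reflection.
\<close>

lemma section_over_strips:
  "openin (classifying_space KB) (classes_over strips)" "section_exists (classes_over strips)"
proof -
  let ?L = "\<lambda>(x, y). \<lfloor>x + 1/2\<rfloor>"
  have op: "open {z \<in> strips. ?L z = k}" for k
  proof -
    have "{z \<in> strips. ?L z = k} = {x. x + 1/2 \<notin> \<int> \<and> \<lfloor>x + 1/2\<rfloor> = k} \<times> UNIV"
      by (auto simp: strips_def)
    then show ?thesis by (simp only:) (intro open_Times open_nonint_floor open_UNIV)
  qed
  have tw: "real_of_int a + real_of_int (int_sgn g) * x + 1/2 =
      real_of_int (a + (if even g then 0 else 1)) + real_of_int (int_sgn g) * (x + 1/2)" for a g x
    by (simp add: int_sgn_def)
  have D: "(real_of_int a + real_of_int (int_sgn g) * x, y + real_of_int g) \<in> strips \<longleftrightarrow> (x, y) \<in> strips" for a g x y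
    unfolding strips_def mem_Collect_eq prod.case tw Ints_twist ..
  have L: "?L (real_of_int a + real_of_int (int_sgn g) * x, y + real_of_int g) = a + int_sgn g * ?L (x, y)"
    if "(x, y) \<in> strips" for a g x y
  proof -
    have "x + 1/2 \<notin> \<int>" using that by (simp add: strips_def)
    then show ?thesis unfolding prod.case tw by (subst floor_twist) auto
  qed
  show "openin (classifying_space KB) (classes_over strips)"
    unfolding classes_over_def by (rule section_over_region(1)[OF op D L])
  show "section_exists (classes_over strips)"
    unfolding classes_over_def by (rule section_over_region(2)[OF op D L])
qed

text \<open>
  Between two integers the reflection exchanges the two candidates for a label. As it only occurs
  together with a translation of the ordinate by an odd number, it is compatible with taking the left
  candidate in the even rows and the right one in the odd rows.
\<close>

lemma section_over_bricks:
  "openin (classifying_space KB) (classes_over (bricks e))" "section_exists (classes_over (bricks e))"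
proof -
  let ?L = "\<lambda>(x, y). \<lfloor>x\<rfloor> + (if even \<lfloor>y + e\<rfloor> then 0 else 1)"
  have op: "open {z \<in> bricks e. ?L z = k}" for k
  proof -
    have floor: "open {x::real. x \<notin> \<int> \<and> \<lfloor>x\<rfloor> = k}" for k
      using open_nonint_floor[of 0 k] by simp
    have "open ({x::real. x \<notin> \<int> \<and> \<lfloor>x\<rfloor> = k} \<times> {y. y + e \<notin> \<int> \<and> (even \<lfloor>y + e\<rfloor> \<longleftrightarrow> True)} \<union>
        {x::real. x \<notin> \<int> \<and> \<lfloor>x\<rfloor> = k - 1} \<times> {y. y + e \<notin> \<int> \<and> (even \<lfloor>y + e\<rfloor> \<longleftrightarrow> False)})"
      by (intro open_Un open_Times open_nonint_parity floor)
    moreover have "{z \<in> bricks e. ?L z = k} =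
        {x. x \<notin> \<int> \<and> \<lfloor>x\<rfloor> = k} \<times> {y. y + e \<notin> \<int> \<and> (even \<lfloor>y + e\<rfloor> \<longleftrightarrow> True)} \<union>
        {x. x \<notin> \<int> \<and> \<lfloor>x\<rfloor> = k - 1} \<times> {y. y + e \<notin> \<int> \<and> (even \<lfloor>y + e\<rfloor> \<longleftrightarrow> False)}"
      by (auto simp: bricks_def split: if_splits)
    ultimately show ?thesis by (simp only:)
  qed
  have tw: "y + real_of_int g + e = (y + e) + real_of_int g" for y g by simp
  have D: "(real_of_int a + real_of_int (int_sgn g) * x, y + real_of_int g) \<in> bricks e \<longleftrightarrow> (x, y) \<in> bricks e" for a g x y
    unfolding bricks_def mem_Collect_eq prod.case tw Ints_twist by simp
  have L: "?L (real_of_int a + real_of_int (int_sgn g) * x, y + real_of_int g) = a + int_sgn g * ?L (x, y)"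
    if "(x, y) \<in> bricks e" for a g x y
  proof -
    have "x \<notin> \<int>" using that by (simp add: bricks_def)
    note fl = floor_twist[OF this]
    show ?thesis unfolding prod.case tw fl by (simp add: int_sgn_def)
  qed
  show "openin (classifying_space KB) (classes_over (bricks e))"
    unfolding classes_over_def by (rule section_over_region(1)[OF op D L])
  show "section_exists (classes_over (bricks e))"
    unfolding classes_over_def by (rule section_over_region(2)[OF op D L])
qed

text \<open>
  A point outside the strips has half-integral abscissa, so it lies in a brick of one of the two
  patterns, whose horizontal boundaries are at different ordinates.
\<close>

lemma tc_le_2: "tc integer_group integer_group \<phi> d \<le> 2"
proof -
  define U :: "nat \<Rightarrow> (int \<times> int) nerve_point set set" where
    "U i = (if i = 0 then classes_over strips else if i = 1 then classes_over (bricks 0) else classes_over (bricks (1/2)))" for i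
  have op: "openin (classifying_space KB) (U i)" for i
    by (simp add: U_def section_over_strips(1) section_over_bricks(1))
  have sec: "section_exists (U i)" for i
    by (simp add: U_def section_over_strips(2) section_over_bricks(2))
  have half: "\<not> (x \<in> \<int> \<and> x + 1/2 \<in> \<int>)" for x :: real
  proof
    assume "x \<in> \<int> \<and> x + 1/2 \<in> \<int>"
    then have "(x + 1/2) - x \<in> \<int>" by (intro Ints_diff) auto
    then obtain j where "(x + 1/2) - x = real_of_int j" by (rule Ints_cases)
    then have "real_of_int (2 * j) = 1" by simp
    then have "2 * j = 1" by linarith
    then show False by presburger
  qed
  have cover: "(\<Union>i\<le>2. U i) = topspace (classifying_space KB)"
  proof (intro subset_antisym subsetI)
    fix y assume "y \<in> topspace (classifying_space KB)"
    then obtain x where x: "y = nerve_equiv KB `` {x}" "x \<in> topspace (nerve_sum KB)"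
      by (auto simp only: topspace_classifying_space elim!: quotientE)
    obtain a b where ab: "develop x = (a, b)" by (cases "develop x")
    have "(a, b) \<in> strips \<or> (a, b) \<in> bricks 0 \<or> (a, b) \<in> bricks (1/2)"
      using half[of a] half[of b] unfolding strips_def bricks_def by auto
    then have "y \<in> classes_over strips \<or> y \<in> classes_over (bricks 0) \<or> y \<in> classes_over (bricks (1/2))"
      using x ab unfolding classes_over_def by auto
    moreover have "classes_over strips = U 0" "classes_over (bricks 0) = U 1" "classes_over (bricks (1/2)) = U 2"
      by (simp_all add: U_def)
    ultimately show "y \<in> (\<Union>i\<le>2. U i)"
      by (auto intro: bexI[of _ "0::nat"] bexI[of _ "1::nat"] bexI[of _ "2::nat"])
  qed (use op openin_subset in blast)
  have "enat 2 \<in> {enat n | n. \<exists>U. (\<forall>i\<le>n. openin (classifying_space KB) (U i)) \<and>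
      (\<Union>i\<le>n. U i) = topspace (classifying_space KB) \<and> (\<forall>i\<le>n. section_exists (U i))}"
    using op sec cover by blast
  then show ?thesis
    unfolding tc_def parametrized_cat_def secat_def section_exists_def numeral_eq_enat
    by (rule Inf_lower)
qed

end

section \<open>Sign profiles\<close>

text \<open>
  The integral over \<open>[0, a]\<close> of the step function with values \<open>\<eta> (v\<^sub>i)\<close>.
\<close>

definition profile :: "('g \<Rightarrow> real) \<Rightarrow> 'g nerve_point \<Rightarrow> real \<Rightarrow> real" where
  "profile \<eta> = (\<lambda>((n, \<sigma>), t) a. \<Sum>i\<le>n. \<eta> (\<sigma> 0 i) * part_below t a i)"

text \<open>
  The profile of a point depends on the representative through a sign, which does not depend on \<open>a\<close>;
  the product of two of its values does not depend on the representative (\<open>profile_product_class\<close>).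
\<close>

definition profile_product :: "('g \<Rightarrow> real) \<Rightarrow> real \<Rightarrow> real \<Rightarrow> 'g nerve_point set \<Rightarrow> real" where
  "profile_product \<eta> a b c = (let x = SOME x. x \<in> c in profile \<eta> x a * profile \<eta> x b)"

lemma continuous_on_part_below_simplex: "continuous_on S (\<lambda>t. part_below t a i)"
  by (intro continuous_on_part_below continuous_on_id continuous_on_const)

text \<open>
  At the end of the first interval of positive length the integral is that length up to a factor.
\<close>

lemma profile_nonzero:
  assumes "x \<in> topspace (nerve_sum G)" "\<And>g. g \<in> carrier G \<Longrightarrow> \<eta> g \<noteq> 0"
  shows "\<exists>a. profile \<eta> x a \<noteq> 0"
proof -
  obtain n \<sigma> t where x: "x = ((n, \<sigma>), t)" "\<sigma> \<in> nerve G n" "t \<in> standard_simplex n"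
    using assms(1) by (auto simp: topspace_nerve_sum)
  note t = simplexD[OF x(3)]
  have "\<exists>i. t i \<noteq> 0"
  proof (rule ccontr)
    assume "\<not> (\<exists>i. t i \<noteq> 0)"
    then show False using t(4) by simp
  qed
  then obtain i where i: "t i \<noteq> 0" "\<And>l. l < i \<Longrightarrow> t l = 0"
    using exists_least_iff[of "\<lambda>i. t i \<noteq> 0"] by blast
  then have ti: "t i > 0" using t(1)[of i] by simp
  have "i \<le> n" using i(1) t(3)[of i] by force
  have lo: "(\<Sum>l<j. t l) = 0" if "j \<le> i" for j
    using that i(2) by (intro sum.neutral) auto
  have hi: "t i \<le> (\<Sum>l<j. t l)" if "i < j" for j
    using that t(1) by (intro member_le_sum) auto
  have pb: "part_below t (t i) j = (if j = i then t i else 0)" for j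
  proof (cases "j < i")
    case True then show ?thesis using lo[of j] lo[of "Suc j"] by (simp add: part_below_def)
  next
    case False
    show ?thesis
    proof (cases "j = i")
      case True then show ?thesis using lo[of i] ti by (simp add: part_below_def)
    next
      case neq: False
      then have "i < j" "i < Suc j" using False by auto
      from hi[OF this(1)] hi[OF this(2)] show ?thesis using neq by (simp add: part_below_def)
    qed
  qed
  have "profile \<eta> x (t i) = \<eta> (\<sigma> 0 i) * t i"
    unfolding x(1) profile_def prod.case pb
    using \<open>i \<le> n\<close> by (subst sum.remove[of _ i]) auto
  moreover have "\<eta> (\<sigma> 0 i) \<noteq> 0"
    using assms(2) nerve_in_carrier[OF x(2), of 0 i] \<open>i \<le> n\<close> by simp
  ultimately show ?thesis using i(1) by (intro exI[of _ "t i"]) simp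
qed

lemma profile_trivial:
  assumes "t \<in> standard_simplex n" "\<And>i. i \<le> n \<Longrightarrow> \<eta> (\<sigma> 0 i) = 1"
  shows "profile \<eta> ((n, \<sigma>), t) a = min a 1 - min a 0"
proof -
  have "profile \<eta> ((n, \<sigma>), t) a = (\<Sum>i<Suc n. part_below t a i)"
    using assms(2) by (simp add: profile_def lessThan_Suc_atMost)
  then show ?thesis
    using simplexD(4)[OF assms(1)] sum_part_below[of t a "Suc n"]
    by (simp add: lessThan_Suc_atMost)
qed

locale sign_character = group G for G (structure) +
  fixes \<eta> :: "'a \<Rightarrow> real"
  assumes \<eta>_mult: "x \<in> carrier G \<Longrightarrow> y \<in> carrier G \<Longrightarrow> \<eta> (x \<otimes> y) = \<eta> x * \<eta> y"
    and \<eta>_sign: "x \<in> carrier G \<Longrightarrow> \<eta> x = 1 \<or> \<eta> x = - 1"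
begin

lemma profile_glue:
  assumes \<theta>: "order_map m n \<theta>" and \<sigma>: "\<sigma> \<in> nerve G n"
  shows "profile \<eta> ((n, \<sigma>), simplex_push m \<theta> t) a =
    \<eta> (\<sigma> 0 (\<theta> 0)) * profile \<eta> ((m, nerve_pullback m \<theta> \<sigma>), t) a"
proof -
  have \<theta>n: "\<theta> i \<le> n" if "i \<le> m" for i using \<theta> that by (auto simp: order_map_def)
  have \<theta>0: "\<theta> 0 \<le> \<theta> i" if "i \<le> m" for i using \<theta> that by (auto simp: order_map_def mono_on_def)
  have vert: "\<eta> (\<sigma> 0 (\<theta> i)) = \<eta> (\<sigma> 0 (\<theta> 0)) * \<eta> (nerve_pullback m \<theta> \<sigma> 0 i)" if "i \<le> m" for i
  proof -
    have "\<sigma> 0 (\<theta> 0) \<otimes> \<sigma> (\<theta> 0) (\<theta> i) = \<sigma> 0 (\<theta> i)"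
      using \<sigma> \<theta>n[OF that] \<theta>0[OF that] by (auto simp: nerve_def)
    moreover have "\<sigma> 0 (\<theta> 0) \<in> carrier G" "\<sigma> (\<theta> 0) (\<theta> i) \<in> carrier G"
      using nerve_in_carrier[OF \<sigma>] \<theta>n[OF that] \<theta>n[of 0] \<theta>0[OF that] by auto
    ultimately show ?thesis using \<eta>_mult that by (metis nerve_pullback_def zero_le)
  qed
  have "profile \<eta> ((n, \<sigma>), simplex_push m \<theta> t) a = (\<Sum>j\<le>n. simplex_push m \<theta> (part_below t a) j * \<eta> (\<sigma> 0 j))"
    unfolding profile_def prod.case simplex_push_part_below[OF \<theta>] by (simp add: mult.commute)
  also have "\<dots> = (\<Sum>i\<le>m. part_below t a i * \<eta> (\<sigma> 0 (\<theta> i)))"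
    by (rule sum_simplex_push_mult[OF \<theta>])
  also have "\<dots> = \<eta> (\<sigma> 0 (\<theta> 0)) * profile \<eta> ((m, nerve_pullback m \<theta> \<sigma>), t) a"
    unfolding profile_def prod.case sum_distrib_left
  proof (rule sum.cong)
    show "part_below t a i * \<eta> (\<sigma> 0 (\<theta> i)) =
        \<eta> (\<sigma> 0 (\<theta> 0)) * (\<eta> (nerve_pullback m \<theta> \<sigma> 0 i) * part_below t a i)" if "i \<in> {..m}" for i
      using vert[of i] that by (simp only: atMost_iff) simp
  qed simp
  finally show ?thesis .
qed

lemma profile_product_class:
  assumes x: "x \<in> topspace (nerve_sum G)"
  shows "profile_product \<eta> a b (nerve_equiv G `` {x}) = profile \<eta> x a * profile \<eta> x b"
proof -
  have "(x, x) \<in> nerve_equiv G" using x by (simp add: nerve_equiv_def)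
  then have some: "(x, SOME y. y \<in> nerve_equiv G `` {x}) \<in> nerve_equiv G"
    by (metis Image_singleton_iff someI_ex)
  have glue: "profile \<eta> x a * profile \<eta> x b = profile \<eta> y a * profile \<eta> y b"
    if xy: "(x, y) \<in> nerve_glue G" for x y
  proof -
    obtain m n \<theta> \<sigma> t where *: "x = ((m, nerve_pullback m \<theta> \<sigma>), t)" "y = ((n, \<sigma>), simplex_push m \<theta> t)"
      "order_map m n \<theta>" "\<sigma> \<in> nerve G n"
      using xy by (auto simp: nerve_glue_def)
    have "\<theta> 0 \<le> n" using *(3) by (auto simp: order_map_def)
    then have "\<eta> (\<sigma> 0 (\<theta> 0)) * \<eta> (\<sigma> 0 (\<theta> 0)) = 1"
      using \<eta>_sign[OF nerve_in_carrier[OF *(4), of 0 "\<theta> 0"]] by auto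
    then show ?thesis
      unfolding *(1,2) profile_glue[OF *(3,4)] by (simp add: mult_ac)
  qed
  show ?thesis
    unfolding profile_product_def Let_def
    using nerve_equiv_invariant[of G "\<lambda>x. profile \<eta> x a * profile \<eta> x b", OF glue some] by (rule sym)
qed

lemma continuous_map_profile_product:
  "continuous_map (classifying_space G) euclideanreal (profile_product \<eta> a b)"
proof (rule continuous_compose_quotient_map[OF quotient_map_classifying])
  have "continuous_map (nerve_sum G) euclideanreal (\<lambda>x. profile \<eta> x a * profile \<eta> x b)"
  proof (rule continuous_map_nerve_sum)
    fix n \<sigma>
    have "continuous_on (standard_simplex n) (\<lambda>t. profile \<eta> ((n, \<sigma>), t) a * profile \<eta> ((n, \<sigma>), t) b)"
      unfolding profile_def prod.case
      by (intro continuous_on_mult continuous_on_sum continuous_on_const continuous_on_part_below_simplex)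
    then show "continuous_map (simplex_top n) euclideanreal
        (\<lambda>t. profile \<eta> ((n, \<sigma>), t) a * profile \<eta> ((n, \<sigma>), t) b)"
      by (simp only: simplex_top_eq continuous_map_iff_continuous)
  qed
  then show "continuous_map (nerve_sum G) euclideanreal
      (profile_product \<eta> a b \<circ> (\<lambda>x. nerve_equiv G `` {x}))"
    by (rule continuous_map_eq) (simp add: profile_product_class)
qed

text \<open>
  The matrix of profile products at a point has rank one, and a nonzero vector that represents it is
  unique up to sign. The two choices are the sheets of the double covering of the character \<open>\<eta>\<close>.
\<close>

lemma profile_product_factors:
  assumes "c \<in> topspace (classifying_space G)"
  shows "\<exists>F. (\<forall>a b. profile_product \<eta> a b c = F a * F b) \<and> (\<exists>a. F a \<noteq> 0)"
proof -
  obtain x where x: "c = nerve_equiv G `` {x}" "x \<in> topspace (nerve_sum G)"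
    using assms unfolding topspace_classifying_space by (rule quotientE)
  have "\<eta> g \<noteq> 0" if "g \<in> carrier G" for g using \<eta>_sign[OF that] by auto
  then show ?thesis
    using profile_nonzero[OF x(2)] profile_product_class[OF x(2)] x(1) by blast
qed

end

section \<open>Unique lifting of square roots\<close>

lemma continuous_on_locally:
  assumes "\<And>x. x \<in> S \<Longrightarrow> \<exists>T. openin (top_of_set S) T \<and> x \<in> T \<and> continuous_on T f"
  shows "continuous_on S f"
  unfolding continuous_on_topological
proof (intro ballI allI impI)
  fix x B assume x: "x \<in> S" and B: "open B" "f x \<in> B"
  obtain O' where O': "open O'" "x \<in> S \<inter> O'" "continuous_on (S \<inter> O') f"
    using assms[OF x] unfolding openin_open by auto
  then obtain A where "open A" "x \<in> A" "\<forall>y\<in>S \<inter> O'. y \<in> A \<longrightarrow> f y \<in> B"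
    using B unfolding continuous_on_topological by meson
  then show "\<exists>A. open A \<and> x \<in> A \<and> (\<forall>y\<in>S. y \<in> A \<longrightarrow> f y \<in> B)"
    using O' by (intro exI[of _ "A \<inter> O'"]) auto
qed

lemma equal_products_sign:
  fixes f f' :: "'i \<Rightarrow> real"
  assumes "\<And>a b. f a * f b = f' a * f' b"
  shows "(\<forall>a. f a = f' a) \<or> (\<forall>a. f a = - f' a)"
proof (cases "\<exists>a. f a \<noteq> 0")
  case True
  then obtain a where a: "f a \<noteq> 0" by blast
  have "(f a - f' a) * (f a + f' a) = 0" using assms[of a a] by (simp add: algebra_simps)
  then consider "f' a = f a" | "f' a = - f a" by (auto simp: add_eq_0_iff)
  then show ?thesis
  proof cases
    case 1
    then have "f b = f' b" for b using assms[of a b] a by simp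
    then show ?thesis by blast
  next
    case 2
    have "f a * (f b + f' b) = 0" for b using assms[of a b] 2 by (simp add: algebra_simps)
    then show ?thesis using a by (auto simp: eq_neg_iff_add_eq_0)
  qed
next
  case False
  then have "f' a = 0" for a using assms[of a a] by simp
  then show ?thesis using False by auto
qed

lemma root_lift_unique:
  fixes f f' :: "'i \<Rightarrow> real \<Rightarrow> real"
  assumes f: "\<And>a. continuous_on {0..1} (f a)" and f': "\<And>a. continuous_on {0..1} (f' a)"
    and prod: "\<And>a b r. r \<in> {0..1} \<Longrightarrow> f a r * f b r = f' a r * f' b r"
    and nz: "\<And>r. r \<in> {0..1} \<Longrightarrow> \<exists>a. f a r \<noteq> 0"
    and start: "\<And>a. f a 0 = f' a 0" and r: "r \<in> {0..1}"
  shows "f a r = f' a r"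
proof -
  \<comment> \<open>The interval is the disjoint union of the closed sets where the roots are equal or opposite.\<close>
  define A where "A = {r \<in> {0..1}. \<forall>a. f a r = f' a r}"
  define B where "B = {r \<in> {0..1}. \<forall>a. f a r = - f' a r}"
  have AB: "r \<in> A \<or> r \<in> B" if r: "r \<in> {0..1}" for r
    using equal_products_sign[of "\<lambda>a. f a r" "\<lambda>a. f' a r", OF prod[OF r]] r
    by (auto simp: A_def B_def)
  have disj: "A \<inter> B = {}"
  proof (rule ccontr)
    assume "A \<inter> B \<noteq> {}"
    then obtain r where "r \<in> {0..1}" "\<And>a. f a r = f' a r" "\<And>a. f a r = - f' a r"
      unfolding A_def B_def by blast
    moreover from this obtain a where "f a r \<noteq> 0" using nz by blast
    ultimately show False by (metis equal_neg_zero)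
  qed
  have "A = (\<Inter>a. {r \<in> {0..1}. f a r - f' a r = 0})" "B = (\<Inter>a. {r \<in> {0..1}. f a r + f' a r = 0})"
    by (auto simp: A_def B_def add_eq_0_iff)
  moreover have "closedin (top_of_set {0..1}) (\<Inter>a. {r \<in> {0..1}. f a r - f' a r = 0})"
    by (intro closedin_INT continuous_closedin_preimage_constant continuous_on_diff f f') simp
  moreover have "closedin (top_of_set {0..1}) (\<Inter>a. {r \<in> {0..1}. f a r + f' a r = 0})"
    by (intro closedin_INT continuous_closedin_preimage_constant continuous_on_add f f') simp
  ultimately have "closedin (top_of_set {0..1}) A" "closedin (top_of_set {0..1}) B"
    by (simp_all only:)
  moreover have "A \<union> B = {0..1}" using AB unfolding A_def B_def by blast
  moreover have "connected {0..1::real}" by simp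
  moreover have "0 \<in> A" using start by (simp add: A_def)
  ultimately have "B = {}" using disj unfolding connected_closedin_eq by blast
  then show ?thesis using AB[OF r] by (auto simp: A_def)
qed

text \<open>
  A family, over \<open>V \<times> [0, 1]\<close>, of nonzero symmetric matrices \<open>q\<close> of rank one. The vectors \<open>f\<close> with
  \<open>q a b = f a * f b\<close> form a double covering of the base, and paths lift to it uniquely,
  continuously in parameters. The index set may be infinite, which is why this covering is handled
  by hand and not as a covering of subsets of Euclidean spaces.
\<close>

locale rank_one_family =
  fixes V :: "'z::metric_space set" and q :: "'i \<Rightarrow> 'i \<Rightarrow> 'z \<times> real \<Rightarrow> real"
  assumes cont: "\<And>a b. continuous_on (V \<times> {0..1}) (q a b)"
    and factors: "\<And>y. y \<in> V \<times> {0..1} \<Longrightarrow>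
      \<exists>F. (\<forall>a b. q a b y = F a * F b) \<and> (\<exists>a. F a \<noteq> 0)"
begin

definition root_on :: "('z \<times> real) set \<Rightarrow> ('i \<Rightarrow> 'z \<times> real \<Rightarrow> real) \<Rightarrow> bool" where
  "root_on Y f \<longleftrightarrow> (\<forall>a. continuous_on Y (f a)) \<and> (\<forall>a b. \<forall>y\<in>Y. q a b y = f a y * f b y)"

lemma root_on_nonzero:
  assumes "root_on Y f" "y \<in> Y" "y \<in> V \<times> {0..1}"
  shows "\<exists>a. f a y \<noteq> 0"
proof -
  obtain F a where "\<forall>a b. q a b y = F a * F b" "F a \<noteq> 0" using factors[OF assms(3)] by blast
  then have "q a a y \<noteq> 0" by simp
  then have "f a y * f a y \<noteq> 0" using assms(1,2) by (simp add: root_on_def)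
  then show ?thesis by auto
qed

definition continues :: "'z set \<Rightarrow> real \<Rightarrow> real \<Rightarrow> bool" where
  "continues N s r \<longleftrightarrow> (\<forall>g. root_on (N \<times> {s}) (\<lambda>a y. g a (fst y)) \<longrightarrow>
      (\<exists>f. root_on (N \<times> {s..r}) f \<and> (\<forall>a. \<forall>z\<in>N. f a (z, s) = g a z)))"

text \<open>
  Square roots over the time \<open>s\<close> can be continued up to the time \<open>r\<close>, over a neighbourhood of \<open>z0\<close>
  that serves all of its subsets at once. The latter makes the property transitive. Intervals
  outside of \<open>[0, 1]\<close> are admitted, with nothing claimed, so that \<open>Bolzano\<close> applies.
\<close>

definition extends :: "'z \<Rightarrow> real \<Rightarrow> real \<Rightarrow> bool" where
  "extends z0 s r \<longleftrightarrow> ({s..r} \<subseteq> {0..1} \<longrightarrow>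
    (\<exists>\<delta>>0. \<forall>N \<subseteq> V \<inter> ball z0 \<delta>. continues N s r))"

text \<open>
  Where a diagonal entry \<open>q c c\<close> is positive, \<open>q c a / sqrt (q c c)\<close> is a root, unique up to the sign
  that is dictated by \<open>g c\<close> at the time \<open>s\<close>.
\<close>

lemma extends_local:
  assumes z0: "z0 \<in> V" and x: "0 \<le> x" "x \<le> 1"
  shows "\<exists>d>0. \<forall>s r. s \<le> x \<and> x \<le> r \<and> r - s < d \<longrightarrow> extends z0 s r"
proof -
  have y0: "(z0, x) \<in> V \<times> {0..1}" using z0 x by simp
  obtain F c where F: "\<forall>a b. q a b (z0, x) = F a * F b" "F c \<noteq> 0" using factors[OF y0] by blast
  then have pos: "q c c (z0, x) > 0" by (metis not_real_square_gt_zero)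
  obtain d where d: "d > 0"
    "\<And>y. y \<in> V \<times> {0..1} \<Longrightarrow> dist y (z0, x) < d \<Longrightarrow> dist (q c c y) (q c c (z0, x)) < q c c (z0, x)"
    using cont[of c c] y0 pos unfolding continuous_on_iff by blast
  have near: "q c c (z, r) > 0" if "z \<in> V" "r \<in> {0..1}" "dist z0 z < d / 2" "\<bar>r - x\<bar> < d / 2" for z r
  proof -
    have "dist (z, r) (z0, x) \<le> dist z z0 + \<bar>r - x\<bar>"
      unfolding dist_Pair_Pair dist_real_def by (rule order_trans[OF sqrt_sum_squares_le_sum]) auto
    then have "dist (z, r) (z0, x) < d" using that(3,4) by (simp add: dist_commute)
    then have "\<bar>q c c (z, r) - q c c (z0, x)\<bar> < q c c (z0, x)"
      using d(2)[of "(z, r)"] that(1,2) by (simp add: dist_real_def)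
    then show ?thesis by linarith
  qed
  have "extends z0 s r" if sr: "s \<le> x" "x \<le> r" "r - s < d / 2" for s r
    unfolding extends_def continues_def
  proof (intro impI exI[of _ "d / 2"] conjI allI)
    show "d / 2 > 0" using d by simp
    fix N g assume I: "{s..r} \<subseteq> {0..1}" and N: "N \<subseteq> V \<inter> ball z0 (d / 2)"
      and g: "root_on (N \<times> {s}) (\<lambda>a y. g a (fst y))"
    \<comment> \<open>The last factor is the sign of \<open>g c\<close>.\<close>
    define f where "f a y = q c a y / sqrt (q c c y) * (g c (fst y) / sqrt (q c c (fst y, s)))" for a y
    have NV: "y \<in> V \<times> {0..1}" if "y \<in> N \<times> {s..r}" for y using that N I by auto
    have posN: "q c c y > 0" if "y \<in> N \<times> {s..r}" for y
    proof -
      have y: "fst y \<in> N" "s \<le> snd y" "snd y \<le> r" using that by auto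
      then have "\<bar>snd y - x\<bar> < d / 2" using sr by linarith
      then have "q c c (fst y, snd y) > 0" using y N I by (intro near) auto
      then show ?thesis by simp
    qed
    have s_in: "(fst y, s) \<in> N \<times> {s..r}" if "y \<in> N \<times> {s..r}" for y
      using that sr by auto
    have g_prod: "q a b (z, s) = g a z * g b z" if "z \<in> N" for a b z
      using g that by (simp add: root_on_def)
    have "continuous_on N (g c)"
    proof -
      have "continuous_on N ((\<lambda>y. g c (fst y)) \<circ> (\<lambda>z. (z, s)))"
        using g by (intro continuous_on_compose continuous_on_Pair continuous_on_id continuous_on_const)
          (auto simp: root_on_def elim: continuous_on_subset)
      then show ?thesis by (simp add: o_def)
    qed
    then have gc: "continuous_on (N \<times> {s..r}) (\<lambda>y. g c (fst y))"
      by (rule continuous_on_compose2) (auto intro: continuous_on_fst continuous_on_id)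
    have qc: "continuous_on (N \<times> {s..r}) (q c a)" for a
      using cont[of c a] NV by (auto intro: continuous_on_subset)
    have qs: "continuous_on (N \<times> {s..r}) (\<lambda>y. q c c (fst y, s))"
      by (rule continuous_on_compose2[OF qc[of c]])
        (use s_in in \<open>auto intro!: continuous_on_Pair continuous_on_fst continuous_on_id continuous_on_const\<close>)
    have "continuous_on (N \<times> {s..r}) (f a)" for a
      unfolding f_def
      by (intro continuous_on_mult continuous_on_divide continuous_on_real_sqrt qc qs gc)
        (use posN s_in in \<open>force\<close>)+
    moreover have "q a b y = f a y * f b y" if y: "y \<in> N \<times> {s..r}" for a b y
    proof -
      obtain F where F: "\<forall>a b. q a b y = F a * F b" using factors[OF NV[OF y]] by blast
      have 1: "sqrt (q c c y) * sqrt (q c c y) = F c * F c" "F c \<noteq> 0"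
        using posN[OF y] F by auto
      have 2: "sqrt (q c c (fst y, s)) * sqrt (q c c (fst y, s)) = g c (fst y) * g c (fst y)" "g c (fst y) \<noteq> 0"
        using posN[OF s_in[OF y]] g_prod[of "fst y" c c] y by auto
      have "f a y * f b y = (F c * F a * (F c * F b)) / (sqrt (q c c y) * sqrt (q c c y)) *
          (g c (fst y) * g c (fst y) / (sqrt (q c c (fst y, s)) * sqrt (q c c (fst y, s))))"
      proof -
        have qF: "q c a y = F c * F a" "q c b y = F c * F b" using F by auto
        have "x / S * (u / T) * (x' / S * (u / T)) = x * x' / (S * S) * (u * u / (T * T))"
          for x x' S T u :: real by (simp add: mult_ac)
        then show ?thesis unfolding f_def qF .
      qed
      also have "\<dots> = F a * F b" unfolding 1 2 using 1(2) 2(2) by simp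
      finally show ?thesis using F by simp
    qed
    moreover have "f a (z, s) = g a z" if z: "z \<in> N" for a z
    proof -
      have zs: "(z, s) \<in> N \<times> {s..r}" using z sr by auto
      have 2: "sqrt (q c c (z, s)) * sqrt (q c c (z, s)) = g c z * g c z" "g c z \<noteq> 0"
        using posN[OF zs] g_prod[OF z, of c c] by auto
      have "f a (z, s) = (g c z * g a z * g c z) / (sqrt (q c c (z, s)) * sqrt (q c c (z, s)))"
        using g_prod[OF z, of c a] by (simp add: f_def)
      also have "\<dots> = g a z" unfolding 2 using 2(2) by simp
      finally show ?thesis .
    qed
    ultimately show "\<exists>f. root_on (N \<times> {s..r}) f \<and> (\<forall>a. \<forall>z\<in>N. f a (z, s) = g a z)"
      unfolding root_on_def by blast
  qed
  then show ?thesis using d(1) by (intro exI[of _ "d / 2"]) auto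
qed

lemma extends_trans:
  assumes 1: "extends z0 s r" and 2: "extends z0 r w" and le: "s \<le> r" "r \<le> w"
  shows "extends z0 s w"
  unfolding extends_def
proof (intro impI)
  assume I: "{s..w} \<subseteq> {0..1}"
  have "{s..r} \<subseteq> {0..1}" "{r..w} \<subseteq> {0..1}" using I le by auto
  with 1 2 have "\<exists>\<delta>>0. \<forall>N \<subseteq> V \<inter> ball z0 \<delta>. continues N s r"
    "\<exists>\<delta>>0. \<forall>N \<subseteq> V \<inter> ball z0 \<delta>. continues N r w"
    unfolding extends_def by simp_all
  then obtain \<delta>1 \<delta>2 where \<delta>: "\<delta>1 > 0" "\<delta>2 > 0"
    and e1: "\<And>N. N \<subseteq> V \<inter> ball z0 \<delta>1 \<Longrightarrow> continues N s r"
    and e2: "\<And>N. N \<subseteq> V \<inter> ball z0 \<delta>2 \<Longrightarrow> continues N r w"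
    by (elim exE conjE) auto
  have "continues N s w" if N: "N \<subseteq> V \<inter> ball z0 (min \<delta>1 \<delta>2)" for N
    unfolding continues_def
  proof (intro allI impI)
    fix g assume g: "root_on (N \<times> {s}) (\<lambda>a y. g a (fst y))"
    have "N \<subseteq> V \<inter> ball z0 \<delta>1" "N \<subseteq> V \<inter> ball z0 \<delta>2" using N by (auto simp: subset_iff)
    then have c: "continues N s r" "continues N r w" using e1 e2 by simp_all
    obtain f1 where f1: "root_on (N \<times> {s..r}) f1" "\<And>a z. z \<in> N \<Longrightarrow> f1 a (z, s) = g a z"
      using c(1) g unfolding continues_def by meson
    have "root_on (N \<times> {r}) (\<lambda>a y. f1 a (fst y, r))"
      unfolding root_on_def
    proof (intro conjI allI ballI)
      show "continuous_on (N \<times> {r}) (\<lambda>y. f1 a (fst y, r))" for a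
        by (rule continuous_on_compose2[of "N \<times> {s..r}" "f1 a"])
          (use f1(1) le in \<open>auto simp: root_on_def intro!: continuous_on_Pair continuous_on_fst
            continuous_on_id continuous_on_const\<close>)
      show "q a b y = f1 a (fst y, r) * f1 b (fst y, r)" if "y \<in> N \<times> {r}" for a b y
        using f1(1) that le by (cases y) (auto simp: root_on_def)
    qed
    then obtain f2 where f2: "root_on (N \<times> {r..w}) f2" "\<And>a z. z \<in> N \<Longrightarrow> f2 a (z, r) = f1 a (z, r)"
      using c(2)[unfolded continues_def, rule_format, of "\<lambda>a z. f1 a (z, r)"] by auto
    define f where "f a y = (if snd y \<le> r then f1 a y else f2 a y)" for a y
    have "root_on (N \<times> {s..w}) f"
      unfolding root_on_def
    proof (intro conjI allI ballI)
      show "continuous_on (N \<times> {s..w}) (f a)" for a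
        unfolding f_def
      proof (rule continuous_on_cases_le)
        have "{y \<in> N \<times> {s..w}. snd y \<le> r} = N \<times> {s..r}" "{y \<in> N \<times> {s..w}. r \<le> snd y} = N \<times> {r..w}"
          using le by auto
        then show "continuous_on {y \<in> N \<times> {s..w}. snd y \<le> r} (f1 a)"
          "continuous_on {y \<in> N \<times> {s..w}. r \<le> snd y} (f2 a)"
          using f1(1) f2(1) by (simp_all add: root_on_def)
        show "continuous_on (N \<times> {s..w}) snd" by (intro continuous_on_snd continuous_on_id)
        show "f1 a y = f2 a y" if "y \<in> N \<times> {s..w}" "snd y = r" for y
          using that f2(2)[of "fst y" a] by (cases y) auto
      qed
      show "q a b y = f a y * f b y" if "y \<in> N \<times> {s..w}" for a b y
        using that f1(1) f2(1) le unfolding root_on_def f_def by (cases "snd y \<le> r") auto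
    qed
    moreover have "f a (z, s) = g a z" if "z \<in> N" for a z using that f1(2) le by (simp add: f_def)
    ultimately show "\<exists>f. root_on (N \<times> {s..w}) f \<and> (\<forall>a. \<forall>z\<in>N. f a (z, s) = g a z)" by blast
  qed
  then show "\<exists>\<delta>>0. \<forall>N \<subseteq> V \<inter> ball z0 \<delta>. continues N s w"
    using \<delta> by (intro exI[of _ "min \<delta>1 \<delta>2"]) simp
qed

lemma root_on_unique:
  assumes "root_on ({z} \<times> {0..1}) f" "root_on ({z} \<times> {0..1}) f'" "z \<in> V"
    "\<And>a. f a (z, 0) = f' a (z, 0)" "r \<in> {0..1}"
  shows "f a (z, r) = f' a (z, r)"
proof (rule root_lift_unique[of "\<lambda>a r. f a (z, r)" "\<lambda>a r. f' a (z, r)" r a])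
  have c: "continuous_on {0..1} (\<lambda>r. h (z, r))" if "continuous_on ({z} \<times> {0..1}) h" for h :: "'z \<times> real \<Rightarrow> real"
    by (rule continuous_on_compose2[OF that]) (auto intro!: continuous_on_Pair continuous_on_id continuous_on_const)
  show "continuous_on {0..1} (\<lambda>r. f a (z, r))" "continuous_on {0..1} (\<lambda>r. f' a (z, r))" for a
    using assms(1,2) by (auto simp: root_on_def intro!: c)
  show "f a (z, r) * f b (z, r) = f' a (z, r) * f' b (z, r)" if "r \<in> {0..1}" for a b r
    using assms(1,2) that by (simp add: root_on_def)
  show "\<exists>a. f a (z, r) \<noteq> 0" if "r \<in> {0..1}" for r
    using root_on_nonzero[OF assms(1)] that assms(3) by simp
qed (use assms(4,5) in auto)

text \<open>
  Lifts exist near each parameter by compactness of \<open>[0, 1]\<close>, and they agree on overlaps by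
  uniqueness.
\<close>

lemma root_exists:
  assumes g: "root_on (V \<times> {0}) (\<lambda>a y. g a (fst y))"
  shows "\<exists>f. root_on (V \<times> {0..1}) f \<and> (\<forall>a. \<forall>z\<in>V. f a (z, 0) = g a z)"
proof -
  have "\<exists>\<delta>>0. \<exists>f. root_on ((V \<inter> ball z0 \<delta>) \<times> {0..1}) f \<and> (\<forall>a. \<forall>z\<in>V \<inter> ball z0 \<delta>. f a (z, 0) = g a z)"
    if z0: "z0 \<in> V" for z0
  proof -
    have "extends z0 0 1"
    proof (rule Bolzano)
      show "extends z0 a c" if "extends z0 a b" "extends z0 b c" "a \<le> b" "b \<le> c" for a b c
        using that by (rule extends_trans)
    qed (use extends_local[OF z0] in auto)
    then obtain \<delta> where \<delta>: "\<delta> > 0" "continues (V \<inter> ball z0 \<delta>) 0 1"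
      unfolding extends_def by auto
    have start: "root_on ((V \<inter> ball z0 \<delta>) \<times> {0}) (\<lambda>a y. g a (fst y))"
      using g unfolding root_on_def by (auto intro: continuous_on_subset)
    have "\<exists>f. root_on ((V \<inter> ball z0 \<delta>) \<times> {0..1}) f \<and>
        (\<forall>a. \<forall>z\<in>V \<inter> ball z0 \<delta>. f a (z, 0) = g a z)"
      using \<delta>(2)[unfolded continues_def, THEN spec[of _ g]] start by (rule mp)
    with \<delta>(1) show ?thesis by (intro exI[of _ \<delta>] conjI)
  qed
  then obtain \<delta> h where \<delta>: "\<And>z0. z0 \<in> V \<Longrightarrow> \<delta> z0 > 0"
    and h: "\<And>z0. z0 \<in> V \<Longrightarrow> root_on ((V \<inter> ball z0 (\<delta> z0)) \<times> {0..1}) (h z0)"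
    and h0: "\<And>z0 a z. z0 \<in> V \<Longrightarrow> z \<in> V \<inter> ball z0 (\<delta> z0) \<Longrightarrow> h z0 a (z, 0) = g a z"
    by metis
  \<comment> \<open>At each parameter the lift is taken from the neighbourhood chosen for this parameter.\<close>
  define f where "f a y = h (fst y) a y" for a y
  have f_eq: "f a y = h z0 a y" if z0: "z0 \<in> V" and yN: "y \<in> (V \<inter> ball z0 (\<delta> z0)) \<times> {0..1}" for z0 y a
  proof -
    obtain z r where y: "y = (z, r)" "z \<in> V" "z \<in> ball z0 (\<delta> z0)" "r \<in> {0..1}" using yN by auto
    have z: "z \<in> V \<inter> ball z (\<delta> z)" using \<delta>[OF y(2)] y(2) by simp
    have "h z a (z, r) = h z0 a (z, r)"
    proof (rule root_on_unique[OF _ _ y(2) _ y(4)])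
      show "root_on ({z} \<times> {0..1}) (h z)"
        using h[OF y(2)] z unfolding root_on_def by (auto intro: continuous_on_subset)
      show "root_on ({z} \<times> {0..1}) (h z0)"
        using h[OF z0] y unfolding root_on_def by (auto intro: continuous_on_subset)
      show "h z a (z, 0) = h z0 a (z, 0)" for a
        using h0[OF y(2) z] h0[OF z0, of z] y by simp
    qed
    then show ?thesis by (simp add: f_def y(1))
  qed
  have "root_on (V \<times> {0..1}) f"
    unfolding root_on_def
  proof (intro conjI allI ballI)
    show "q a b y = f a y * f b y" if y: "y \<in> V \<times> {0..1}" for a b y
    proof -
      have "fst y \<in> V" "y \<in> (V \<inter> ball (fst y) (\<delta> (fst y))) \<times> {0..1}" using y \<delta> by auto
      then show ?thesis using h[of "fst y"] unfolding f_def root_on_def by blast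
    qed
    show "continuous_on (V \<times> {0..1}) (f a)" for a
    proof (rule continuous_on_locally)
      fix y :: "'z \<times> real" assume y: "y \<in> V \<times> {0..1}"
      define z0 where "z0 = fst y"
      define T where "T = (V \<inter> ball z0 (\<delta> z0)) \<times> {0..1::real}"
      have z0: "z0 \<in> V" using y by (auto simp: z0_def)
      have "T = (V \<times> {0..1}) \<inter> (ball z0 (\<delta> z0) \<times> UNIV)" by (auto simp: T_def)
      moreover have "open (ball z0 (\<delta> z0) \<times> (UNIV :: real set))" by (intro open_Times) simp_all
      ultimately have "openin (top_of_set (V \<times> {0..1})) T" unfolding openin_open by blast
      moreover have "y \<in> T" using y \<delta>[OF z0] by (auto simp: T_def z0_def)
      moreover have "continuous_on T (h z0 a)" using h[OF z0] by (simp add: root_on_def T_def)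
      then have "continuous_on T (f a)"
        by (rule continuous_on_eq) (simp add: T_def f_eq[OF z0])
      ultimately show "\<exists>T. openin (top_of_set (V \<times> {0..1})) T \<and> y \<in> T \<and> continuous_on T (f a)"
        by blast
    qed
  qed
  moreover have "f a (z, 0) = g a z" if "z \<in> V" for a z
    using h0[OF that, of z a] \<delta>[OF that] that by (simp add: f_def)
  ultimately show ?thesis by blast
qed

end

section \<open>Evaluation of paths and functions on the square\<close>

lemma continuous_on_vanishing_product:
  fixes \<rho> e :: "'a::topological_space \<Rightarrow> real"
  assumes \<rho>: "continuous_on S \<rho>" and V: "openin (top_of_set S) V" and e: "continuous_on V e"
    and bound: "\<And>x. x \<in> V \<Longrightarrow> \<bar>e x\<bar> \<le> 1" and zero: "\<And>x. x \<in> S \<Longrightarrow> x \<notin> V \<Longrightarrow> \<rho> x = 0"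
  shows "continuous_on S (\<lambda>x. \<rho> x * e x)"
  unfolding continuous_on_topological
proof (intro ballI allI impI)
  fix x B assume x: "x \<in> S" and B: "open B" "\<rho> x * e x \<in> B"
  show "\<exists>A. open A \<and> x \<in> A \<and> (\<forall>y\<in>S. y \<in> A \<longrightarrow> \<rho> y * e y \<in> B)"
  proof (cases "x \<in> V")
    case True
    have "continuous_on V (\<lambda>x. \<rho> x * e x)"
      using openin_imp_subset[OF V] by (intro continuous_on_mult e continuous_on_subset[OF \<rho>])
    then obtain A where A: "open A" "x \<in> A" "\<forall>y\<in>V. y \<in> A \<longrightarrow> \<rho> y * e y \<in> B"
      using B True unfolding continuous_on_topological by meson
    obtain O' where "open O'" "V = S \<inter> O'" using V unfolding openin_open by blast
    then show ?thesis using A True by (intro exI[of _ "A \<inter> O'"]) auto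
  next
    case False
    then have 0: "\<rho> x = 0" using zero x by blast
    then have "0 \<in> B" using B(2) by simp
    then obtain r where r: "r > 0" "ball 0 r \<subseteq> B" using openE[OF B(1)] by blast
    have "\<rho> x \<in> ball 0 r" using 0 r by simp
    then obtain A where A: "open A" "x \<in> A" "\<forall>y\<in>S. y \<in> A \<longrightarrow> \<rho> y \<in> ball 0 r"
      using \<rho> x unfolding continuous_on_topological by (meson open_ball)
    have "\<rho> y * e y \<in> B" if y: "y \<in> S" "y \<in> A" for y
    proof (cases "y \<in> V")
      case True
      have "\<bar>\<rho> y * e y\<bar> \<le> \<bar>\<rho> y\<bar> * 1"
        unfolding abs_mult by (intro mult_left_mono bound True) simp
      moreover have "\<bar>\<rho> y\<bar> < r" using A y by simp
      ultimately have "\<rho> y * e y \<in> ball 0 r" by (simp add: dist_real_def)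
      then show ?thesis using r by blast
    next
      case False
      then have "\<rho> y * e y = 0" using zero[OF y(1)] by simp
      then show ?thesis using r by auto
    qed
    then show ?thesis using A by blast
  qed
qed

text \<open>
  Evaluation of paths is jointly continuous because the unit interval is locally compact.
\<close>

lemma continuous_on_evaluation:
  fixes V :: "'z::topological_space set" and \<sigma> :: "'z \<Rightarrow> real \<Rightarrow> 'x"
  assumes \<sigma>: "continuous_map (top_of_set V) (compact_open (top_of_set {0..1}) X) \<sigma>"
    and \<phi>: "continuous_map X euclideanreal \<phi>"
  shows "continuous_on (V \<times> {0..1}) (\<lambda>y. \<phi> (\<sigma> (fst y) (snd y)))"
  unfolding continuous_on_topological
proof (intro ballI allI impI)
  fix y :: "'z \<times> real" and B assume y: "y \<in> V \<times> {0..1}" and B: "open B" "\<phi> (\<sigma> (fst y) (snd y)) \<in> B"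
  obtain z r where zr: "y = (z, r)" "z \<in> V" "r \<in> {0..1}" using y by auto
  define W where "W = {c \<in> topspace X. \<phi> c \<in> B}"
  have W: "openin X W"
    unfolding W_def using openin_continuous_map_preimage[OF \<phi>, of B] B(1) by simp
  have mem: "\<alpha> \<in> extensional {0..1} \<and> continuous_map (top_of_set {0..1}) X \<alpha>"
    if "\<alpha> \<in> topspace (compact_open (top_of_set {0..1::real}) X)" for \<alpha>
    using that unfolding compact_open_def topology_generated_by_topspace by auto
  have \<sigma>z: "continuous_map (top_of_set {0..1}) X (\<sigma> z')" "\<sigma> z' \<in> extensional {0..1}" if "z' \<in> V" for z'
    using mem[of "\<sigma> z'"] continuous_map_image_subset_topspace[OF \<sigma>] that by auto
  have "openin (top_of_set {0..1}) {u \<in> {0..1}. \<sigma> z u \<in> W}"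
    using openin_continuous_map_preimage[OF \<sigma>z(1)[OF zr(2)] W] by simp
  moreover have "r \<in> {u \<in> {0..1}. \<sigma> z u \<in> W}"
    using zr B(2) continuous_map_image_subset_topspace[OF \<sigma>z(1)[OF zr(2)]] by (auto simp: W_def)
  ultimately obtain e where e: "e > 0" "cball r e \<inter> {0..1} \<subseteq> {u \<in> {0..1}. \<sigma> z u \<in> W}"
    unfolding openin_contains_cball by blast
  define C where "C = cball r e \<inter> {0..1}"
  define N where "N = {\<alpha> \<in> extensional (topspace (top_of_set {0..1::real})).
      continuous_map (top_of_set {0..1}) X \<alpha> \<and> \<alpha> ` C \<subseteq> W}"
  have "compactin (top_of_set {0..1}) C"
    by (auto simp: C_def compactin_subtopology intro!: compact_Int)
  then have "openin (compact_open (top_of_set {0..1}) X) N"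
    unfolding compact_open_def N_def using W by (intro topology_generated_by_Basis) blast
  from openin_continuous_map_preimage[OF \<sigma> this]
  have "openin (top_of_set V) {z' \<in> V. \<sigma> z' \<in> N}" by simp
  then obtain O' where O': "open O'" "{z' \<in> V. \<sigma> z' \<in> N} = V \<inter> O'"
    unfolding openin_open by blast
  have "z \<in> O'"
  proof -
    have "\<sigma> z \<in> N" using \<sigma>z[OF zr(2)] e(2) by (auto simp: N_def C_def)
    then show ?thesis using O'(2) zr(2) by blast
  qed
  moreover have "\<phi> (\<sigma> (fst y') (snd y')) \<in> B" if "y' \<in> V \<times> {0..1}" "y' \<in> O' \<times> ball r e" for y'
  proof -
    have "fst y' \<in> V \<inter> O'" using that by auto
    then have "\<sigma> (fst y') \<in> N" unfolding O'(2)[symmetric] by simp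
    moreover have "snd y' \<in> C" using that by (auto simp: C_def)
    ultimately show ?thesis by (auto simp: N_def W_def)
  qed
  ultimately show "\<exists>A. open A \<and> y \<in> A \<and> (\<forall>y\<in>V \<times> {0..1}. y \<in> A \<longrightarrow> \<phi> (\<sigma> (fst y) (snd y)) \<in> B)"
    using e(1) O'(1) zr(1) by (intro exI[of _ "O' \<times> ball r e"]) (auto intro: open_Times)
qed

abbreviation unit_square :: "(real \<times> real) set" where
  "unit_square \<equiv> {0..1} \<times> {0..1}"

lemma exp_constant_imp_constant:
  fixes D :: "real \<Rightarrow> complex"
  assumes D: "continuous_on {0..1} D" and exp: "\<And>r. r \<in> {0..1} \<Longrightarrow> exp (D r) = w"
  shows "D 0 = D 1"
proof -
  have "D constant_on {0..1}"
  proof (rule continuous_discrete_range_constant[OF _ D])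
    show "\<exists>e>0. \<forall>s. s \<in> {0..1} \<and> D s \<noteq> D r \<longrightarrow> e \<le> norm (D s - D r)" if r: "r \<in> {0..1}" for r
    proof (intro exI[of _ 1] conjI allI impI)
      fix s assume s: "s \<in> {0..1} \<and> D s \<noteq> D r"
      then have "exp (D s) = exp (D r)" using exp r by simp
      then obtain n :: int where n: "D s = D r + (of_int (2 * n) * pi) * \<i>"
        unfolding exp_eq by blast
      then have "n \<noteq> 0" using s by auto
      then have "1 \<le> \<bar>real_of_int n\<bar>" by linarith
      then have "1 * 1 \<le> \<bar>real_of_int n\<bar> * (2 * pi)" using pi_ge_two by (intro mult_mono) auto
      also have "\<dots> = norm (D s - D r)" using n by (simp add: norm_mult)
      finally show "1 \<le> norm (D s - D r)" by simp
    qed simp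
  qed simp
  then show ?thesis by (auto simp: constant_on_def)
qed

text \<open>
  A continuous logarithm \<open>L\<close> exists on the square. The difference of \<open>L\<close> between the right and the left edge
  is constant, and so is the difference between a point of the top edge and the point of the bottom edge
  to which it is glued. Comparing the corners, the first difference at the top is the negative of the
  first difference at the bottom, so it is zero. But its
  exponential is \<open>- 1\<close>.
\<close>

lemma no_odd_function_on_klein_square:
  fixes g :: "real \<times> real \<Rightarrow> complex"
  assumes g: "continuous_on unit_square g" and nz: "\<And>z. z \<in> unit_square \<Longrightarrow> g z \<noteq> 0"
    and side: "\<And>b. b \<in> {0..1} \<Longrightarrow> g (1, b) = - g (0, b)"
    and top: "\<And>a. a \<in> {0..1} \<Longrightarrow> g (a, 1) = w * g (1 - a, 0)"
  shows False
proof -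
  have "contractible unit_square"
    by (intro convex_imp_contractible convex_Times) auto
  then obtain L where L: "continuous_on unit_square L" "\<And>z. z \<in> unit_square \<Longrightarrow> g z = exp (L z)"
    using continuous_logarithm_on_contractible[OF g _ nz] by metis
  have cont: "continuous_on {0..1} (\<lambda>r::real. L (h r))"
    if "continuous_on {0..1} h" "h \<in> {0..1} \<rightarrow> unit_square" for h :: "real \<Rightarrow> real \<times> real"
    by (rule continuous_on_compose2[OF L(1) that(1)]) (rule funcset_image[OF that(2)])
  have "L (1, 0) - L (0, 0) = L (1, 1) - L (0, 1)"
  proof (rule exp_constant_imp_constant)
    show "continuous_on {0..1} (\<lambda>b. L (1, b) - L (0, b))"
      by (intro continuous_on_diff cont continuous_on_Pair continuous_on_const continuous_on_id) auto
    show "exp (L (1, b) - L (0, b)) = - 1" if "b \<in> {0..1}" for b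
    proof -
      have "exp (L (1, b)) = - exp (L (0, b))"
        using L(2)[of "(1, b)"] L(2)[of "(0, b)"] side[OF that] that by simp
      then show ?thesis by (simp add: exp_diff)
    qed
  qed
  moreover have "L (0, 1) - L (1 - 0, 0) = L (1, 1) - L (1 - 1, 0)"
  proof (rule exp_constant_imp_constant)
    show "continuous_on {0..1} (\<lambda>a. L (a, 1) - L (1 - a, 0))"
      by (intro continuous_on_diff cont continuous_on_Pair continuous_on_const continuous_on_id) auto
    show "exp (L (a, 1) - L (1 - a, 0)) = w" if "a \<in> {0..1}" for a
    proof -
      have "exp (L (a, 1)) = w * exp (L (1 - a, 0))"
        using L(2)[of "(a, 1)"] L(2)[of "(1 - a, 0)"] top[OF that] that by simp
      then show ?thesis by (simp add: exp_diff)
    qed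
  qed
  ultimately have "2 * (L (1, 0) - L (0, 0)) = 0" by (simp only: diff_self diff_zero) algebra
  then have "L (1, 0) = L (0, 0)" by simp
  then have "g (1, 0) = g (0, 0)" using L(2)[of "(1, 0)"] L(2)[of "(0, 0)"] by simp
  then show False using side[of 0] nz[of "(0, 0)"] by simp
qed

section \<open>The Klein bottle inside its classifying space\<close>

text \<open>
  Barycentric coordinates on the square, cut along the diagonal into the triangles with the vertices
  \<open>0, 1, 2\<close> and \<open>0, 2, 3\<close>, numbered in the order \<open>(0, 0), (1, 0), (1, 1), (0, 1)\<close>. Both are faces of one
  3-simplex. With this order the four edges are traversed in the directions in which they are
  identified in the Klein bottle.
\<close>

definition square_weights :: "real \<times> real \<Rightarrow> nat \<Rightarrow> real" where
  "square_weights = (\<lambda>(a, b) j. if j = 0 then 1 - max a b else if j = 1 then a - min a b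
    else if j = 2 then min a b else if j = 3 then b - min a b else 0)"

definition edge_weights :: "nat \<Rightarrow> nat \<Rightarrow> real \<Rightarrow> nat \<Rightarrow> real" where
  "edge_weights i l r j = (if j = i then 1 - r else if j = l then r else 0)"

lemma square_weights_in:
  assumes "z \<in> unit_square"
  shows "square_weights z \<in> standard_simplex 3"
proof (rule simplexI)
  show "0 \<le> square_weights z i" for i
    using assms by (auto simp: square_weights_def split: prod.splits)
  show "square_weights z i = 0" if "i > 3" for i
    using that by (simp add: square_weights_def split: prod.splits)
  show "(\<Sum>i\<le>3. square_weights z i) = 1"
    by (cases z) (simp add: square_weights_def numeral_3_eq_3 max_def min_def)
qed

lemma continuous_on_square_weights: "continuous_on S square_weights"
proof (rule continuous_on_coordinatewise_then_product)
  fix j :: nat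
  have *: "continuous_on S (\<lambda>z::real \<times> real. fst z)" "continuous_on S (\<lambda>z::real \<times> real. snd z)"
    by (intro continuous_on_fst continuous_on_snd continuous_on_id)+
  consider "j = 0" | "j = 1" | "j = 2" | "j = 3" | "j > 3" by linarith
  then show "continuous_on S (\<lambda>z. square_weights z j)"
    by cases (simp_all add: square_weights_def case_prod_unfold
        continuous_on_diff continuous_on_max continuous_on_min *)
qed

lemma square_weights_sides:
  assumes "r \<in> {0..1}"
  shows "square_weights (0, r) = edge_weights 0 3 r" "square_weights (1, r) = edge_weights 1 2 r"
    "square_weights (r, 1) = edge_weights 2 3 (1 - r)" "square_weights (1 - r, 0) = edge_weights 0 1 (1 - r)"
  using assms by (auto simp: square_weights_def edge_weights_def fun_eq_iff)

text \<open>
  An embedding of the Klein bottle into Euclidean space. All coordinates are invariant under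
  \<open>(1, b) \<sim> (0, b)\<close> and \<open>(a, 1) \<sim> (1 - a, 0)\<close>, and they separate
  points that are not identified. Distances in the image
  give functions on the square that respect the identifications.
\<close>

definition square_embedding :: "real \<times> real \<Rightarrow> real \<times> real \<times> real \<times> real \<times> real" where
  "square_embedding = (\<lambda>(a, b). (a * (1 - a), b * (1 - b), b * (1 - b) * (1 - 2 * b),
    a * (1 - a) * (1 - 2 * a) * (1 - 2 * b), a * (1 - a) * (1 - 2 * a) * (b * (1 - b))))"

text \<open>
  The symmetric functions \<open>x (1 - x)\<close> determine \<open>a\<close> and \<open>b\<close> up to reflection. The odd function
  \<open>\<beta>\<close>, which vanishes only at the ends and in the middle, recovers the direction.
\<close>

lemma square_embedding_fibres:
  fixes f :: "real \<times> real \<Rightarrow> 'b"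
  assumes side: "\<And>b. b \<in> {0..1} \<Longrightarrow> f (1, b) = f (0, b)"
    and top: "\<And>a. a \<in> {0..1} \<Longrightarrow> f (a, 1) = f (1 - a, 0)"
    and z: "z \<in> unit_square" "z' \<in> unit_square" "square_embedding z = square_embedding z'"
  shows "f z = f z'"
proof -
  obtain a b a' b' where ab: "z = (a, b)" "z' = (a', b')" by (cases z; cases z')
  have I: "a \<in> {0..1}" "b \<in> {0..1}" "a' \<in> {0..1}" "b' \<in> {0..1}" using z(1,2) ab by auto
  have e: "a * (1 - a) = a' * (1 - a')" "b * (1 - b) = b' * (1 - b')"
    "b * (1 - b) * (1 - 2 * b) = b' * (1 - b') * (1 - 2 * b')"
    "a * (1 - a) * (1 - 2 * a) * (1 - 2 * b) = a' * (1 - a') * (1 - 2 * a') * (1 - 2 * b')"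
    "a * (1 - a) * (1 - 2 * a) * (b * (1 - b)) = a' * (1 - a') * (1 - 2 * a') * (b' * (1 - b'))"
    using z(3) unfolding ab square_embedding_def prod.case prod.inject by blast+
  have quad: "x' = x \<or> x' = 1 - x" if "x * (1 - x) = x' * (1 - x')" for x x' :: real
  proof -
    have "(x' - x) * (x' - (1 - x)) = 0" using that by (simp add: algebra_simps)
    then show ?thesis by auto
  qed
  have a': "a' = a \<or> a' = 1 - a" by (rule quad[OF e(1)])
  define \<beta> where "\<beta> x = x * (1 - x) * (1 - 2 * x)" for x :: real
  have \<beta>_odd: "\<beta> (1 - x) = - \<beta> x" for x by (simp add: \<beta>_def algebra_simps)
  have \<beta>_zero: "x = 0 \<or> x = 1 \<or> x = 1 - x" if "\<beta> x = 0" for x using that by (auto simp: \<beta>_def)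
  show ?thesis
  proof (cases "b' = b")
    case True
    have "\<beta> a = \<beta> a'"
    proof (cases "1 - 2 * b = 0")
      case True
      then have "b = 1 / 2" by simp
      then show ?thesis using e(5) \<open>b' = b\<close> by (simp add: \<beta>_def)
    next
      case False
      then show ?thesis using e(4) True by (simp add: \<beta>_def)
    qed
    then have "a' = a \<or> \<beta> a = 0" using a' \<beta>_odd[of a] by auto
    then have "a' = a \<or> a = 0 \<and> a' = 1 \<or> a = 1 \<and> a' = 0" using a' \<beta>_zero[of a] by auto
    then show ?thesis using True ab side[OF I(2)] by auto
  next
    case False
    then have b': "b' = 1 - b" using quad[OF e(2)] by simp
    have "\<beta> b = \<beta> (1 - b)" using e(3) unfolding b' \<beta>_def .
    then have "\<beta> b = 0" using \<beta>_odd[of b] by simp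
    then have b: "b = 0 \<or> b = 1" using False b' \<beta>_zero[of b] by auto
    have "\<beta> a = - \<beta> a'" using e(4) b b' by (auto simp: \<beta>_def)
    then have "a' = 1 - a \<or> \<beta> a = 0" using a' by auto
    then have "a' = 1 - a \<or> a' = a \<and> (a = 0 \<or> a = 1)" using a' \<beta>_zero[of a] by auto
    then show ?thesis
      using b b' ab top[OF I(1)] top[OF I(3)] top[of 0] top[of 1] side[of 0] by auto
  qed
qed

lemma square_embedding_sides:
  "square_embedding (1, b) = square_embedding (0, b)"
  "square_embedding (a, 1) = square_embedding (1 - a, 0)"
  by (simp_all add: square_embedding_def algebra_simps)

context klein
begin

text \<open>
  The reduction modulo 2 of \<open>height\<close> is a homomorphism, as signs do not matter, and it is trivial on
  the image of the section.
\<close>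

definition parity :: "int \<times> int \<Rightarrow> real" where
  "parity x = (if even (height x) then 1 else - 1)"

sublocale sign: sign_character KB parity
proof (intro sign_character.intro sign_character_axioms.intro)
  show "group KB" by (rule E.is_group)
  show "parity (x \<otimes>\<^bsub>KB\<^esub> y) = parity x * parity y" for x y
    by (simp add: parity_def height_mult int_sgn_def)
qed (simp add: parity_def)

text \<open>
  The corners of a fundamental domain: with \<open>x = (1, 0)\<close> and \<open>t = (0, 1)\<close> they are
  \<open>1, x, x t\<close> and \<open>t\<close>, where \<open>t = x t x\<close>.
\<close>

definition square_vertex :: "nat \<Rightarrow> int \<times> int" where
  "square_vertex j = (if j = 0 then (0, 0) else if j = 1 then (1, 0) else if j = 2 then (1, 1) else (0, 1))"

definition square_point :: "real \<times> real \<Rightarrow> (int \<times> int) nerve_point" where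
  "square_point z = ((3, vertex_simplex KB 3 square_vertex), square_weights z)"

definition klein_map :: "real \<times> real \<Rightarrow> (int \<times> int) nerve_point set" where
  "klein_map z = nerve_equiv KB `` {square_point z}"

lemma one_K: "\<one>\<^bsub>KB\<^esub> = (0, 0)" by (simp add: semidirect_def)

lemma d_zero: "d 0 = 0" using d_add[of 0 0] by (simp add: int_sgn_def)

lemma square_point_in: "z \<in> unit_square \<Longrightarrow> square_point z \<in> topspace (nerve_sum KB)"
  using vertex_simplex_in_nerve[OF E.is_group, of 3 square_vertex] square_weights_in
  by (simp add: square_point_def topspace_nerve_sum)

lemma continuous_map_klein_map:
  "continuous_map (top_of_set unit_square) (classifying_space KB) klein_map"
proof -
  have "continuous_map (top_of_set unit_square) (simplex_top 3) square_weights"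
    unfolding simplex_top_eq continuous_map_in_subtopology
    using square_weights_in continuous_on_square_weights by auto
  moreover have "vertex_simplex KB 3 square_vertex \<in> nerve KB 3"
    by (rule vertex_simplex_in_nerve[OF E.is_group]) simp
  ultimately have "continuous_map (top_of_set unit_square) (classifying_space KB)
    ((\<lambda>t. nerve_equiv KB `` {((3, vertex_simplex KB 3 square_vertex), t)}) \<circ> square_weights)"
    using continuous_map_compose continuous_map_simplex_class by blast
  then show ?thesis by (simp add: o_def klein_map_def[abs_def] square_point_def)
qed

text \<open>
  On an edge two of the four coordinates vanish, so its image is the 1-simplex of its two vertices.
\<close>

lemma edge_class:
  assumes il: "i < l" "l \<le> 3" and r: "r \<in> {0..1}"
  shows "nerve_equiv KB `` {((3, vertex_simplex KB 3 square_vertex), edge_weights i l r)} =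
    nerve_equiv KB `` {((1, vertex_simplex KB 1 (\<lambda>j. if j = 0 then square_vertex i else square_vertex l)),
      edge_weights 0 1 r)}"
proof (rule vertex_simplex_class_eq[symmetric, OF E.is_group, where \<theta> = "\<lambda>j. if j = 0 then i else l"])
  show "order_map 1 3 (\<lambda>j. if j = 0 then i else l)"
    using il by (auto simp: order_map_def mono_on_def)
  show "edge_weights 0 1 r \<in> standard_simplex 1"
    by (rule simplexI) (use r in \<open>auto simp: edge_weights_def\<close>)
  show "edge_weights i l r = simplex_push 1 (\<lambda>j. if j = 0 then i else l) (edge_weights 0 1 r)"
  proof
    fix j
    have "{k::nat. k \<le> 1 \<and> (if k = 0 then i else l) = j} = (if j = i then {0} else if j = l then {1} else {})"
      using il by (auto simp: le_Suc_eq split: if_splits)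
    then show "edge_weights i l r j = simplex_push 1 (\<lambda>j. if j = 0 then i else l) (edge_weights 0 1 r) j"
      using il by (simp add: simplex_push_def edge_weights_def)
  qed
qed auto

lemma edge_translate:
  assumes "square_vertex i' = \<gamma> \<otimes>\<^bsub>KB\<^esub> square_vertex i" "square_vertex l' = \<gamma> \<otimes>\<^bsub>KB\<^esub> square_vertex l"
  shows "vertex_simplex KB 1 (\<lambda>j. if j = 0 then square_vertex i' else square_vertex l') =
    vertex_simplex KB 1 (\<lambda>j. if j = 0 then square_vertex i else square_vertex l)"
proof -
  have "(\<lambda>j. if j = 0 then square_vertex i' else square_vertex l') =
      (\<lambda>j::nat. \<gamma> \<otimes>\<^bsub>KB\<^esub> (if j = 0 then square_vertex i else square_vertex l))"
    using assms by auto
  then show ?thesis by (simp only:) (rule vertex_simplex_translate[OF E.is_group], simp_all)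
qed

lemma klein_map_sides:
  assumes "r \<in> {0..1}"
  shows "klein_map (1, r) = klein_map (0, r)" "klein_map (r, 1) = klein_map (1 - r, 0)"
proof -
  have r: "1 - r \<in> {0..1}" using assms by auto
  have "vertex_simplex KB 1 (\<lambda>j. if j = 0 then square_vertex 1 else square_vertex 2) =
    vertex_simplex KB 1 (\<lambda>j. if j = 0 then square_vertex 0 else square_vertex 3)"
    by (rule edge_translate[where \<gamma> = "(1, 0)"]) (simp_all add: square_vertex_def int_sgn_def)
  then show "klein_map (1, r) = klein_map (0, r)"
    unfolding klein_map_def square_point_def square_weights_sides[OF assms]
    using edge_class[of 1 2 r] edge_class[of 0 3 r] assms by simp
  have "vertex_simplex KB 1 (\<lambda>j. if j = 0 then square_vertex 2 else square_vertex 3) =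
    vertex_simplex KB 1 (\<lambda>j. if j = 0 then square_vertex 0 else square_vertex 1)"
    by (rule edge_translate[where \<gamma> = "(1, 1)"]) (simp_all add: square_vertex_def int_sgn_def)
  then show "klein_map (r, 1) = klein_map (1 - r, 0)"
    unfolding klein_map_def square_point_def square_weights_sides[OF assms]
    using edge_class[of 2 3 "1 - r"] edge_class[of 0 1 "1 - r"] r by simp
qed

abbreviation square_profile :: "real \<times> real \<Rightarrow> real \<Rightarrow> real" where
  "square_profile z \<equiv> profile parity (square_point z)"

lemma square_profile_eq:
  "square_profile z r = part_below (square_weights z) r 0 - part_below (square_weights z) r 1 +
    parity (1, 1) * (part_below (square_weights z) r 2 - part_below (square_weights z) r 3)"
proof -
  have v: "vertex_simplex KB 3 square_vertex 0 i = square_vertex i" if "i \<le> 3" for i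
  proof -
    have "inv\<^bsub>KB\<^esub> square_vertex 0 = \<one>\<^bsub>KB\<^esub>" by (simp add: square_vertex_def flip: one_K)
    then show ?thesis using that by (simp add: vertex_simplex_def)
  qed
  have p: "parity (0, 0) = 1" "parity (1, 0) = - 1" "parity (0, 1) = - parity (1, 1)"
    by (simp_all add: parity_def height_def d_zero)
  have "square_profile z r = (\<Sum>i\<le>3. parity (square_vertex i) * part_below (square_weights z) r i)"
    unfolding profile_def square_point_def prod.case by (intro sum.cong) (simp_all add: v)
  then show ?thesis
    by (simp add: numeral_3_eq_3 numeral_2_eq_2 square_vertex_def p algebra_simps)
qed

text \<open>
  Identified points of the square lift the same point of the Klein bottle, and the lifts differ by a deck
  transformation: \<open>x\<close> for the vertical edges and \<open>x t\<close> for the horizontal ones. The profiles differ by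
  its parity.
\<close>

lemma square_profile_sides:
  assumes "b \<in> {0..1}"
  shows "square_profile (1, b) r = - square_profile (0, b) r"
    "square_profile (b, 1) r = parity (1, 1) * square_profile (1 - b, 0) r"
proof -
  have "parity (1, 1) = 1 \<or> parity (1, 1) = - 1" by (simp add: parity_def)
  then show "square_profile (1, b) r = - square_profile (0, b) r"
    "square_profile (b, 1) r = parity (1, 1) * square_profile (1 - b, 0) r"
    unfolding square_profile_eq square_weights_sides[OF assms]
    by (elim disjE; simp add: part_below_def edge_weights_def numeral_3_eq_3 numeral_2_eq_2)+
qed

lemma continuous_on_square_profile: "continuous_on S (\<lambda>z. square_profile z r)"
  unfolding square_profile_eq
  by (intro continuous_on_add continuous_on_diff continuous_on_mult continuous_on_const
      continuous_on_part_below continuous_on_square_weights)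

lemma square_profile_nonzero: "z \<in> unit_square \<Longrightarrow> \<exists>r. square_profile z r \<noteq> 0"
  by (rule profile_nonzero[OF square_point_in]) (auto simp: parity_def)

text \<open>
  On the image of the section all signs are \<open>1\<close>, so the profile is the length of
  \<open>[0, a] \<inter> [0, 1]\<close>.
\<close>

lemma profile_product_on_section:
  assumes c: "c \<in> topspace (classifying_space KB)"
    and sec: "c = classifying_map KB (\<lambda>g. (d g, g)) (classifying_map integer_group snd c)"
  shows "profile_product parity a b c = (min a 1 - min a 0) * (min b 1 - min b 0)"
proof -
  obtain x where x: "c = nerve_equiv KB `` {x}" "x \<in> topspace (nerve_sum KB)"
    using c unfolding topspace_classifying_space by (rule quotientE)
  define y where "y = nerve_map (\<lambda>g. (d g, g)) (nerve_map snd x)"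
  have in1: "nerve_map snd x \<in> topspace (nerve_sum integer_group)"
    by (rule nerve_map_in[OF E.is_group G.is_group p x(2)])
  have yin: "y \<in> topspace (nerve_sum KB)"
    unfolding y_def by (rule nerve_map_in[OF G.is_group E.is_group s in1])
  have cy: "c = nerve_equiv KB `` {y}"
    using sec unfolding x(1) classifying_map_class[OF E.is_group G.is_group p x(2)]
      classifying_map_class[OF G.is_group E.is_group s in1] y_def .
  obtain n \<sigma> t where nst: "x = ((n, \<sigma>), t)" "t \<in> standard_simplex n"
    using x(2) by (auto simp: topspace_nerve_sum)
  have "profile parity y a = min a 1 - min a 0" for a
    unfolding y_def nst(1) nerve_map_def prod.case
    by (rule profile_trivial[OF nst(2)]) (simp add: parity_def height_def)
  then show ?thesis unfolding cy sign.profile_product_class[OF yin] by simp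
qed

text \<open>
  The number \<open>e z\<close> compares two roots at the point \<open>klein_map z\<close>: the one that is transported from the
  image of \<open>B(s\<^sub>d)\<close> along the path of the given section, and the one that is given by the coordinates of
  the square. The first depends on the point of \<open>X\<close> only, the second changes by signs on the edges.
\<close>

lemma section_sign:
  assumes sec: "section_exists U"
  defines "V \<equiv> {z \<in> unit_square. klein_map z \<in> U}"
  obtains e :: "real \<times> real \<Rightarrow> real" where "continuous_on V e" "\<And>z. z \<in> V \<Longrightarrow> e z = 1 \<or> e z = - 1"
    "\<forall>z\<in>V. \<forall>z'\<in>V. \<forall>w. klein_map z' = klein_map z \<and> (w = 1 \<or> w = - 1) \<and>
      (\<forall>r. square_profile z' r = w * square_profile z r) \<longrightarrow> e z' = w * e z"
proof -
  let ?X = "classifying_space KB"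
  let ?P = "fibre_path_space ?X (classifying_map integer_group snd) (classifying_map KB (\<lambda>g. (d g, g)))"
  obtain s where s: "continuous_map (subtopology ?X U) ?P s" "\<And>y. y \<in> U \<Longrightarrow> s y 1 = y"
    using sec unfolding section_exists_def by blast
  define \<sigma> where "\<sigma> z = s (klein_map z)" for z
  have "continuous_map (top_of_set V) (subtopology ?X U) klein_map"
  proof -
    have "continuous_map (top_of_set V) ?X klein_map"
      using continuous_map_from_subtopology_mono[OF continuous_map_klein_map, of V] by (auto simp: V_def)
    then show ?thesis by (auto simp: continuous_map_in_subtopology V_def)
  qed
  from continuous_map_compose[OF this s(1)] have \<sigma>P: "continuous_map (top_of_set V) ?P \<sigma>"
    by (simp add: o_def \<sigma>_def[abs_def])
  then have \<sigma>: "continuous_map (top_of_set V) (compact_open (top_of_set {0..1}) ?X) \<sigma>"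
    unfolding fibre_path_space_def continuous_map_in_subtopology by blast
  have \<sigma>_in: "\<sigma> z \<in> topspace ?P" if "z \<in> V" for z
    using continuous_map_image_subset_topspace[OF \<sigma>P] that by auto
  have \<sigma>_path: "\<sigma> z r \<in> topspace ?X" if "z \<in> V" "r \<in> {0..1}" for z r
  proof -
    have "\<sigma> z \<in> topspace (compact_open (top_of_set {0..1::real}) ?X)"
      using \<sigma>_in[OF that(1)] by (simp add: fibre_path_space_def)
    then have "continuous_map (top_of_set {0..1}) ?X (\<sigma> z)"
      unfolding compact_open_def topology_generated_by_topspace by auto
    then show ?thesis using that(2) continuous_map_image_subset_topspace by fastforce
  qed
  have \<sigma>0: "\<sigma> z 0 = classifying_map KB (\<lambda>g. (d g, g)) (classifying_map integer_group snd (\<sigma> z 0))"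
    if "z \<in> V" for z
    using \<sigma>_in[OF that] unfolding fibre_path_space_def topspace_subtopology by blast
  define q where "q a b y = profile_product parity a b (\<sigma> (fst y) (snd y))" for a b y
  interpret rank_one_family V q
  proof
    show "continuous_on (V \<times> {0..1}) (q a b)" for a b
      unfolding q_def by (rule continuous_on_evaluation[OF \<sigma> sign.continuous_map_profile_product])
    show "\<exists>F. (\<forall>a b. q a b y = F a * F b) \<and> (\<exists>a. F a \<noteq> 0)" if "y \<in> V \<times> {0..1}" for y
      unfolding q_def by (rule sign.profile_product_factors[OF \<sigma>_path]) (use that in auto)
  qed
  have "root_on (V \<times> {0}) (\<lambda>a y. min a 1 - min a 0)"
    unfolding root_on_def q_def
    using profile_product_on_section[OF \<sigma>_path \<sigma>0] by auto
  from root_exists[of "\<lambda>a z. min a 1 - min a 0", OF this]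
  obtain f where f: "root_on (V \<times> {0..1}) f" and f0: "\<And>a z. z \<in> V \<Longrightarrow> f a (z, 0) = min a 1 - min a 0"
    by blast
  have f1: "f a (z, 1) * f b (z, 1) = square_profile z a * square_profile z b" if "z \<in> V" for a b z
  proof -
    have "f a (z, 1) * f b (z, 1) = profile_product parity a b (\<sigma> z 1)"
      using f that by (simp add: root_on_def q_def)
    also have "\<sigma> z 1 = klein_map z" using s(2)[of "klein_map z"] that by (simp add: \<sigma>_def V_def)
    also have "profile_product parity a b (klein_map z) = square_profile z a * square_profile z b"
      unfolding klein_map_def
      by (rule sign.profile_product_class[OF square_point_in]) (use that in \<open>simp add: V_def\<close>)
    finally show ?thesis .
  qed
  define e where "e z = (if \<forall>a. f a (z, 1) = square_profile z a then 1 else - 1 :: real)" for z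
  have e: "f a (z, 1) = e z * square_profile z a" if "z \<in> V" for a z
    using equal_products_sign[of "\<lambda>a. f a (z, 1)" "square_profile z", OF f1[OF that]] by (auto simp: e_def)
  have nz: "\<exists>r. square_profile z r \<noteq> 0" if "z \<in> V" for z
    using square_profile_nonzero that by (simp add: V_def)
  show thesis
  proof (rule that)
    show "continuous_on V e"
    proof (rule continuous_on_locally)
      fix z assume z: "z \<in> V"
      obtain a where a: "square_profile z a \<noteq> 0" using nz[OF z] by blast
      define T where "T = {z \<in> V. square_profile z a \<noteq> 0}"
      have "T = V \<inter> (\<lambda>z. square_profile z a) -` (- {0})" by (auto simp: T_def)
      then have "openin (top_of_set V) T"
        using continuous_openin_preimage_gen[OF continuous_on_square_profile[of V a], of "- {0}"]
        by (simp add: open_Compl)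
      moreover have "continuous_on T (\<lambda>z. f a (z, 1) / square_profile z a)"
      proof (intro continuous_on_divide continuous_on_square_profile)
        show "continuous_on T (\<lambda>z. f a (z, 1))"
          by (rule continuous_on_compose2[of "V \<times> {0..1}" "f a"])
            (use f in \<open>auto simp: root_on_def T_def intro!: continuous_on_Pair continuous_on_id continuous_on_const\<close>)
      qed (simp add: T_def)
      then have "continuous_on T e"
        by (rule continuous_on_eq) (simp add: T_def e)
      ultimately show "\<exists>T. openin (top_of_set V) T \<and> z \<in> T \<and> continuous_on T e"
        using z a by (intro exI[of _ T]) (simp add: T_def)
    qed
    show "e z = 1 \<or> e z = - 1" for z by (simp add: e_def)
    have "e z' = w * e z" if z: "z \<in> V" "z' \<in> V" and eq: "klein_map z' = klein_map z" and w: "w = 1 \<or> w = - 1"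
      and pr: "\<And>r. square_profile z' r = w * square_profile z r" for z z' w
    proof -
      have c: "continuous_on {0..1} (\<lambda>r. f a (z, r))" if "z \<in> V" for a z
        by (rule continuous_on_compose2[of "V \<times> {0..1}" "f a"])
          (use f that in \<open>auto simp: root_on_def intro!: continuous_on_Pair continuous_on_id continuous_on_const\<close>)
      have "f a (z, 1) = f a (z', 1)" for a
      proof (rule root_lift_unique[of "\<lambda>a r. f a (z, r)" "\<lambda>a r. f a (z', r)"])
        show "f a (z, r) * f b (z, r) = f a (z', r) * f b (z', r)" if "r \<in> {0..1}" for a b r
        proof -
          have "q a b (z, r) = q a b (z', r)" by (simp add: q_def \<sigma>_def eq)
          then show ?thesis using f z that by (simp add: root_on_def)
        qed
        show "\<exists>a. f a (z, r) \<noteq> 0" if "r \<in> {0..1}" for r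
          by (rule root_on_nonzero[OF f]) (use z that in auto)
      qed (use z c f0 in auto)
      then have "e z * square_profile z a = e z' * (w * square_profile z a)" for a
        using e[OF z(1)] e[OF z(2)] pr by simp
      then have "e z = e z' * w" using nz[OF z(1)] by auto
      then show ?thesis using w by auto
    qed
    then show "\<forall>z\<in>V. \<forall>z'\<in>V. \<forall>w. klein_map z' = klein_map z \<and> (w = 1 \<or> w = - 1) \<and>
      (\<forall>r. square_profile z' r = w * square_profile z r) \<longrightarrow> e z' = w * e z"
      by blast
  qed
qed

text \<open>
  The sign is multiplied by a function that vanishes exactly outside of the preimage of \<open>U\<close> and respects
  the identifications.
\<close>

lemma weighted_section_sign:
  assumes U: "openin (classifying_space KB) U" and sec: "section_exists U"
  obtains h :: "real \<times> real \<Rightarrow> real" where "continuous_on unit_square h"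
    "\<And>z. z \<in> unit_square \<Longrightarrow> klein_map z \<in> U \<Longrightarrow> h z \<noteq> 0"
    "\<And>b. b \<in> {0..1} \<Longrightarrow> h (1, b) = - h (0, b)"
    "\<And>a. a \<in> {0..1} \<Longrightarrow> h (a, 1) = parity (1, 1) * h (1 - a, 0)"
proof -
  define V where "V = {z \<in> unit_square. klein_map z \<in> U}"
  obtain e where e: "continuous_on V e" "\<And>z. z \<in> V \<Longrightarrow> e z = 1 \<or> e z = - 1"
    "\<forall>z\<in>V. \<forall>z'\<in>V. \<forall>w. klein_map z' = klein_map z \<and> (w = 1 \<or> w = - 1) \<and>
      (\<forall>r. square_profile z' r = w * square_profile z r) \<longrightarrow> e z' = w * e z"
    using section_sign[OF sec, folded V_def] by blast
  have V: "openin (top_of_set unit_square) V"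
    using openin_continuous_map_preimage[OF continuous_map_klein_map U] by (simp add: V_def)
  define A where "A = square_embedding ` (unit_square - V)"
  \<comment> \<open>The distance to the empty set is \<open>0\<close> by convention, hence the case distinction.\<close>
  define \<rho> where "\<rho> z = (if A = {} then 1 else infdist (square_embedding z) A)" for z
  have emb: "continuous_on S square_embedding" for S
    unfolding square_embedding_def case_prod_unfold
    by (intro continuous_intros)
  have "closed A"
  proof -
    have "closedin (top_of_set unit_square) (unit_square - V)"
      using V by (simp add: closedin_def) (metis Diff_Diff_Int Int_absorb1 openin_imp_subset)
    then have "compact (unit_square - V)"
      by (rule closedin_compact[rotated]) (intro compact_Times compact_Icc)
    then show ?thesis unfolding A_def by (intro compact_imp_closed compact_continuous_image emb)
  qed
  have \<rho>_pos: "\<rho> z \<noteq> 0" if z: "z \<in> V" for z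
  proof -
    have "square_embedding z \<notin> A"
    proof
      assume "square_embedding z \<in> A"
      then obtain z' where z': "z' \<in> unit_square" "z' \<notin> V" "square_embedding z = square_embedding z'"
        by (auto simp: A_def)
      have "klein_map z = klein_map z'"
        by (rule square_embedding_fibres[of klein_map]) (use z' z klein_map_sides in \<open>auto simp: V_def\<close>)
      then show False using z z' by (simp add: V_def)
    qed
    then show ?thesis
      using in_closed_iff_infdist_zero[OF \<open>closed A\<close>, of "square_embedding z"]
      by (cases "A = {}") (simp_all add: \<rho>_def)
  qed
  have \<rho>_zero: "\<rho> z = 0" if "z \<in> unit_square" "z \<notin> V" for z
  proof -
    have "square_embedding z \<in> A" using that by (auto simp: A_def)
    then show ?thesis by (auto simp: \<rho>_def)
  qed
  have \<rho>: "continuous_on unit_square \<rho>"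
    unfolding \<rho>_def by (cases "A = {}") (simp_all add: continuous_on_infdist emb)
  have inv: "\<rho> z' * e z' = w * (\<rho> z * e z)"
    if "z \<in> unit_square" "z' \<in> unit_square" "klein_map z' = klein_map z" "w = 1 \<or> w = - 1"
      "\<And>r. square_profile z' r = w * square_profile z r" "square_embedding z' = square_embedding z" for z z' w
  proof (cases "z \<in> V")
    case True
    then have "z' \<in> V" using that(2,3) by (simp add: V_def)
    then have "e z' = w * e z" using e(3) True that(3,4,5) by blast
    moreover have "\<rho> z' = \<rho> z" by (simp add: \<rho>_def that(6))
    ultimately show ?thesis by simp
  next
    case False
    then have "z' \<notin> V" using that(1,3) by (simp add: V_def)
    then show ?thesis using \<rho>_zero that(1,2) False by simp
  qed
  show thesis
  proof (rule that[of "\<lambda>z. \<rho> z * e z"])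
    show "continuous_on unit_square (\<lambda>z. \<rho> z * e z)"
      by (rule continuous_on_vanishing_product[OF \<rho> V e(1) _ \<rho>_zero]) (use e(2) in force)
    show "\<rho> z * e z \<noteq> 0" if "z \<in> unit_square" "klein_map z \<in> U" for z
      using \<rho>_pos[of z] e(2)[of z] that by (auto simp: V_def)
    show "\<rho> (1, b) * e (1, b) = - (\<rho> (0, b) * e (0, b))" if "b \<in> {0..1}" for b
      using inv[of "(0, b)" "(1, b)" "- 1"] klein_map_sides(1)[OF that] square_profile_sides(1)[OF that]
        square_embedding_sides(1)[of b] that by simp
    show "\<rho> (a, 1) * e (a, 1) = parity (1, 1) * (\<rho> (1 - a, 0) * e (1 - a, 0))" if "a \<in> {0..1}" for a
    proof (rule inv)
      show "parity (1, 1) = 1 \<or> parity (1, 1) = - 1" by (simp add: parity_def)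
    qed (use klein_map_sides(2)[OF that] square_profile_sides(2)[OF that] square_embedding_sides(2)[of a] that
        in auto)
  qed
qed

text \<open>
  The two weighted signs become the real and the imaginary part of a complex function. It has no zeros,
  since each part is nonzero on the preimage of one of the two sets.
\<close>

lemma no_two_sections:
  assumes U: "openin (classifying_space KB) U" "section_exists U"
    and U': "openin (classifying_space KB) U'" "section_exists U'"
    and cover: "U \<union> U' = topspace (classifying_space KB)"
  shows False
proof -
  obtain h where h: "continuous_on unit_square h"
    "\<And>z. z \<in> unit_square \<Longrightarrow> klein_map z \<in> U \<Longrightarrow> h z \<noteq> 0"
    "\<And>b. b \<in> {0..1} \<Longrightarrow> h (1, b) = - h (0, b)"
    "\<And>a. a \<in> {0..1} \<Longrightarrow> h (a, 1) = parity (1, 1) * h (1 - a, 0)"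
    using weighted_section_sign[OF U] by blast
  obtain h' where h': "continuous_on unit_square h'"
    "\<And>z. z \<in> unit_square \<Longrightarrow> klein_map z \<in> U' \<Longrightarrow> h' z \<noteq> 0"
    "\<And>b. b \<in> {0..1} \<Longrightarrow> h' (1, b) = - h' (0, b)"
    "\<And>a. a \<in> {0..1} \<Longrightarrow> h' (a, 1) = parity (1, 1) * h' (1 - a, 0)"
    using weighted_section_sign[OF U'] by blast
  show False
  proof (rule no_odd_function_on_klein_square[of "\<lambda>z. Complex (h z) (h' z)" "complex_of_real (parity (1, 1))"])
    show "continuous_on unit_square (\<lambda>z. Complex (h z) (h' z))"
      by (intro continuous_on_Complex h h')
    show "Complex (h z) (h' z) \<noteq> 0" if z: "z \<in> unit_square" for z
    proof -
      have "klein_map z \<in> topspace (classifying_space KB)"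
        unfolding klein_map_def by (rule class_in_classifying_space[OF square_point_in[OF z]])
      then have "h z \<noteq> 0 \<or> h' z \<noteq> 0" using cover h(2)[OF z] h'(2)[OF z] by blast
      then show ?thesis by (simp add: complex_eq_iff)
    qed
    show "Complex (h (1, b)) (h' (1, b)) = - Complex (h (0, b)) (h' (0, b))" if "b \<in> {0..1}" for b
      using h(3)[OF that] h'(3)[OF that] by (simp add: complex_eq_iff)
    show "Complex (h (a, 1)) (h' (a, 1)) = complex_of_real (parity (1, 1)) * Complex (h (1 - a, 0)) (h' (1 - a, 0))"
      if "a \<in> {0..1}" for a
      using h(4)[OF that] h'(4)[OF that] by (simp add: complex_eq_iff)
  qed
qed

lemma tc_ge_2: "2 \<le> tc integer_group integer_group \<phi> d"
  unfolding tc_def parametrized_cat_def secat_def section_exists_def[symmetric]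
proof (rule Inf_greatest)
  fix x assume "x \<in> {enat n | n. \<exists>U. (\<forall>i\<le>n. openin (classifying_space KB) (U i)) \<and>
      (\<Union>i\<le>n. U i) = topspace (classifying_space KB) \<and> (\<forall>i\<le>n. section_exists (U i))}"
  then obtain n U where n: "x = enat n" and op: "\<forall>i\<le>n. openin (classifying_space KB) (U i)"
    and cover: "(\<Union>i\<le>n. U i) = topspace (classifying_space KB)"
    and sec: "\<forall>i\<le>n. section_exists (U i)"
    by (elim CollectE exE conjE)
  show "2 \<le> x"
  proof (rule ccontr)
    assume "\<not> 2 \<le> x"
    then have "n \<le> 1" using n by (simp add: numeral_eq_enat)
    \<comment> \<open>This covers a single open set as well, which is then used twice.\<close>
    then have "{..n} = {0, n}" by auto
    then have "U 0 \<union> U n = topspace (classifying_space KB)" using cover by simp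
    then show False using no_two_sections[of "U 0" "U n"] op sec by simp
  qed
qed

end

section \<open>The complexity of a derivation for the Klein bottle\<close>

theorem proposition4p2:
  fixes \<phi> :: "int \<Rightarrow> int \<Rightarrow> int" and d :: "int \<Rightarrow> int"
  assumes "\<phi> \<in> hom integer_group (AutoGroup integer_group)"
    and "\<phi> 1 = (\<lambda>k. - k)"
    and "derivation integer_group integer_group \<phi> d"
  shows "tc integer_group integer_group \<phi> d = 2"
proof -
  interpret klein \<phi> d using assms by (rule klein.intro)
  show ?thesis using tc_le_2 tc_ge_2 by (rule antisym)
qed

end
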